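(* Let $m_0,m_1,\dots,m_N$ be regular moment functions of respective orders $s_0>0$ and $s_1,\dots,s_N\ge 1$, and consider the Cauchy problem $$(\ast)\quad\begin{cases}\partial_{m_0;t}^{\kappa}u-\displaystyle\sum_{n\in\mathcal I}\sum_{(\underline i,\underline q,\underline r)\in\Lambda_n}t^{v_{\underline i,\underline q,\underline r}}a_{\underline i,\underline q,\underline r}(t,x)\prod_{\ell=1}^n\left(\partial_{m_0;t}^{i_\ell}\partial_{m;x}^{q_\ell}u\right)^{r_\ell}=\widetilde f(t,x)\\ \partial_{m_0;t}^{j}u(t,x)_{|t=0}=\varphi_j(x),\quad 0\le j<\kappa\end{cases}$$ with data as specified in the context. Assume that $\sum_{\ell=1}^n r_\ell i_\ell-v_{\underline i,\underline q,\underline r}<\kappa$ for all $n\in\mathcal I$ and all $(\underline i,\underline q,\underline r)\in\Lambda_n$. Let $\widetilde u(t,x)\in\mathcal O(D_{\rho_1,\dots,\rho_N})[[t]]$ be the unique formal power series solution of $(\ast)$ and let $\sigma_c\ge0$ be the critical value of $(\ast)$. Then: 1. For every $\sigma\ge\sigma_c$, $\widetilde u(t,x)$ is $\sigma$-Gevrey if and only if $\widetilde f(t,x)$ is $\sigma$-Gevrey. 2. If $\widetilde f(t,x)$ is $\sigma$-Gevrey with $0\le\sigma<\sigma_c$, then $\widetilde u(t,x)$ is generically $\sigma_c$-Gevrey; that is, $\widetilde u(t,x)$ is $\sigma_c$-Gevrey, and in general this cannot be improved: for every $\sigma\ge0$ there exist an equation of the form $(\ast)$ (with regular moment functions $m_0,m_1,\dots,m_N$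 of respective orders $s_0>0$ and $s_1,\dots,s_N\ge1$, with data as specified in the context, and with $\sum_{\ell=1}^n r_\ell i_\ell-v_{\underline i,\underline q,\underline r}<\kappa$ for all $n\in\mathcal I$ and all $(\underline i,\underline q,\underline r)\in\Lambda_n$) with critical value $\sigma_c>\sigma$ and with a $\sigma$-Gevrey inhomogeneity, whose formal solution is $\sigma'$-Gevrey for no $0\le\sigma'<\sigma_c$.
   Context: Notation. $\mathbb N=\{0,1,2,\dots\}$, $\mathbb N^*=\mathbb N\setminus\{0\}$. $D_\rho=\{z\in\mathbb C:|z|<\rho\}$, $D_{\rho_0,\dots,\rho_N}=D_{\rho_0}\times\dots\times D_{\rho_N}$, $D_{\rho_1,\dots,\rho_N}=D_{\rho_1}\times\dots\times D_{\rho_N}$. $\mathcal O(U)$ is the set of holomorphic functions on $U$, and $\mathcal O(U)[[t]]$ the set of formal power series in $t$ with coefficients in $\mathcal O(U)$. $S_d(\alpha)=\{x\in\mathbb C:x\ne0,\ |\arg x-d|<\alpha/2\}$. Moment functions. Let $0<s<2$ and $k=1/s$. Kernel functions of order $s$ are pairs $(e,E)$ such that: (1) $e$ is holomorphic on $S_0(\pi s)$, $e(t)>0$ for $t>0$, $t^{-1}e(t)$ is integrable at zero, and for every $\varepsilon>0$ there are $A,B>0$ with $|e(x)|\le A\exp(-(|x|/B)^k)$ on $S_0(\pi s-\varepsilon)$; (2) $E$ is entire with global exponential growth of order at most $k$ at infinity, and $t^{-1}E(1/t)$ is integrable at zero in $S_\pi(\pi(2-s))$; (3) with $m(\lambda)=\int_0^{+\infty}t^{\lambda-1}e(t)\,dt$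 for $\mathrm{Re}(\lambda)\ge0$, one has $E(t)=\sum_{j\ge0}t^j/m(j)$ for all $t\in\mathbb C$. The function $m$ is called a moment function of order $s$. For general $s>0$, choose an integer $p\ge1$ with $s/p<2$; a kernel function of order $s$ is $e(t)=\hat e(t^{1/p})/p$, where $\hat e$ is the first member of a pair $(\hat e,\hat E)$ satisfying conditions (1), (2), (3) with $s$ replaced by $s/p$ and $k$ replaced by $p/s$, and the corresponding moment function of order $s$ is $m(\lambda)=\int_0^{+\infty}t^{\lambda-1}e(t)\,dt$. It is always assumed that $m(0)=1$. A moment function $m$ of order $s>0$ is regular if there are $a,A>0$ with $a(j+1)^s\le m(j+1)/m(j)\le A(j+1)^s$ for all $j\in\mathbb N$. Moment derivatives. For $\widetilde u=\sum_{j\ge0}u_{j,*}(x)\frac{t^j}{m_0(j)}$, $\partial_{m_0;t}\widetilde u=\sum_{j\ge0}u_{j+1,*}(x)\frac{t^j}{m_0(j)}$. The operator $\partial_{m_d;x_d}$ is defined in the same way on power series in $x_d$ (with $m_d$), acting on analytic functions via their Taylor expansion at $0$ and coefficientwise on formal series in $t$. For $q=(q_1,\dots,q_N)\in\mathbb N^N$, $\partial_{m;x}^q=\partial_{m_1;x_1}^{q_1}\cdots\partial_{m_N;x_N}^{q_N}$. Gevrey order. For $\sigma\ge0$, $\sum_{j\ge0}u_{j}(x)t^j\in\mathcal O(D_{\rho_1,\dots,\rho_N})[[t]]$ is $\sigma$-Gevrey if there are $0<r<\min\{\rho_1,\dots,\rho_N\}$ and $C,K>0$ with $|u_j(x)|\le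 CK^j\Gamma(1+\sigma j)$ for all $x\in D_{r,\dots,r}$ and all $j\ge0$. Data of the equation. $\kappa\ge1$ is an integer; $\mathcal I$ is a non-empty finite subset of $\mathbb N^*$; for $n\in\mathcal I$, $\Lambda_n$ is a non-empty finite set of $n$-tuples $(\underline i,\underline q,\underline r)=((i_1,q_1,r_1),\dots,(i_n,q_n,r_n))$ of elements of $\{0,\dots,\kappa-1\}\times\mathbb N^N\times\mathbb N^*$ whose pairs $(i_k,q_k)$ are pairwise distinct; $v_{\underline i,\underline q,\underline r}\in\mathbb N$; $a_{\underline i,\underline q,\underline r}\in\mathcal O(D_{\rho_0,\rho_1,\dots,\rho_N})$ with $a_{\underline i,\underline q,\underline r}(0,x)\not\equiv0$; $\widetilde f\in\mathcal O(D_{\rho_1,\dots,\rho_N})[[t]]$; $\varphi_j\in\mathcal O(D_{\rho_1,\dots,\rho_N})$. Under these conditions $(\ast)$ has a unique formal solution in $\mathcal O(D_{\rho_1,\dots,\rho_N})[[t]]$. Critical value. With $q_\ell=(q_{\ell,1},\dots,q_{\ell,N})$ put $\lambda(sq_\ell)=\sum_{d=1}^N s_dq_{\ell,d}$. Let $\mathcal S_n$ be the set of $(\underline i,\underline q,\underline r)\in\Lambda_n$ with $\sum_{\ell=1}^n(s_0r_\ell i_\ell+r_\ell\lambda(sq_\ell))>s_0\kappa$, and $\mathcal S=\bigcup_{n\in\mathcal I}\mathcal S_n$. Then $\sigma_c=0$ if $\mathcal S=\emptyset$, and otherwise $\sigma_c=1/k$ with $$k=\min_{n\in\mathcal I,\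 (\underline i,\underline q,\underline r)\in\mathcal S_n}\frac{\kappa+v_{\underline i,\underline q,\underline r}-\sum_{\ell=1}^n r_\ell i_\ell}{\sum_{\ell=1}^n(s_0r_\ell i_\ell+r_\ell\lambda(sq_\ell))-s_0\kappa}.$$ *)

theory Defs
  imports "HOL-Complex_Analysis.Complex_Analysis"
begin

text \<open>Here \<open>$\<close> denotes vector components only.\<close>

no_notation fps_nth (infixl "$" 75)

section \<open>Moment functions\<close>

text \<open>The argument of \<open>x\<close> is taken modulo \<open>2 * pi\<close>. All sectors used below have an opening
  smaller than \<open>2 * pi\<close>, so they are genuine subsets of the complex plane.\<close>

definition sector :: "real \<Rightarrow> real \<Rightarrow> complex set" where
  "sector d \<alpha> = {x. x \<noteq> 0 \<and> (\<exists>\<theta>. x = of_real (cmod x) * cis \<theta> \<and> \<bar>\<theta> - d\<bar> < \<alpha> / 2)}"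

definition integrable_at_zero_along :: "real \<Rightarrow> (complex \<Rightarrow> complex) \<Rightarrow> bool" where
  "integrable_at_zero_along \<theta> g \<longleftrightarrow>
     (\<exists>\<delta>>0. set_integrable lborel {0<..<\<delta>} (\<lambda>r::real. g (of_real r * cis \<theta>)))"

definition moment_integral :: "(complex \<Rightarrow> complex) \<Rightarrow> complex \<Rightarrow> complex" where
  "moment_integral e z =
     set_lebesgue_integral lborel {0<..} (\<lambda>t::real. of_real t powr (z - 1) * e (of_real t))"

text \<open>Kernel functions of order \<open>s\<close> (for \<open>0 < s < 2\<close>); here \<open>k = 1 / s\<close>.\<close>

definition kernel_pair :: "real \<Rightarrow> (complex \<Rightarrow> complex) \<Rightarrow> (complex \<Rightarrow> complex) \<Rightarrow> bool" where
  "kernel_pair s e E \<longleftrightarrow>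
     0 < s \<and> s < 2 \<and>
     e holomorphic_on sector 0 (pi * s) \<and>
     (\<forall>t::real. t > 0 \<longrightarrow> e (of_real t) \<in> \<real> \<and> Re (e (of_real t)) > 0) \<and>
     integrable_at_zero_along 0 (\<lambda>t. e t / t) \<and>
     (\<forall>\<epsilon>>0. \<exists>A>0. \<exists>B>0. \<forall>x\<in>sector 0 (pi * s - \<epsilon>).
        cmod (e x) \<le> A * exp (- ((cmod x / B) powr (1 / s)))) \<and>
     E holomorphic_on UNIV \<and>
     (\<exists>A>0. \<exists>B>0. \<forall>x. cmod (E x) \<le> A * exp ((cmod x / B) powr (1 / s))) \<and>
     (\<forall>\<theta>. \<bar>\<theta> - pi\<bar> < pi * (2 - s) / 2 \<longrightarrow> integrable_at_zero_along \<theta> (\<lambda>t. E (1 / t) / t)) \<and>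
     (\<forall>t. (\<lambda>j. t ^ j / moment_integral e (of_nat j)) sums E t)"

text \<open>Only the values of \<open>m\<close> on \<open>Re z \<ge> 0\<close> are constrained. For \<open>s < 2\<close>, the choice \<open>p = 1\<close>
  gives the moment function of a kernel function of order \<open>s\<close> itself.\<close>

definition moment_function :: "real \<Rightarrow> (complex \<Rightarrow> complex) \<Rightarrow> bool" where
  "moment_function s m \<longleftrightarrow>
     0 < s \<and> m 0 = 1 \<and>
     (\<exists>(p::nat) ehat Ehat. p \<ge> 1 \<and> kernel_pair (s / real p) ehat Ehat \<and>
        (\<forall>z. Re z \<ge> 0 \<longrightarrow>
           m z = moment_integral (\<lambda>t. ehat (t powr (1 / of_nat p)) / of_nat p) z))"

text \<open>The values of a moment function at natural numbers are positive reals, which is why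
  taking real parts is harmless.\<close>

definition regular_moment_function :: "real \<Rightarrow> (complex \<Rightarrow> complex) \<Rightarrow> bool" where
  "regular_moment_function s m \<longleftrightarrow>
     moment_function s m \<and>
     (\<exists>a>0. \<exists>A>0. \<forall>j::nat.
        a * real (j + 1) powr s \<le> Re (m (of_nat (j + 1)) / m (of_nat j)) \<and>
        Re (m (of_nat (j + 1)) / m (of_nat j)) \<le> A * real (j + 1) powr s)"


section \<open>Holomorphic functions of several variables and formal power series\<close>

type_synonym 'n cvec = "complex ^ 'n"
type_synonym 'n rvec = "real ^ 'n"
type_synonym 'n multi_index = "nat ^ 'n"

definition polydisc :: "('n::finite) rvec \<Rightarrow> 'n cvec set" where
  "polydisc \<rho> = {x. \<forall>d. cmod (x $ d) < \<rho> $ d}"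

text \<open>Holomorphy in several variables is complex differentiability, i.e. the Frechet derivative
  exists at every point and is complex linear.\<close>

definition holomorphic_vec :: "(('n::finite) cvec \<Rightarrow> complex) \<Rightarrow> 'n cvec set \<Rightarrow> bool" where
  "holomorphic_vec f U \<longleftrightarrow>
     (\<forall>x\<in>U. \<exists>c. (f has_derivative (\<lambda>h. \<Sum>d\<in>UNIV. c $ d * h $ d)) (at x))"

definition holomorphic_time_vec ::
    "(complex \<Rightarrow> ('n::finite) cvec \<Rightarrow> complex) \<Rightarrow> (complex \<times> 'n cvec) set \<Rightarrow> bool" where
  "holomorphic_time_vec f U \<longleftrightarrow>
     (\<forall>z\<in>U. \<exists>c0 c. ((\<lambda>(t, x). f t x) has_derivative
        (\<lambda>(\<tau>, h). c0 * \<tau> + (\<Sum>d\<in>UNIV. c $ d * h $ d))) (at z))"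

text \<open>A formal power series in \<open>t\<close> with coefficients depending on \<open>x\<close> is represented by the
  function sending \<open>x\<close> to the series in \<open>t\<close>; ring operations are thus pointwise in \<open>x\<close>.
  The following predicate is membership in \<open>O(D_rho)[[t]]\<close>; values outside the polydisc
  are irrelevant.\<close>

definition holomorphic_fps :: "('n::finite) rvec \<Rightarrow> ('n cvec \<Rightarrow> complex fps) \<Rightarrow> bool" where
  "holomorphic_fps \<rho> u \<longleftrightarrow> (\<forall>j. holomorphic_vec (\<lambda>x. fps_nth (u x) j) (polydisc \<rho>))"

definition gevrey :: "('n::finite) rvec \<Rightarrow> real \<Rightarrow> ('n cvec \<Rightarrow> complex fps) \<Rightarrow> bool" where
  "gevrey \<rho> \<sigma> u \<longleftrightarrow>
     (\<exists>r>0. (\<forall>d. r < \<rho> $ d) \<and>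
        (\<exists>C>0. \<exists>K>0. \<forall>x\<in>polydisc (\<chi> d. r). \<forall>j.
           cmod (fps_nth (u x) j) \<le> C * K ^ j * Gamma (1 + \<sigma> * real j)))"


section \<open>Moment derivatives\<close>

text \<open>If a series is written as the sum of \<open>u_j * t^j / m(j)\<close>, its moment derivative is the sum of
  \<open>u_{j+1} * t^j / m(j)\<close>; in terms of the plain coefficients \<open>F_j = u_j / m(j)\<close>, the
  coefficient \<open>u_{j+1} / m(j)\<close> is \<open>m(j+1) * F_{j+1} / m(j)\<close>.\<close>

definition moment_deriv :: "(complex \<Rightarrow> complex) \<Rightarrow> complex fps \<Rightarrow> complex fps" where
  "moment_deriv m F =
     Abs_fps (\<lambda>j. m (of_nat (j + 1)) * fps_nth F (j + 1) / m (of_nat j))"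

text \<open>The moment derivative in the variable \<open>x_d\<close> acts on the Taylor expansion at \<open>x_d = 0\<close>,
  the other variables being frozen.\<close>

definition moment_deriv_var ::
    "(complex \<Rightarrow> complex) \<Rightarrow> 'n \<Rightarrow> (('n::finite) cvec \<Rightarrow> complex) \<Rightarrow> 'n cvec \<Rightarrow> complex" where
  "moment_deriv_var m d g x =
     eval_fps (moment_deriv m (fps_expansion (\<lambda>z. g (\<chi> c. if c = d then z else x $ c)) 0)) (x $ d)"

text \<open>The index type is linearly ordered, \<open>d_1 < ... < d_N\<close>, and the operators are composed in the
  order \<open>d_1, ..., d_N\<close>, the one for \<open>d_N\<close> being applied first.\<close>

definition moment_deriv_vec ::
    "('n::{finite,linorder} \<Rightarrow> complex \<Rightarrow> complex) \<Rightarrow> 'n multi_index \<Rightarrow>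
     ('n cvec \<Rightarrow> complex) \<Rightarrow> 'n cvec \<Rightarrow> complex" where
  "moment_deriv_vec m q =
     foldr (\<lambda>d. moment_deriv_var (m d) d ^^ (q $ d)) (sorted_list_of_set UNIV)"

definition moment_deriv_coeffs ::
    "('n::{finite,linorder} \<Rightarrow> complex \<Rightarrow> complex) \<Rightarrow> 'n multi_index \<Rightarrow>
     ('n cvec \<Rightarrow> complex fps) \<Rightarrow> 'n cvec \<Rightarrow> complex fps" where
  "moment_deriv_coeffs m q u x =
     Abs_fps (\<lambda>j. moment_deriv_vec m q (\<lambda>y. fps_nth (u y) j) x)"


section \<open>The Cauchy problem\<close>

text \<open>A tuple \<open>((i_1,q_1,r_1), ..., (i_n,q_n,r_n))\<close> is a list of length \<open>n\<close>.\<close>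

type_synonym 'n index_tuple = "(nat \<times> 'n multi_index \<times> nat) list"

record ('n::"{finite,linorder}") cauchy_problem =
  ord_t :: real                                                   \<comment> \<open>\<open>s_0\<close>\<close>
  ord_x :: "'n rvec"                                              \<comment> \<open>\<open>s_1, ..., s_N\<close>\<close>
  mom_t :: "complex \<Rightarrow> complex"                        \<comment> \<open>\<open>m_0\<close>\<close>
  mom_x :: "'n \<Rightarrow> complex \<Rightarrow> complex"       \<comment> \<open>\<open>m_1, ..., m_N\<close>\<close>
  kappa :: nat
  degrees :: "nat set"                                            \<comment> \<open>the set \<open>I\<close>\<close>
  Lam :: "nat \<Rightarrow> 'n index_tuple set"
  t_exp :: "'n index_tuple \<Rightarrow> nat"                     \<comment> \<open>the exponents \<open>v\<close>\<close>
  coef :: "'n index_tuple \<Rightarrow> complex \<Rightarrow> 'n cvec \<Rightarrow> complex"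
  rad_t :: real                                                   \<comment> \<open>\<open>rho_0\<close>\<close>
  rad_x :: "'n rvec"                                              \<comment> \<open>\<open>rho_1, ..., rho_N\<close>\<close>
  inhom :: "'n cvec \<Rightarrow> complex fps"                    \<comment> \<open>\<open>f\<close>\<close>
  init_data :: "nat \<Rightarrow> 'n cvec \<Rightarrow> complex"  \<comment> \<open>\<open>phi_j\<close>\<close>

definition cauchy_data :: "('n::{finite,linorder}) cauchy_problem \<Rightarrow> bool" where
  "cauchy_data P \<longleftrightarrow>
     ord_t P > 0 \<and> regular_moment_function (ord_t P) (mom_t P) \<and>
     (\<forall>d. ord_x P $ d \<ge> 1 \<and> regular_moment_function (ord_x P $ d) (mom_x P d)) \<and>
     kappa P \<ge> 1 \<and>
     rad_t P > 0 \<and> (\<forall>d. rad_x P $ d > 0) \<and>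
     finite (degrees P) \<and> degrees P \<noteq> {} \<and> 0 \<notin> degrees P \<and>
     (\<forall>n\<in>degrees P. finite (Lam P n) \<and> Lam P n \<noteq> {} \<and>
        (\<forall>w\<in>Lam P n.
           length w = n \<and>
           (\<forall>(i, q, r)\<in>set w. i < kappa P \<and> r \<ge> 1) \<and>
           distinct (map (\<lambda>(i, q, r). (i, q)) w) \<and>
           holomorphic_time_vec (coef P w) (ball 0 (rad_t P) \<times> polydisc (rad_x P)) \<and>
           (\<exists>x\<in>polydisc (rad_x P). coef P w 0 x \<noteq> 0))) \<and>
     holomorphic_fps (rad_x P) (inhom P) \<and>
     (\<forall>j<kappa P. holomorphic_vec (init_data P j) (polydisc (rad_x P)))"

definition formal_solution ::
    "('n::{finite,linorder}) cauchy_problem \<Rightarrow> ('n cvec \<Rightarrow> complex fps) \<Rightarrow> bool" where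
  "formal_solution P u \<longleftrightarrow>
     holomorphic_fps (rad_x P) u \<and>
     (\<forall>x\<in>polydisc (rad_x P).
        (moment_deriv (mom_t P) ^^ kappa P) (u x) -
          (\<Sum>n\<in>degrees P. \<Sum>w\<in>Lam P n.
             fps_X ^ t_exp P w * fps_expansion (\<lambda>t. coef P w t x) 0 *
             (\<Prod>(i, q, r)\<leftarrow>w.
                ((moment_deriv (mom_t P) ^^ i) (moment_deriv_coeffs (mom_x P) q u x)) ^ r))
        = inhom P x) \<and>
     (\<forall>j<kappa P. \<forall>x\<in>polydisc (rad_x P).
        fps_nth ((moment_deriv (mom_t P) ^^ j) (u x)) 0 = init_data P j x)"

definition order_condition :: "('n::{finite,linorder}) cauchy_problem \<Rightarrow> bool" where
  "order_condition P \<longleftrightarrow>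
     (\<forall>n\<in>degrees P. \<forall>w\<in>Lam P n.
        int (\<Sum>(i, q, r)\<leftarrow>w. r * i) - int (t_exp P w) < int (kappa P))"


section \<open>The critical value\<close>

definition lambda_sq :: "('n::{finite,linorder}) cauchy_problem \<Rightarrow> 'n multi_index \<Rightarrow> real" where
  "lambda_sq P q = (\<Sum>d\<in>UNIV. ord_x P $ d * real (q $ d))"

definition total_order :: "('n::{finite,linorder}) cauchy_problem \<Rightarrow> 'n index_tuple \<Rightarrow> real" where
  "total_order P w =
     (\<Sum>(i, q, r)\<leftarrow>w. ord_t P * real r * real i + real r * lambda_sq P q)"

definition crit_tuples :: "('n::{finite,linorder}) cauchy_problem \<Rightarrow> 'n index_tuple set" where
  "crit_tuples P =
     (\<Union>n\<in>degrees P. {w \<in> Lam P n. total_order P w > ord_t P * real (kappa P)})"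

definition critical_value :: "('n::{finite,linorder}) cauchy_problem \<Rightarrow> real" where
  "critical_value P =
     (if crit_tuples P = {} then 0
      else 1 / Min ((\<lambda>w. (real (kappa P) + real (t_exp P w) - (\<Sum>(i, q, r)\<leftarrow>w. real r * real i)) /
                         (total_order P w - ord_t P * real (kappa P))) ` crit_tuples P))"

end

theory Submission
  imports Defs
begin

text \<open>Comparing coefficients of \<open>t\<^sup>j\<close> in the equation expresses \<open>u\<^sub>j\<^sub>+\<^sub>\<kappa>\<close> as
  \<open>m\<^sub>0(j) / m\<^sub>0(j + \<kappa>)\<close> times the sum of \<open>f\<^sub>j\<close> and of finitely many products of moment
  derivatives of earlier coefficients. For a regular moment function of order \<open>s\<close>, the quotient
  \<open>m(j + 1) / m(j)\<close> is comparable to \<open>(j + 1)\<^sup>s\<close>, so the effect of all operators on the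
  Taylor coefficients \<open>u\<^sub>j\<^sub>,\<^sub>\<alpha>\<close> of the \<open>u\<^sub>j\<close> at \<open>x = 0\<close> is known up
  to constants. The proof is a majorant argument for these numbers.

  Put \<open>S = s\<^sub>0 + \<sigma>\<close> and choose a natural number \<open>L \<ge> 1\<close> and \<open>0 < \<beta> \<le> 1\<close> with \<open>L \<beta> = S\<close>. The
  bound that propagates is, with \<open>n = |\<alpha>|\<close>,

    \<open>|u\<^sub>j\<^sub>,\<^sub>\<alpha>| \<le> M K\<^sup>j R\<^sup>n F(j, n) D(j, \<alpha>)\<close>

  where \<open>F(j, n) = ((L j + n)! / n!) powr \<beta> / (j! powr s\<^sub>0)\<close> and
  \<open>D(j, \<alpha>) = 1 / ((j + 1)\<^sup>2 \<Prod> (\<alpha>\<^sub>d + 1)\<^sup>2)\<close>.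

  Up to geometric factors \<open>F(j, n)\<close> is \<open>j! powr \<sigma>\<close> (\<open>F_lower\<close>, \<open>F_upper\<close>), so these bounds
  for some \<open>M\<close>, \<open>K\<close>, \<open>R\<close> say that \<open>u\<close> is \<open>\<sigma>\<close>-Gevrey (\<open>gevrey_imp_factorially_bounded\<close>,
  \<open>factorially_bounded_imp_gevrey\<close>). The weight has this form for three reasons.

  \<^item> \<open>F\<close> is supermultiplicative by Vandermonde's identity (\<open>F_mult\<close>), and convolution
    reproduces \<open>D\<close> up to a constant (\<open>decay_convolution\<close>); hence a product obeys the product of
    the bounds of its factors.
  \<^item> A moment derivative in \<open>x\<^sub>d\<close> costs a factor \<open>(j + n + 1) powr s\<^sub>d\<close>
    (\<open>F_Suc_n_upper\<close>; this is where \<open>s\<^sub>d \<ge> 1 \<ge> \<beta>\<close> enters), and one in \<open>t\<close> costs the power \<open>S\<close>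
    (\<open>F_Suc_j_upper\<close>). A term of the equation therefore costs \<open>(j + n + 1)\<^sup>E\<close> with
    \<open>E = \<Sum> r\<^sub>\<ell> (\<lambda>(s q\<^sub>\<ell>) + i\<^sub>\<ell> S)\<close>.
  \<^item> Raising the index by \<open>\<kappa> + v\<close>, as the recursion does, gains the power \<open>S \<kappa> + \<sigma> v\<close>
    (\<open>F_critical\<close>).

  So the recursion preserves the bound if \<open>E \<le> S \<kappa> + \<sigma> v\<close> for every term. Solving this for \<open>\<sigma>\<close>
  gives exactly \<open>\<sigma> \<ge> \<sigma>\<^sub>c\<close> (\<open>term_order_le\<close>). Since \<open>\<Sum> r\<^sub>\<ell> i\<^sub>\<ell> < \<kappa> + v\<close>, every step also
  wins a factor \<open>1 / K\<close>, and a large \<open>K\<close> absorbs all constants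
  (\<open>solution_bounded_if_inhom_bounded\<close>). Conversely \<open>f\<close> is obtained from \<open>u\<close> by the same operators,
  which gives \<open>inhom_bounded_if_solution_bounded\<close>.

  The value \<open>\<sigma>\<^sub>c\<close> is attained by the heat-type equation \<open>\<partial>\<^sub>t u = \<partial>\<^sub>x\<^sup>q u\<close> with all moments
  equal to factorials and \<open>u(0, x) = 1 / (1 - x)\<close>: there \<open>\<sigma>\<^sub>c = q - 1\<close> and \<open>u\<^sub>j(0) = (q j)! / j!\<close>.\<close>

section \<open>Power series in several variables\<close>

abbreviation cube :: "real \<Rightarrow> ('n::finite) cvec set" where
  "cube \<delta> \<equiv> polydisc (\<chi> d. \<delta>)"

lemma mem_cube: "x \<in> cube \<delta> \<longleftrightarrow> (\<forall>d. cmod (x $ d) < \<delta>)"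
  by (simp add: polydisc_def)

definition degree_of :: "('n::finite) multi_index \<Rightarrow> nat" where
  "degree_of \<alpha> = (\<Sum>d\<in>UNIV. \<alpha> $ d)"

definition mpow :: "('n::finite) cvec \<Rightarrow> 'n multi_index \<Rightarrow> complex" where
  "mpow x \<alpha> = (\<Prod>d\<in>UNIV. x $ d ^ \<alpha> $ d)"

lemma degree_of_add: "degree_of (\<alpha> + \<beta>) = degree_of \<alpha> + degree_of \<beta>"
  by (simp add: degree_of_def sum.distrib)

lemma degree_of_axis [simp]: "degree_of (axis d k) = k"
  by (simp add: degree_of_def axis_def)

lemma le_degree_of: "\<alpha> $ d \<le> degree_of \<alpha>"
  unfolding degree_of_def by (rule member_le_sum) auto

lemma mpow_add: "mpow x (\<alpha> + \<beta>) = mpow x \<alpha> * mpow x \<beta>"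
  by (simp add: mpow_def power_add prod.distrib)

lemma mpow_axis: "mpow x (axis d k) = x $ d ^ k"
proof -
  have "mpow x (axis d k) = (\<Prod>c\<in>UNIV. if c = d then x $ d ^ k else 1)"
    unfolding mpow_def by (rule prod.cong) (auto simp: axis_def)
  then show ?thesis by simp
qed

lemma norm_mpow_le:
  assumes "\<And>d. cmod (x $ d) \<le> r"
  shows "cmod (mpow x \<alpha>) \<le> r ^ degree_of \<alpha>"
proof -
  have "cmod (mpow x \<alpha>) = (\<Prod>d\<in>UNIV. cmod (x $ d) ^ \<alpha> $ d)"
    by (simp add: mpow_def norm_power prod_norm[symmetric])
  also have "\<dots> \<le> (\<Prod>d\<in>UNIV. r ^ \<alpha> $ d)"
    by (intro prod_mono) (use assms in \<open>auto intro!: power_mono\<close>)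
  also have "\<dots> = r ^ degree_of \<alpha>" by (simp add: degree_of_def power_sum)
  finally show ?thesis .
qed

lemma mpow_const: "mpow (\<chi> d. z) \<alpha> = z ^ degree_of \<alpha>"
  by (simp add: mpow_def degree_of_def power_sum)

lemma sum_prod_multi_index:
  fixes f :: "'n::finite \<Rightarrow> nat \<Rightarrow> 'a::comm_semiring_1"
  assumes "\<And>d. finite (A d)"
  shows "(\<Sum>\<alpha> | \<forall>d. \<alpha> $ d \<in> A d. \<Prod>d\<in>UNIV. f d (\<alpha> $ d)) = (\<Prod>d\<in>UNIV. \<Sum>k\<in>A d. f d k)"
proof -
  have "(\<Prod>d\<in>UNIV. \<Sum>k\<in>A d. f d k) = (\<Sum>g\<in>PiE UNIV A. \<Prod>d\<in>UNIV. f d (g d))"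
    by (rule prod_sum_PiE) (auto simp: assms)
  also have "\<dots> = (\<Sum>\<alpha> | \<forall>d. \<alpha> $ d \<in> A d. \<Prod>d\<in>UNIV. f d (\<alpha> $ d))"
    by (rule sum.reindex_bij_witness[of _ "\<lambda>\<alpha>. vec_nth \<alpha>" "\<lambda>g. vec_lambda g"])
       (auto simp: PiE_def Pi_def)
  finally show ?thesis ..
qed

lemma finite_multi_index_box:
  assumes "\<And>d. finite (A d)"
  shows "finite {\<alpha> :: 'n::finite multi_index. \<forall>d. \<alpha> $ d \<in> A d}"
proof -
  have "{\<alpha> :: 'n multi_index. \<forall>d. \<alpha> $ d \<in> A d} \<subseteq> vec_lambda ` PiE UNIV A"
  proof
    fix \<alpha> :: "'n multi_index" assume "\<alpha> \<in> {\<alpha>. \<forall>d. \<alpha> $ d \<in> A d}"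
    then have "vec_nth \<alpha> \<in> PiE UNIV A" by auto
    then show "\<alpha> \<in> vec_lambda ` PiE UNIV A"
      by (metis imageI vec_nth_inverse)
  qed
  then show ?thesis using assms by (meson finite_PiE finite_code finite_imageI finite_subset finite)
qed

text \<open>Every finite set of multi-indices lies in a box, over which the sum is a product of
  one-dimensional geometric sums.\<close>

lemma geometric_multi_summable:
  fixes t :: real
  assumes "0 \<le> t" "t < 1"
  shows "(\<lambda>\<alpha> :: 'n::finite multi_index. t ^ degree_of \<alpha>) summable_on UNIV"
proof (rule nonneg_bdd_above_summable_on)
  show "bdd_above (sum (\<lambda>\<alpha> :: 'n multi_index. t ^ degree_of \<alpha>) ` {F. F \<subseteq> UNIV \<and> finite F})"
  proof (rule bdd_aboveI2)
    fix F :: "'n multi_index set" assume F: "F \<in> {F. F \<subseteq> UNIV \<and> finite F}"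
    define m where "m = (\<Sum>\<alpha>\<in>F. degree_of \<alpha>)"
    have le: "\<alpha> $ d \<le> m" if "\<alpha> \<in> F" for \<alpha> d
      using le_degree_of[of \<alpha> d] member_le_sum[of \<alpha> F degree_of] F that
      unfolding m_def by auto
    have "(\<Sum>\<alpha>\<in>F. t ^ degree_of \<alpha>) \<le> (\<Sum>\<alpha>::'n multi_index | \<forall>d. \<alpha> $ d \<in> {..m}. t ^ degree_of \<alpha>)"
    proof (rule sum_mono2)
      show "finite {\<alpha> :: 'n multi_index. \<forall>d. \<alpha> $ d \<in> {..m}}"
        by (rule finite_multi_index_box) auto
    qed (use le assms in auto)
    also have "\<dots> = (\<Sum>\<alpha>::'n multi_index | \<forall>d. \<alpha> $ d \<in> {..m}. \<Prod>d\<in>UNIV. t ^ (\<alpha> $ d))"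
      by (simp add: degree_of_def power_sum)
    also have "\<dots> = (\<Prod>d\<in>(UNIV::'n set). \<Sum>k\<in>{..m}. t ^ k)"
      by (rule sum_prod_multi_index) auto
    also have "\<dots> \<le> (\<Prod>d\<in>(UNIV::'n set). 1 / (1 - t))"
    proof (intro prod_mono conjI)
      show "(\<Sum>k\<in>{..m}. t ^ k) \<le> 1 / (1 - t)"
        using sum_le_suminf[OF summable_geometric[of t], of "{..m}"] suminf_geometric[of t] assms
        by auto
    qed (use assms in \<open>auto intro!: sum_nonneg\<close>)
    finally show "(\<Sum>\<alpha>\<in>F. t ^ degree_of \<alpha>) \<le> (\<Prod>d\<in>(UNIV::'n set). 1 / (1 - t))" .
  qed
qed (use assms in auto)

text \<open>Abel's lemma: bounded terms at radius \<open>r\<close> give a geometric majorant at the largest modulus of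
  a component of \<open>x\<close>.\<close>

lemma power_series_abs_summable:
  fixes c :: "'n::finite multi_index \<Rightarrow> complex"
  assumes c: "\<And>\<alpha>. cmod (c \<alpha>) * r ^ degree_of \<alpha> \<le> C" and x: "x \<in> cube r"
  shows "(\<lambda>\<alpha>. cmod (c \<alpha> * mpow x \<alpha>)) summable_on UNIV"
proof -
  define q where "q = Max (range (\<lambda>d. cmod (x $ d)))"
  have q: "cmod (x $ d) \<le> q" for d unfolding q_def by (intro Max_ge) auto
  have "q \<in> range (\<lambda>d. cmod (x $ d))" unfolding q_def by (intro Max_in) auto
  then have qr: "0 \<le> q" "q < r" using x by (auto simp: mem_cube)
  have "(\<lambda>\<alpha>::'n multi_index. C * (q / r) ^ degree_of \<alpha>) summable_on UNIV"
    by (intro summable_on_cmult_right geometric_multi_summable) (use qr in auto)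
  then show ?thesis
  proof (rule summable_on_comparison_test)
    fix \<alpha> :: "'n multi_index"
    have "cmod (c \<alpha> * mpow x \<alpha>) \<le> cmod (c \<alpha>) * q ^ degree_of \<alpha>"
      using norm_mpow_le[OF q, of \<alpha>] by (simp add: norm_mult mult_left_mono)
    also have "\<dots> = cmod (c \<alpha>) * r ^ degree_of \<alpha> * (q / r) ^ degree_of \<alpha>"
      using qr by (simp add: power_divide)
    also have "\<dots> \<le> C * (q / r) ^ degree_of \<alpha>"
      using qr by (intro mult_right_mono c) auto
    finally show "cmod (c \<alpha> * mpow x \<alpha>) \<le> C * (q / r) ^ degree_of \<alpha>" .
  qed auto
qed

lemma power_series_summable:
  fixes c :: "'n::finite multi_index \<Rightarrow> complex"
  assumes c: "\<And>\<alpha>. cmod (c \<alpha>) * r ^ degree_of \<alpha> \<le> C" and x: "x \<in> cube r"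
  shows "(\<lambda>\<alpha>. c \<alpha> * mpow x \<alpha>) summable_on UNIV"
  using power_series_abs_summable[OF assms] summable_on_iff_abs_summable_on_complex by blast

text \<open>Convergence here is unconditional summation over all multi-indices, which for complex terms is
  absolute convergence.\<close>

definition expands :: "real \<Rightarrow> (('n::finite) cvec \<Rightarrow> complex) \<Rightarrow> ('n multi_index \<Rightarrow> complex) \<Rightarrow> bool" where
  "expands \<delta> h c \<longleftrightarrow> (\<forall>x\<in>cube \<delta>. ((\<lambda>\<alpha>. c \<alpha> * mpow x \<alpha>) has_sum h x) UNIV)"

lemma expandsD: "expands \<delta> h c \<Longrightarrow> x \<in> cube \<delta> \<Longrightarrow> ((\<lambda>\<alpha>. c \<alpha> * mpow x \<alpha>) has_sum h x) UNIV"
  by (auto simp: expands_def)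

lemma expands_abs_summable:
  "expands \<delta> h c \<Longrightarrow> x \<in> cube \<delta> \<Longrightarrow> (\<lambda>\<alpha>. cmod (c \<alpha> * mpow x \<alpha>)) summable_on UNIV"
  by (rule iffD1[OF summable_on_iff_abs_summable_on_complex], rule has_sum_imp_summable, rule expandsD)

lemma expands_bound:
  assumes "expands \<delta> h c" "0 < r" "r < \<delta>"
  obtains C where "\<And>\<alpha>. cmod (c \<alpha>) * r ^ degree_of \<alpha> \<le> C"
proof
  define x :: "'a cvec" where "x = (\<chi> d. of_real r)"
  have "x \<in> cube \<delta>" using assms by (simp add: x_def mem_cube)
  from expands_abs_summable[OF assms(1) this]
  have s: "(\<lambda>\<alpha>. cmod (c \<alpha>) * r ^ degree_of \<alpha>) summable_on UNIV"
    using assms by (simp add: x_def mpow_const norm_mult norm_power)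
  show "cmod (c \<alpha>) * r ^ degree_of \<alpha> \<le> infsum (\<lambda>\<alpha>. cmod (c \<alpha>) * r ^ degree_of \<alpha>) UNIV" for \<alpha>
    using finite_sum_le_infsum[OF s, of "{\<alpha>}"] assms by auto
qed

lemma expands_cong:
  assumes "expands \<delta> h c" "\<And>x. x \<in> cube \<delta> \<Longrightarrow> h x = h' x"
  shows "expands \<delta> h' c"
  using assms by (auto simp: expands_def)

lemma expands_subset:
  assumes "expands \<delta> h c" "\<delta>' \<le> \<delta>"
  shows "expands \<delta>' h c"
  unfolding expands_def
proof
  fix x :: "'a cvec" assume "x \<in> cube \<delta>'"
  then have "x \<in> cube \<delta>" using assms(2) unfolding mem_cube by (blast intro: order_less_le_trans)
  then show "((\<lambda>\<alpha>. c \<alpha> * mpow x \<alpha>) has_sum h x) UNIV" by (rule expandsD[OF assms(1)])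
qed

lemma expands_0: "expands \<delta> (\<lambda>x. 0) (\<lambda>\<alpha>. 0)"
  by (simp add: expands_def)

lemma expands_add:
  "expands \<delta> h c \<Longrightarrow> expands \<delta> h' c' \<Longrightarrow> expands \<delta> (\<lambda>x. h x + h' x) (\<lambda>\<alpha>. c \<alpha> + c' \<alpha>)"
  by (auto simp: expands_def distrib_right intro!: has_sum_add)

lemma expands_cmult:
  "expands \<delta> h c \<Longrightarrow> expands \<delta> (\<lambda>x. k * h x) (\<lambda>\<alpha>. k * c \<alpha>)"
  by (auto simp: expands_def mult.assoc intro!: has_sum_cmult_right)

definition multi_splits :: "'n::finite multi_index \<Rightarrow> ('n multi_index \<times> 'n multi_index) set" where
  "multi_splits \<alpha> = {(\<beta>, \<gamma>). \<beta> + \<gamma> = \<alpha>}"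

lemma finite_multi_splits: "finite (multi_splits \<alpha>)"
proof -
  have "multi_splits \<alpha> \<subseteq> {\<beta>. \<forall>d. \<beta> $ d \<in> {..\<alpha> $ d}} \<times> {\<beta>. \<forall>d. \<beta> $ d \<in> {..\<alpha> $ d}}"
    by (auto simp: multi_splits_def)
  moreover have "finite {\<beta> :: 'a multi_index. \<forall>d. \<beta> $ d \<in> {..\<alpha> $ d}}"
    by (rule finite_multi_index_box) auto
  ultimately show ?thesis by (meson finite_SigmaI finite_subset)
qed

text \<open>The Cauchy product: absolute convergence allows the double sum to be grouped by
  \<open>\<beta> + \<gamma> = \<alpha>\<close>.\<close>

lemma expands_mult:
  fixes h h' :: "'n::finite cvec \<Rightarrow> complex"
  assumes "expands \<delta> h c" "expands \<delta> h' c'"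
  shows "expands \<delta> (\<lambda>x. h x * h' x) (\<lambda>\<alpha>. \<Sum>(\<beta>, \<gamma>)\<in>multi_splits \<alpha>. c \<beta> * c' \<gamma>)"
  unfolding expands_def
proof
  fix x :: "'n cvec" assume x: "x \<in> cube \<delta>"
  define f where "f = (\<lambda>(\<beta>, \<gamma>). (c \<beta> * mpow x \<beta>) * (c' \<gamma> * mpow x \<gamma>))"
  have s: "f summable_on UNIV \<times> UNIV"
  proof (rule abs_summable_summable)
    show "(\<lambda>p. norm (f p)) summable_on UNIV \<times> UNIV"
    proof (rule summable_on_SigmaI)
      show "((\<lambda>\<gamma>. norm (f (\<beta>, \<gamma>))) has_sum
              cmod (c \<beta> * mpow x \<beta>) * infsum (\<lambda>\<gamma>. cmod (c' \<gamma> * mpow x \<gamma>)) UNIV) UNIV" for \<beta>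
        unfolding f_def case_prod_conv norm_mult[of "c \<beta> * _"]
        by (intro has_sum_cmult_right has_sum_infsum expands_abs_summable[OF assms(2) x])
      show "(\<lambda>\<beta>. cmod (c \<beta> * mpow x \<beta>) * infsum (\<lambda>\<gamma>. cmod (c' \<gamma> * mpow x \<gamma>)) UNIV) summable_on UNIV"
        by (intro summable_on_cmult_left expands_abs_summable[OF assms(1) x])
    qed auto
  qed
  have "(f has_sum h x * h' x) (UNIV \<times> UNIV)"
  proof (rule has_sum_SigmaI[OF _ _ s])
    show "((\<lambda>\<gamma>. f (\<beta>, \<gamma>)) has_sum (c \<beta> * mpow x \<beta>) * h' x) UNIV" for \<beta>
      unfolding f_def by (auto intro!: has_sum_cmult_right expandsD[OF assms(2) x])
    show "((\<lambda>\<beta>. c \<beta> * mpow x \<beta> * h' x) has_sum h x * h' x) UNIV"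
      by (auto intro!: has_sum_cmult_left expandsD[OF assms(1) x])
  qed
  also have "?this \<longleftrightarrow> ((\<lambda>(\<alpha>, p). f p) has_sum h x * h' x) (Sigma UNIV multi_splits)"
    by (rule has_sum_reindex_bij_witness[of _ "\<lambda>(\<alpha>, p). p" "\<lambda>(\<beta>, \<gamma>). (\<beta> + \<gamma>, (\<beta>, \<gamma>))"])
       (auto simp: multi_splits_def)
  finally have "((\<lambda>(\<alpha>, p). f p) has_sum h x * h' x) (Sigma UNIV multi_splits)" .
  from has_sum_SigmaD[OF this, of "\<lambda>\<alpha>. \<Sum>p\<in>multi_splits \<alpha>. f p"]
  have "((\<lambda>\<alpha>. \<Sum>p\<in>multi_splits \<alpha>. f p) has_sum h x * h' x) UNIV"
    using finite_multi_splits by (auto intro!: has_sum_finite)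
  moreover have "(\<Sum>p\<in>multi_splits \<alpha>. f p) = (\<Sum>(\<beta>, \<gamma>)\<in>multi_splits \<alpha>. c \<beta> * c' \<gamma>) * mpow x \<alpha>" for \<alpha>
    unfolding sum_distrib_right
    by (rule sum.cong) (auto simp: f_def multi_splits_def mpow_add)
  ultimately show "((\<lambda>\<alpha>. (\<Sum>(\<beta>, \<gamma>)\<in>multi_splits \<alpha>. c \<beta> * c' \<gamma>) * mpow x \<alpha>) has_sum h x * h' x) UNIV"
    by simp
qed

section \<open>Moment derivatives of power series\<close>

abbreviation upd :: "('n::finite) cvec \<Rightarrow> 'n \<Rightarrow> complex \<Rightarrow> 'n cvec" where
  "upd x d z \<equiv> (\<chi> c. if c = d then z else x $ c)"

lemma upd_in_cube: "x \<in> cube \<delta> \<Longrightarrow> cmod z < \<delta> \<Longrightarrow> upd x d z \<in> cube \<delta>"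
  by (simp add: mem_cube)

lemma upd_same [simp]: "upd x d (x $ d) = x"
  by (simp add: vec_eq_iff)

lemma mpow_upd: "mpow (upd x d z) \<alpha> = z ^ (\<alpha> $ d) * mpow (upd x d 1) \<alpha>"
proof -
  have "mpow (upd x d z) \<alpha> = z ^ (\<alpha> $ d) * (\<Prod>e\<in>UNIV - {d}. x $ e ^ \<alpha> $ e)" for z
    unfolding mpow_def by (subst prod.remove[of _ d]) (auto intro!: prod.cong)
  from this[of z] this[of 1] show ?thesis by simp
qed

lemma power_div_fact_le_exp:
  fixes x :: real
  assumes "0 \<le> x"
  shows "x ^ k / fact k \<le> exp x"
proof -
  have "(\<lambda>n. x ^ n / fact n) sums exp x"
    using exp_converges[of x] by (simp add: divide_inverse mult.commute)
  then show ?thesis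
    using sum_le_suminf[of "\<lambda>n. x ^ n / fact n" "{k}"] assms by (auto simp: sums_iff)
qed

text \<open>With \<open>a = - ln t\<close> and a natural number \<open>k \<ge> s\<close>, the \<open>k\<close>-th term of the exponential series gives
  \<open>(a (n + 1))\<^sup>k / k! \<le> exp (a (n + 1)) = 1 / t\<^sup>n\<^sup>+\<^sup>1\<close>.\<close>

lemma power_times_geometric_bounded:
  fixes t s :: real
  assumes "0 \<le> t" "t < 1"
  obtains C where "\<And>n. real (n + 1) powr s * t ^ n \<le> C" "C \<ge> 0"
proof -
  show thesis
  proof (cases "t = 0")
    case True
    show thesis
    proof (rule that[of 1])
      show "real (n + 1) powr s * t ^ n \<le> 1" for n using True by (cases n) auto
    qed auto
  next
    case False
    obtain k :: nat where k: "s \<le> real k" using real_arch_simple by blast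
    define a where "a = - ln t"
    have a: "a > 0" "exp a = 1 / t" using assms False by (auto simp: a_def exp_minus field_simps)
    show thesis
    proof (rule that[of "fact k / a ^ k / t"])
      fix n :: nat
      have "(a * real (n + 1)) ^ k / fact k \<le> exp (a * real (n + 1))"
        by (rule power_div_fact_le_exp) (use a in auto)
      also have "\<dots> = exp a ^ (n + 1)" using exp_of_nat_mult[of "n + 1" a] by (simp add: mult.commute)
      also have "\<dots> = 1 / t ^ (n + 1)" by (simp add: a power_one_over divide_inverse power_inverse)
      finally have "real (n + 1) ^ k * t ^ n \<le> fact k / a ^ k / t"
        unfolding power_mult_distrib using a(1) assms False by (simp add: field_simps del: of_nat_Suc of_nat_add)
      moreover have "real (n + 1) powr s \<le> real (n + 1) ^ k"
        using k by (simp flip: powr_realpow add: powr_mono)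
      ultimately show "real (n + 1) powr s * t ^ n \<le> fact k / a ^ k / t"
        using assms by (meson mult_right_mono order_trans zero_le_power)
    qed (use a assms in auto)
  qed
qed

text \<open>The moment derivative in \<open>x\<^sub>d\<close> is defined through the one-variable Taylor expansion with the
  other variables frozen. Grouping the multiple series by the exponent of \<open>x\<^sub>d\<close> identifies that
  expansion, and since the moment quotients grow only polynomially, the differentiated series
  still converges absolutely on the same polydisc and can be regrouped.\<close>

lemma expands_moment_deriv_var:
  fixes h :: "'n::finite cvec \<Rightarrow> complex"
  assumes h: "expands \<delta> h c"
    and m: "\<And>j. cmod (m (of_nat (j + 1)) / m (of_nat j)) \<le> A * real (j + 1) powr s"
  shows "expands \<delta> (moment_deriv_var m d h)
           (\<lambda>\<alpha>. m (of_nat (\<alpha> $ d + 1)) / m (of_nat (\<alpha> $ d)) * c (\<alpha> + axis d 1))"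
    (is "expands \<delta> _ ?c'")
  unfolding expands_def
proof
  fix x :: "'n cvec" assume x: "x \<in> cube \<delta>"
  define q where "q = Max (range (\<lambda>d. cmod (x $ d)))"
  have q: "cmod (x $ d) \<le> q" for d unfolding q_def by (intro Max_ge) auto
  have "q \<in> range (\<lambda>d. cmod (x $ d))" unfolding q_def by (intro Max_in) auto
  then have q\<delta>: "0 \<le> q" "q < \<delta>" using x by (auto simp: mem_cube)
  then have \<delta>: "\<delta> > 0" by simp
  obtain r where r: "q < r" "r < \<delta>" using q\<delta> dense by blast
  obtain r' where r': "r < r'" "r' < \<delta>" using r dense by blast
  have xr: "x \<in> cube r" using q r unfolding mem_cube by (blast intro: le_less_trans)
  have pos: "0 < r" "0 < r'" using r r' q\<delta> by auto
  obtain C where C: "\<And>\<alpha>. cmod (c \<alpha>) * r' ^ degree_of \<alpha> \<le> C"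
    using expands_bound[OF h pos(2) r'(2)] by blast
  have C0: "0 \<le> C" using C[of 0] pos by (meson mult_nonneg_nonneg norm_ge_zero order_trans zero_le_power less_imp_le)
  obtain G where G: "\<And>n. real (n + 1) powr max s 0 * (r / r') ^ n \<le> G" "0 \<le> G"
    using power_times_geometric_bounded[of "r / r'"] pos r' by auto
  have A0: "0 \<le> A" using m[of 0] by (simp, meson norm_ge_zero order_trans)
  have bnd: "cmod (?c' \<alpha>) * r ^ degree_of \<alpha> \<le> A * (C / r') * G" for \<alpha> :: "'n multi_index"
  proof -
    let ?n = "degree_of \<alpha>"
    have "cmod (?c' \<alpha>) \<le> (A * real (\<alpha> $ d + 1) powr s) * (C / r' ^ (?n + 1))"
      unfolding norm_mult
    proof (intro mult_mono m)
      show "cmod (c (\<alpha> + axis d 1)) \<le> C / r' ^ (?n + 1)"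
        using C[of "\<alpha> + axis d 1"] pos by (simp add: degree_of_add field_simps)
    qed (use A0 in auto)
    also have "\<dots> \<le> (A * real (?n + 1) powr max s 0) * (C / r' ^ (?n + 1))"
    proof (intro mult_right_mono mult_left_mono)
      have "real (\<alpha> $ d + 1) powr s \<le> real (\<alpha> $ d + 1) powr max s 0" by (intro powr_mono) auto
      also have "\<dots> \<le> real (?n + 1) powr max s 0" using le_degree_of[of \<alpha> d] by (intro powr_mono2) auto
      finally show "real (\<alpha> $ d + 1) powr s \<le> real (?n + 1) powr max s 0" .
    qed (use A0 C0 pos in auto)
    finally have "cmod (?c' \<alpha>) * r ^ ?n \<le> (A * real (?n + 1) powr max s 0) * (C / r' ^ (?n + 1)) * r ^ ?n"
      using pos by (intro mult_right_mono) auto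
    also have "\<dots> = A * (C / r') * (real (?n + 1) powr max s 0 * (r / r') ^ ?n)"
      using pos by (simp add: power_divide)
    also have "\<dots> \<le> A * (C / r') * G"
      using A0 C0 pos by (intro mult_left_mono G) auto
    finally show ?thesis .
  qed
  have sum': "(\<lambda>\<alpha>. ?c' \<alpha> * mpow x \<alpha>) summable_on UNIV"
    by (rule power_series_summable[OF bnd xr])
  \<comment> \<open>multi-indices with prescribed exponent of \<open>x\<^sub>d\<close>, and the coefficients of the one-variable expansion\<close>
  define L where "L = (\<lambda>n. {\<alpha> :: 'n multi_index. \<alpha> $ d = n})"
  define b where "b = (\<lambda>n. infsum (\<lambda>\<alpha>. c \<alpha> * mpow (upd x d 1) \<alpha>) (L n))"
  have reindex: "(f has_sum l) UNIV \<longleftrightarrow> ((\<lambda>(n, \<alpha>). f \<alpha>) has_sum l) (Sigma UNIV L)"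
    for f :: "'n multi_index \<Rightarrow> complex" and l
    by (rule has_sum_reindex_bij_witness[of _ "\<lambda>(n, \<alpha>). \<alpha>" "\<lambda>\<alpha>. (\<alpha> $ d, \<alpha>)"])
       (auto simp: L_def)
  have b: "((\<lambda>\<alpha>. c \<alpha> * mpow (upd x d 1) \<alpha>) has_sum b n) (L n)" for n
    unfolding b_def
  proof (rule has_sum_infsum)
    \<comment> \<open>evaluate at the nonzero value \<open>\<delta> / 2\<close> of \<open>x\<^sub>d\<close> and divide by its \<open>n\<close>-th power\<close>
    have "(\<lambda>\<alpha>. c \<alpha> * mpow (upd x d (of_real (\<delta>/2))) \<alpha>) summable_on UNIV"
      by (rule has_sum_imp_summable, rule expandsD[OF h]) (use \<delta> in \<open>auto intro!: upd_in_cube x\<close>)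
    then have "(\<lambda>\<alpha>. c \<alpha> * mpow (upd x d (of_real (\<delta>/2))) \<alpha>) summable_on L n"
      by (rule summable_on_subset_banach) auto
    then have "(\<lambda>\<alpha>. (c \<alpha> * mpow (upd x d (of_real (\<delta>/2))) \<alpha>) * inverse (of_real (\<delta>/2) ^ n)) summable_on L n"
      by (rule summable_on_cmult_left)
    moreover have "(c \<alpha> * mpow (upd x d (of_real (\<delta>/2))) \<alpha>) * inverse (of_real (\<delta>/2) ^ n)
        = c \<alpha> * mpow (upd x d 1) \<alpha>" if "\<alpha> \<in> L n" for \<alpha>
      using that \<delta> mpow_upd[where x = x and d = d and z = "of_real (\<delta>/2)" and \<alpha> = \<alpha>] by (simp add: L_def field_simps)
    ultimately show "(\<lambda>\<alpha>. c \<alpha> * mpow (upd x d 1) \<alpha>) summable_on L n"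
      by (subst summable_on_cong[symmetric]) auto
  qed
  have line: "(\<lambda>n. b n * z ^ n) sums h (upd x d z)" if z: "cmod z < \<delta>" for z
  proof (rule has_sum_imp_sums)
    have hs: "((\<lambda>(n, \<alpha>). c \<alpha> * mpow (upd x d z) \<alpha>) has_sum h (upd x d z)) (Sigma UNIV L)"
      using expandsD[OF h upd_in_cube[OF x z, of d]] by (simp only: reindex)
    show "((\<lambda>n. b n * z ^ n) has_sum h (upd x d z)) UNIV"
    proof (rule has_sum_SigmaD[OF hs])
      fix n
      have "((\<lambda>\<alpha>. (c \<alpha> * mpow (upd x d 1) \<alpha>) * z ^ n) has_sum b n * z ^ n) (L n)"
        by (rule has_sum_cmult_left[OF b])
      also have "?this \<longleftrightarrow> ((\<lambda>\<alpha>. case (n, \<alpha>) of (n, \<alpha>) \<Rightarrow> c \<alpha> * mpow (upd x d z) \<alpha>) has_sum b n * z ^ n) (L n)"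
        by (rule has_sum_cong) (use mpow_upd[where x = x and d = d and z = z] in \<open>auto simp: L_def mult_ac\<close>)
      finally show "((\<lambda>\<alpha>. case (n, \<alpha>) of (n, \<alpha>) \<Rightarrow> c \<alpha> * mpow (upd x d z) \<alpha>) has_sum b n * z ^ n) (L n)" .
    qed
  qed
  have "(\<lambda>z. h (upd x d z)) has_fps_expansion Abs_fps b"
  proof (rule has_fps_expansionI)
    have "eventually (\<lambda>z::complex. z \<in> ball 0 \<delta>) (nhds 0)"
      using \<delta> by (intro eventually_nhds_in_open) auto
    then show "eventually (\<lambda>u. (\<lambda>n. fps_nth (Abs_fps b) n * u ^ n) sums h (upd x d u)) (nhds 0)"
      by eventually_elim (use line in auto)
  qed
  then have fe: "fps_expansion (\<lambda>z. h (upd x d z)) 0 = Abs_fps b"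
    using fps_nth_fps_expansion[of "\<lambda>z. h (upd x d z)" "Abs_fps b"]
    by (auto simp: fps_expansion_def fps_eq_iff)
  have eq: "\<alpha> - (\<chi> i. if i = d then Suc 0 else 0) + (\<chi> i. if i = d then Suc 0 else 0) = \<alpha>"
    if "\<alpha> $ d = Suc n" for \<alpha> :: "'n multi_index" and n
    using that by (auto simp: vec_eq_iff)
  have shift: "((\<lambda>\<alpha>. c (\<alpha> + axis d 1) * mpow (upd x d 1) \<alpha>) has_sum b (n + 1)) (L n)" for n
  proof -
    have "((\<lambda>\<alpha>. c \<alpha> * mpow (upd x d 1) \<alpha>) has_sum b (n + 1)) (L (n + 1))" by (rule b)
    also have "?this \<longleftrightarrow> ((\<lambda>\<alpha>. c (\<alpha> + axis d 1) * mpow (upd x d 1) (\<alpha> + axis d 1)) has_sum b (n + 1)) (L n)"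
      by (rule has_sum_reindex_bij_witness[of _ "\<lambda>\<alpha>. \<alpha> + axis d 1" "\<lambda>\<alpha>. \<alpha> - axis d 1"])
         (auto simp: L_def axis_def eq)
    finally show ?thesis by (simp add: mpow_add mpow_axis)
  qed
  have hs: "((\<lambda>(n, \<alpha>). ?c' \<alpha> * mpow x \<alpha>) has_sum infsum (\<lambda>\<alpha>. ?c' \<alpha> * mpow x \<alpha>) UNIV) (Sigma UNIV L)"
    using has_sum_infsum[OF sum'] by (simp only: reindex)
  have "((\<lambda>n. m (of_nat (n + 1)) / m (of_nat n) * b (n + 1) * (x $ d) ^ n) has_sum
           infsum (\<lambda>\<alpha>. ?c' \<alpha> * mpow x \<alpha>) UNIV) UNIV"
  proof (rule has_sum_SigmaD[OF hs])
    fix n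
    have "((\<lambda>\<alpha>. m (of_nat (n + 1)) / m (of_nat n) * (c (\<alpha> + axis d 1) * mpow (upd x d 1) \<alpha>) * (x $ d) ^ n)
        has_sum m (of_nat (n + 1)) / m (of_nat n) * b (n + 1) * (x $ d) ^ n) (L n)"
      by (intro has_sum_cmult_left has_sum_cmult_right shift)
    also have "?this \<longleftrightarrow> ((\<lambda>\<alpha>. case (n, \<alpha>) of (n, \<alpha>) \<Rightarrow> ?c' \<alpha> * mpow x \<alpha>) has_sum
        m (of_nat (n + 1)) / m (of_nat n) * b (n + 1) * (x $ d) ^ n) (L n)"
      by (rule has_sum_cong) (use mpow_upd[where x = x and d = d and z = "x $ d"] in \<open>auto simp: L_def mult_ac\<close>)
    finally show "((\<lambda>\<alpha>. case (n, \<alpha>) of (n, \<alpha>) \<Rightarrow> ?c' \<alpha> * mpow x \<alpha>) has_sum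
        m (of_nat (n + 1)) / m (of_nat n) * b (n + 1) * (x $ d) ^ n) (L n)" .
  qed
  then have "moment_deriv_var m d h x = infsum (\<lambda>\<alpha>. ?c' \<alpha> * mpow x \<alpha>) UNIV"
    unfolding moment_deriv_var_def fe eval_fps_def moment_deriv_def
    by (intro sums_unique[symmetric]) (auto dest!: has_sum_imp_sums simp: mult_ac)
  then show "((\<lambda>\<alpha>. ?c' \<alpha> * mpow x \<alpha>) has_sum moment_deriv_var m d h x) UNIV"
    using has_sum_infsum[OF sum'] by simp
qed

section \<open>Taylor expansion of holomorphic functions\<close>

text \<open>Holomorphy in each variable, together with boundedness, is the hypothesis that passes from a
  function to its Taylor coefficients in one variable, and so supports induction on the variables.\<close>

definition separately_holomorphic :: "real \<Rightarrow> (('n::finite) cvec \<Rightarrow> complex) \<Rightarrow> bool" where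
  "separately_holomorphic r h \<longleftrightarrow> (\<forall>x\<in>cube r. \<forall>d. (\<lambda>z. h (upd x d z)) holomorphic_on ball 0 r)"

text \<open>Cauchy's inequality on an open disc, by letting the radius of a smaller circle tend to \<open>r\<close>.\<close>

lemma taylor_coefficient_bound:
  assumes f: "f holomorphic_on ball 0 r" and r: "0 < r"
    and B: "\<And>z. z \<in> ball 0 r \<Longrightarrow> cmod (f z) \<le> B"
  shows "cmod ((deriv ^^ n) f 0 / fact n) * r ^ n \<le> B"
proof -
  let ?c = "cmod ((deriv ^^ n) f 0 / fact n)"
  have *: "?c * q ^ n \<le> B" if q: "0 < q" "q < r" for q
  proof -
    have sub: "cball 0 q \<subseteq> ball 0 r" using q by auto
    have "cmod ((deriv ^^ n) f 0) \<le> fact n * B / q ^ n"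
    proof (rule Cauchy_inequality[OF _ _ q(1)])
      show "f holomorphic_on ball 0 q" by (rule holomorphic_on_subset[OF f]) (use q in auto)
      show "continuous_on (cball 0 q) f"
        by (rule holomorphic_on_imp_continuous_on, rule holomorphic_on_subset[OF f sub])
    qed (use q in \<open>auto intro!: B\<close>)
    then show ?thesis using q by (simp add: norm_divide field_simps)
  qed
  have "((\<lambda>q. ?c * q ^ n) \<longlongrightarrow> ?c * r ^ n) (at_left r)" by (intro tendsto_intros)
  moreover have "eventually (\<lambda>q. ?c * q ^ n \<le> B) (at_left r)"
    using eventually_at_left_real[OF r] by eventually_elim (use * in auto)
  ultimately show ?thesis by (rule tendsto_upperbound) auto
qed

lemma taylor_series:
  assumes f: "f holomorphic_on ball 0 r" and w: "w \<in> ball 0 r"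
  shows "(\<lambda>n. (deriv ^^ n) f 0 / fact n * w ^ n) sums f w"
  using holomorphic_power_series[OF f w] by simp

text \<open>The \<open>n\<close>-th coefficient \<open>c\<^sub>n(z)\<close> is the limit, as \<open>w\<close> tends to \<open>0\<close>, of
  \<open>(g(w, z) - \<Sum>\<^sub>k\<^sub><\<^sub>n c\<^sub>k(z) w\<^sup>k) / w\<^sup>n\<close>. By induction these quotients are holomorphic in \<open>z\<close>, and
  Cauchy's inequality makes the convergence uniform in \<open>z\<close>.\<close>

lemma taylor_coefficient_holomorphic:
  fixes g :: "complex \<Rightarrow> complex \<Rightarrow> complex"
  assumes S: "open S" and r: "r > 0"
    and hw: "\<And>z. z \<in> S \<Longrightarrow> (\<lambda>w. g w z) holomorphic_on ball 0 r"
    and hz: "\<And>w. w \<in> ball 0 r \<Longrightarrow> g w holomorphic_on S"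
    and B: "\<And>w z. w \<in> ball 0 r \<Longrightarrow> z \<in> S \<Longrightarrow> cmod (g w z) \<le> B"
  shows "(\<lambda>z. (deriv ^^ n) (\<lambda>w. g w z) 0 / fact n) holomorphic_on S"
proof (induction n rule: less_induct)
  case (less n)
  define c where "c = (\<lambda>k z. (deriv ^^ k) (\<lambda>w. g w z) 0 / fact k)"
  define w where "w = (\<lambda>m. complex_of_real (r / real (m + 2)))"
  have w: "w m \<noteq> 0" "cmod (w m) = r / real (m + 2)" "w m \<in> ball 0 r" for m
    using r unfolding w_def by (auto simp: norm_of_real field_simps add_pos_nonneg simp del: of_real_divide of_real_add of_nat_add)
  define F where "F = (\<lambda>m z. (g (w m) z - (\<Sum>k<n. c k z * w m ^ k)) / w m ^ n)"
  have cb: "cmod (c k z) \<le> B / r ^ k" if "z \<in> S" for k z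
    using taylor_coefficient_bound[OF hw[OF that] r B[OF _ that], of k] r
    by (simp add: c_def field_simps)
  have err: "cmod (F m z - c n z) \<le> 2 * B / r ^ n / real (m + 2)" if z: "z \<in> S" for m z
  proof -
    let ?t = "1 / real (m + 2)"
    have geo: "B / r ^ (k + Suc n) * (r / q) ^ Suc k = B / r ^ n * (1 / q) * (1 / q) ^ k" if "q > 0" for q k
      using r that by (simp add: power_add power_divide field_simps)
    have B0: "0 \<le> B" using B[of 0 z] r z by (auto intro: order_trans[OF norm_ge_zero])
    have "(\<lambda>k. c k z * w m ^ k) sums g (w m) z"
      using taylor_series[OF hw[OF z] w(3)] by (simp add: c_def)
    then have "(\<lambda>k. c (k + Suc n) z * w m ^ (k + Suc n)) sums (g (w m) z - (\<Sum>k<Suc n. c k z * w m ^ k))"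
      by (rule sums_split_initial_segment)
    then have "(\<lambda>k. c (k + Suc n) z * w m ^ (k + Suc n) / w m ^ n) sums
                 ((g (w m) z - (\<Sum>k<Suc n. c k z * w m ^ k)) / w m ^ n)"
      by (rule sums_divide)
    also have "(g (w m) z - (\<Sum>k<Suc n. c k z * w m ^ k)) / w m ^ n = F m z - c n z"
      using w by (simp add: F_def field_simps)
    also have "(\<lambda>k. c (k + Suc n) z * w m ^ (k + Suc n) / w m ^ n) = (\<lambda>k. c (k + Suc n) z * w m ^ Suc k)"
      using w by (simp add: power_add)
    finally have s1: "(\<lambda>k. c (k + Suc n) z * w m ^ Suc k) sums (F m z - c n z)" .
    have s2: "(\<lambda>k. B / r ^ n * ?t * ?t ^ k) sums (B / r ^ n * ?t * (1 / (1 - ?t)))"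
      by (intro sums_mult geometric_sums) auto
    have "cmod (F m z - c n z) \<le> B / r ^ n * ?t * (1 / (1 - ?t))"
    proof (rule norm_sums_le[OF s1 s2])
      fix k
      have "cmod (c (k + Suc n) z * w m ^ Suc k) \<le> B / r ^ (k + Suc n) * (r / real (m + 2)) ^ Suc k"
        using cb[OF z, of "k + Suc n"] w r
        unfolding norm_mult norm_power w(2) by (intro mult_right_mono) auto
      also have "\<dots> = B / r ^ n * ?t * ?t ^ k"
        by (rule geo) simp
      finally show "cmod (c (k + Suc n) z * w m ^ Suc k) \<le> B / r ^ n * ?t * ?t ^ k" .
    qed
    also have "\<dots> \<le> B / r ^ n * ?t * 2"
      using B0 r by (intro mult_left_mono) (auto simp: field_simps)
    finally show ?thesis by (simp add: mult.commute)
  qed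
  have unif: "uniform_limit S F (c n) sequentially"
  proof (rule uniform_limitI)
    fix e :: real assume "e > 0"
    have "(\<lambda>m. 2 * B / r ^ n / real (m + 2)) \<longlonglongrightarrow> 0"
      by (rule LIMSEQ_ignore_initial_segment[OF lim_const_over_n])
    then have "eventually (\<lambda>m. 2 * B / r ^ n / real (m + 2) < e) sequentially"
      using \<open>e > 0\<close> by (rule order_tendstoD)
    then show "eventually (\<lambda>m. \<forall>z\<in>S. dist (F m z) (c n z) < e) sequentially"
    proof eventually_elim
      case (elim m)
      show ?case
        unfolding dist_norm
      proof
        fix z assume "z \<in> S"
        from err[OF this, of m] elim show "cmod (F m z - c n z) < e" by (rule le_less_trans)
      qed
    qed
  qed
  show ?case
    unfolding c_def[symmetric]
  proof (rule holomorphic_uniform_sequence[OF S])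
    fix m
    have "c k holomorphic_on S" if "k < n" for k using less[OF that] by (simp add: c_def)
    then show "F m holomorphic_on S"
      unfolding F_def using w by (intro holomorphic_intros hz) auto
  next
    fix x assume "x \<in> S"
    then obtain d where "d > 0" "cball x d \<subseteq> S" using S open_contains_cball by blast
    then show "\<exists>d>0. cball x d \<subseteq> S \<and> uniform_limit (cball x d) F (\<lambda>z. (deriv ^^ n) (\<lambda>w. g w z) 0 / fact n) sequentially"
      using uniform_limit_on_subset[OF unif] by (auto simp: c_def)
  qed
qed

lemma upd_commute: "e \<noteq> d \<Longrightarrow> upd (upd x e z) d w = upd (upd x d w) e z"
  by (auto simp: vec_eq_iff)

lemma upd_upd: "upd (upd x d z) d w = upd x d w"
  by (auto simp: vec_eq_iff)

text \<open>Expanding in the variables of \<open>D\<close> only leaves coefficients that are functions of the remaining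
  variables and again separately holomorphic and bounded, so that one more variable can be expanded.\<close>

lemma expand_in_variables:
  fixes h :: "'n::finite cvec \<Rightarrow> complex"
  assumes r: "r > 0" and hol: "separately_holomorphic r h" and B: "\<And>x. x \<in> cube r \<Longrightarrow> cmod (h x) \<le> B"
    and D: "finite D"
  shows "\<exists>c. (\<forall>\<alpha>. (\<forall>d. d \<notin> D \<longrightarrow> \<alpha> $ d = 0) \<longrightarrow>
           separately_holomorphic r (c \<alpha>) \<and> (\<forall>x\<in>cube r. cmod (c \<alpha> x) * r ^ degree_of \<alpha> \<le> B) \<and>
           (\<forall>d\<in>D. \<forall>x z. c \<alpha> (upd x d z) = c \<alpha> x)) \<and>
         (\<forall>x\<in>cube r. ((\<lambda>\<alpha>. c \<alpha> x * mpow x \<alpha>) has_sum h x) {\<alpha>. \<forall>d. d \<notin> D \<longrightarrow> \<alpha> $ d = 0})"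
  using D
proof (induction D)
  case empty
  have "{\<alpha> :: 'n multi_index. \<forall>d. d \<notin> {} \<longrightarrow> \<alpha> $ d = 0} = {0}" by (auto simp: vec_eq_iff)
  moreover have "\<alpha> = 0" if "\<forall>d. \<alpha> $ d = 0" for \<alpha> :: "'n multi_index" using that by (simp add: vec_eq_iff)
  ultimately show ?case
    using hol B by (intro exI[of _ "\<lambda>_. h"]) (auto simp: mpow_def degree_of_def intro!: has_sum_finiteI)
next
  case (insert d D)
  from insert.IH obtain c where c: "(\<forall>\<alpha>. (\<forall>d. d \<notin> D \<longrightarrow> \<alpha> $ d = 0) \<longrightarrow>
           separately_holomorphic r (c \<alpha>) \<and> (\<forall>x\<in>cube r. cmod (c \<alpha> x) * r ^ degree_of \<alpha> \<le> B) \<and>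
           (\<forall>d\<in>D. \<forall>x z. c \<alpha> (upd x d z) = c \<alpha> x)) \<and>
         (\<forall>x\<in>cube r. ((\<lambda>\<alpha>. c \<alpha> x * mpow x \<alpha>) has_sum h x) {\<alpha>. \<forall>d. d \<notin> D \<longrightarrow> \<alpha> $ d = 0})" ..
  have hc: "\<And>\<alpha>. (\<forall>d. d \<notin> D \<longrightarrow> \<alpha> $ d = 0) \<Longrightarrow> separately_holomorphic r (c \<alpha>)" and
    bc: "\<And>\<alpha> x. (\<forall>d. d \<notin> D \<longrightarrow> \<alpha> $ d = 0) \<Longrightarrow> x \<in> cube r \<Longrightarrow> cmod (c \<alpha> x) * r ^ degree_of \<alpha> \<le> B" and
    ic: "\<And>\<alpha> d x z. (\<forall>d. d \<notin> D \<longrightarrow> \<alpha> $ d = 0) \<Longrightarrow> d \<in> D \<Longrightarrow> c \<alpha> (upd x d z) = c \<alpha> x" and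
    sc: "\<And>x. x \<in> cube r \<Longrightarrow> ((\<lambda>\<alpha>. c \<alpha> x * mpow x \<alpha>) has_sum h x) {\<alpha>. \<forall>d. d \<notin> D \<longrightarrow> \<alpha> $ d = 0}"
    using c by simp_all
  \<comment> \<open>the multi-index with the exponent of the new variable \<open>x\<^sub>d\<close> removed\<close>
  define cut where "cut = (\<lambda>\<alpha> :: 'n multi_index. (\<chi> e. if e = d then 0 else \<alpha> $ e) :: 'n multi_index)"
  define c' where "c' = (\<lambda>\<alpha> x. (deriv ^^ (\<alpha> $ d)) (\<lambda>w. c (cut \<alpha>) (upd x d w)) 0 / fact (\<alpha> $ d))"
  have cutD: "\<forall>e. e \<notin> D \<longrightarrow> cut \<alpha> $ e = 0" if "\<forall>e. e \<notin> insert d D \<longrightarrow> \<alpha> $ e = 0" for \<alpha>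
    using that by (auto simp: cut_def)
  have cut_add: "cut \<alpha> + axis d (\<alpha> $ d) = \<alpha>" for \<alpha>
    by (auto simp: cut_def vec_eq_iff axis_def)
  have deg: "degree_of \<alpha> = degree_of (cut \<alpha>) + \<alpha> $ d" for \<alpha>
    using degree_of_add[of "cut \<alpha>" "axis d (\<alpha> $ d)"] by (simp add: cut_add)
  have holc: "(\<lambda>w. c \<alpha> (upd x d w)) holomorphic_on ball 0 r"
    if "\<forall>e. e \<notin> D \<longrightarrow> \<alpha> $ e = 0" "x \<in> cube r" for \<alpha> x
    using hc[OF that(1)] that(2) by (auto simp: separately_holomorphic_def)
  have b': "cmod (c' \<alpha> x) * r ^ degree_of \<alpha> \<le> B"
    if \<alpha>: "\<forall>e. e \<notin> insert d D \<longrightarrow> \<alpha> $ e = 0" and x: "x \<in> cube r" for \<alpha> x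
  proof -
    have "cmod (c' \<alpha> x) * r ^ (\<alpha> $ d) \<le> B / r ^ degree_of (cut \<alpha>)"
      unfolding c'_def
    proof (rule taylor_coefficient_bound[OF holc[OF cutD[OF \<alpha>] x] r])
      fix z :: complex assume "z \<in> ball 0 r"
      then show "cmod (c (cut \<alpha>) (upd x d z)) \<le> B / r ^ degree_of (cut \<alpha>)"
        using bc[OF cutD[OF \<alpha>] upd_in_cube[OF x, of z d]] r by (simp add: field_simps)
    qed
    then show ?thesis using r by (simp add: deg[of \<alpha>] power_add field_simps)
  qed
  show ?case
  proof (intro exI[of _ c'] conjI allI impI ballI)
    fix \<alpha> :: "'n multi_index" assume \<alpha>: "\<forall>e. e \<notin> insert d D \<longrightarrow> \<alpha> $ e = 0"
    show "separately_holomorphic r (c' \<alpha>)"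
      unfolding separately_holomorphic_def
    proof (intro ballI allI)
      fix x :: "'n cvec" and e assume x: "x \<in> cube r"
      show "(\<lambda>z. c' \<alpha> (upd x e z)) holomorphic_on ball 0 r"
      proof (cases "e = d")
        case True
        then show ?thesis by (simp add: c'_def upd_upd)
      next
        case False
        show ?thesis
          unfolding c'_def
        proof (rule taylor_coefficient_holomorphic[where r = r and B = "B / r ^ degree_of (cut \<alpha>)"])
          fix z :: complex assume "z \<in> ball 0 r"
          then show "(\<lambda>w. c (cut \<alpha>) (upd (upd x e z) d w)) holomorphic_on ball 0 r"
            by (intro holc[OF cutD[OF \<alpha>]] upd_in_cube x) auto
        next
          fix w :: complex assume "w \<in> ball 0 r"
          then have "upd x d w \<in> cube r" by (intro upd_in_cube x) auto
          then have "(\<lambda>z. c (cut \<alpha>) (upd (upd x d w) e z)) holomorphic_on ball 0 r"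
            using hc[OF cutD[OF \<alpha>]] by (auto simp: separately_holomorphic_def)
          then show "(\<lambda>z. c (cut \<alpha>) (upd (upd x e z) d w)) holomorphic_on ball 0 r"
            by (simp only: upd_commute[OF False])
        next
          fix w z :: complex assume "w \<in> ball 0 r" "z \<in> ball 0 r"
          then have "upd (upd x e z) d w \<in> cube r" by (intro upd_in_cube x) auto
          from bc[OF cutD[OF \<alpha>] this]
          show "cmod (c (cut \<alpha>) (upd (upd x e z) d w)) \<le> B / r ^ degree_of (cut \<alpha>)"
            using r by (simp add: field_simps)
        qed (use r in auto)
      qed
    qed
    show "cmod (c' \<alpha> x) * r ^ degree_of \<alpha> \<le> B" if "x \<in> cube r" for x
      using b' \<alpha> that by blast
    show "c' \<alpha> (upd x e z) = c' \<alpha> x" if "e \<in> insert d D" for e x z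
    proof (cases "e = d")
      case True
      then show ?thesis by (simp add: c'_def upd_upd)
    next
      case False
      with that have "e \<in> D" by simp
      then show ?thesis by (simp only: c'_def upd_commute[OF False] ic[OF cutD[OF \<alpha>]])
    qed
  next
    fix x :: "'n cvec" assume x: "x \<in> cube r"
    let ?I = "{\<alpha> :: 'n multi_index. \<forall>e. e \<notin> insert d D \<longrightarrow> \<alpha> $ e = 0}"
    let ?J = "{\<alpha> :: 'n multi_index. \<forall>e. e \<notin> D \<longrightarrow> \<alpha> $ e = 0}"
    have B0: "0 \<le> B" using B[OF x] norm_ge_zero order_trans by blast
    have "(\<lambda>\<alpha>. (if \<alpha> \<in> ?I then c' \<alpha> x else 0) * mpow x \<alpha>) summable_on UNIV"
      by (rule power_series_summable[where C = B and r = r]) (use b' x B0 in auto)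
    then have "(\<lambda>\<alpha>. (if \<alpha> \<in> ?I then c' \<alpha> x else 0) * mpow x \<alpha>) summable_on ?I"
      by (rule summable_on_subset_banach) auto
    then have summ: "(\<lambda>\<alpha>. c' \<alpha> x * mpow x \<alpha>) summable_on ?I"
      by (subst summable_on_cong[where g = "\<lambda>\<alpha>. (if \<alpha> \<in> ?I then c' \<alpha> x else 0) * mpow x \<alpha>"]) auto
    have reindex: "((\<lambda>\<alpha>. c' \<alpha> x * mpow x \<alpha>) has_sum l) ?I \<longleftrightarrow>
        ((\<lambda>(\<alpha>, k). c' (\<alpha> + axis d k) x * mpow x (\<alpha> + axis d k)) has_sum l) (Sigma ?J (\<lambda>_. UNIV))" for l
    proof (rule has_sum_reindex_bij_witness[of _ "\<lambda>(\<alpha>, k). \<alpha> + axis d k" "\<lambda>\<alpha>. (cut \<alpha>, \<alpha> $ d)"])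
      fix \<alpha> assume "\<alpha> \<in> ?I"
      then show "(cut \<alpha>, \<alpha> $ d) \<in> Sigma ?J (\<lambda>_. UNIV)" using cutD by blast
    next
      fix p :: "'n multi_index \<times> nat" assume p: "p \<in> Sigma ?J (\<lambda>_. UNIV)"
      then show "(case p of (\<alpha>, k) \<Rightarrow> \<alpha> + axis d k) \<in> ?I" by (auto simp: axis_def)
      show "(cut (case p of (\<alpha>, k) \<Rightarrow> \<alpha> + axis d k), (case p of (\<alpha>, k) \<Rightarrow> \<alpha> + axis d k) $ d) = p"
        using p insert.hyps by (auto simp: cut_def axis_def vec_eq_iff)
    qed (auto simp: cut_add)
    have "((\<lambda>(\<alpha>, k). c' (\<alpha> + axis d k) x * mpow x (\<alpha> + axis d k)) has_sum h x) (Sigma ?J (\<lambda>_. UNIV))"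
    proof (rule has_sum_SigmaI)
      show "((\<lambda>\<alpha>. c \<alpha> x * mpow x \<alpha>) has_sum h x) ?J" by (rule sc[OF x])
      show "(\<lambda>(\<alpha>, k). c' (\<alpha> + axis d k) x * mpow x (\<alpha> + axis d k)) summable_on Sigma ?J (\<lambda>_. UNIV)"
        using summ reindex unfolding summable_on_def by blast
    next
      fix \<alpha> assume \<alpha>: "\<alpha> \<in> ?J"
      then have \<alpha>d: "\<alpha> $ d = 0" using insert.hyps by blast
      have cut: "cut (\<alpha> + axis d k) = \<alpha>" for k
        using \<alpha>d by (auto simp: cut_def vec_eq_iff axis_def)
      have c'_eq: "c' (\<alpha> + axis d k) x = (deriv ^^ k) (\<lambda>w. c \<alpha> (upd x d w)) 0 / fact k" for k
        using \<alpha>d by (simp add: c'_def cut)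
      let ?f = "\<lambda>k. (deriv ^^ k) (\<lambda>w. c \<alpha> (upd x d w)) 0 / fact k"
      have hol: "(\<lambda>w. c \<alpha> (upd x d w)) holomorphic_on ball 0 r" using holc x \<alpha> by blast
      have xd: "x $ d \<in> ball 0 r" using x by (simp add: mem_cube)
      have "(\<lambda>k. ?f k * (x $ d) ^ k) sums c \<alpha> x"
        using taylor_series[OF hol xd] by simp
      moreover have "summable (\<lambda>k. norm (?f k * (x $ d) ^ k))"
      proof (rule summable_comparison_test')
        show "summable (\<lambda>k. B / r ^ degree_of \<alpha> * (cmod (x $ d) / r) ^ k)"
          using xd r by (intro summable_mult summable_geometric) auto
        fix k
        have "cmod (?f k) * r ^ k \<le> B / r ^ degree_of \<alpha>"
        proof (rule taylor_coefficient_bound[OF hol r])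
          fix z :: complex assume "z \<in> ball 0 r"
          then show "cmod (c \<alpha> (upd x d z)) \<le> B / r ^ degree_of \<alpha>"
            using bc[of \<alpha>, OF _ upd_in_cube[OF x, of z d]] r \<alpha> by (simp add: field_simps)
        qed
        then have "cmod (?f k) * r ^ k * (cmod (x $ d) / r) ^ k \<le> B / r ^ degree_of \<alpha> * (cmod (x $ d) / r) ^ k"
          using r by (intro mult_right_mono) auto
        then show "norm (norm (?f k * (x $ d) ^ k)) \<le> B / r ^ degree_of \<alpha> * (cmod (x $ d) / r) ^ k"
          using r unfolding norm_mult norm_power power_divide by (simp add: mult_ac)
      qed
      ultimately have "((\<lambda>k. ?f k * (x $ d) ^ k) has_sum c \<alpha> x) UNIV"
        by (intro norm_summable_imp_has_sum)
      from has_sum_cmult_left[OF this, of "mpow x \<alpha>"]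
      show "((\<lambda>k. case (\<alpha>, k) of (\<alpha>, k) \<Rightarrow> c' (\<alpha> + axis d k) x * mpow x (\<alpha> + axis d k)) has_sum c \<alpha> x * mpow x \<alpha>) UNIV"
        by (simp add: c'_eq mpow_add mpow_axis mult_ac)
    qed
    then show "((\<lambda>\<alpha>. c' \<alpha> x * mpow x \<alpha>) has_sum h x) ?I" by (simp only: reindex)
  qed
qed

lemma separately_holomorphic_expands:
  fixes h :: "'n::finite cvec \<Rightarrow> complex"
  assumes r: "r > 0" and hol: "separately_holomorphic r h" and B: "\<And>x. x \<in> cube r \<Longrightarrow> cmod (h x) \<le> B"
  obtains c where "expands r h c" "\<And>\<alpha>. cmod (c \<alpha>) * r ^ degree_of \<alpha> \<le> B"
proof -
  have "\<exists>c. (\<forall>\<alpha>. separately_holomorphic r (c \<alpha>) \<and> (\<forall>x\<in>cube r. cmod (c \<alpha> x) * r ^ degree_of \<alpha> \<le> B) \<and>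
           (\<forall>d x z. c \<alpha> (upd x d z) = c \<alpha> x)) \<and>
         (\<forall>x\<in>cube r. ((\<lambda>\<alpha>. c \<alpha> x * mpow x \<alpha>) has_sum h x) UNIV)"
    using expand_in_variables[OF assms finite, of UNIV] by simp
  then obtain c where c: "(\<forall>\<alpha>. separately_holomorphic r (c \<alpha>) \<and> (\<forall>x\<in>cube r. cmod (c \<alpha> x) * r ^ degree_of \<alpha> \<le> B) \<and>
           (\<forall>d x z. c \<alpha> (upd x d z) = c \<alpha> x)) \<and>
         (\<forall>x\<in>cube r. ((\<lambda>\<alpha>. c \<alpha> x * mpow x \<alpha>) has_sum h x) UNIV)" ..
  have bc: "\<And>\<alpha> x. x \<in> cube r \<Longrightarrow> cmod (c \<alpha> x) * r ^ degree_of \<alpha> \<le> B" and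
    ic: "\<And>\<alpha> d x z. c \<alpha> (upd x d z) = c \<alpha> x" and
    sc: "\<And>x. x \<in> cube r \<Longrightarrow> ((\<lambda>\<alpha>. c \<alpha> x * mpow x \<alpha>) has_sum h x) UNIV"
    using c by simp_all
  have const: "c \<alpha> x = c \<alpha> 0" for \<alpha> x
  proof -
    have "c \<alpha> (\<chi> e. if e \<in> D then 0 else x $ e) = c \<alpha> x" for D
      using finite[of D]
    proof (induction D)
      case (insert d D)
      have "(\<chi> e. if e \<in> insert d D then 0 else x $ e) = upd (\<chi> e. if e \<in> D then 0 else x $ e) d 0"
        by (auto simp: vec_eq_iff)
      then show ?case by (simp only: ic insert.IH)
    qed (simp add: vec_lambda_eta)
    from this[of UNIV] show ?thesis by (simp add: zero_vec_def)
  qed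
  show ?thesis
  proof (rule that[of "\<lambda>\<alpha>. c \<alpha> 0"])
    show "expands r h (\<lambda>\<alpha>. c \<alpha> 0)"
      unfolding expands_def
    proof
      fix x :: "'n cvec" assume "x \<in> cube r"
      have "(\<lambda>\<alpha>. c \<alpha> x * mpow x \<alpha>) = (\<lambda>\<alpha>. c \<alpha> 0 * mpow x \<alpha>)"
        by (intro ext arg_cong2[where f = "(*)"] const refl)
      then show "((\<lambda>\<alpha>. c \<alpha> 0 * mpow x \<alpha>) has_sum h x) UNIV"
        using sc[OF \<open>x \<in> cube r\<close>] by simp
    qed
    show "cmod (c \<alpha> 0) * r ^ degree_of \<alpha> \<le> B" for \<alpha>
      using bc[of 0 \<alpha>] r by (simp add: mem_cube)
  qed
qed

lemma holomorphic_vec_upd: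
  assumes f: "holomorphic_vec f (polydisc \<rho>)" and x: "x \<in> polydisc \<rho>" and r: "r \<le> \<rho> $ d"
  shows "(\<lambda>z. f (upd x d z)) holomorphic_on ball 0 r"
  unfolding holomorphic_on_def
proof
  fix z :: complex assume z: "z \<in> ball 0 r"
  then have "upd x d z \<in> polydisc \<rho>" using x r by (auto simp: polydisc_def)
  then obtain c where c: "(f has_derivative (\<lambda>h. \<Sum>d\<in>UNIV. c $ d * h $ d)) (at (upd x d z))"
    using f by (auto simp: holomorphic_vec_def)
  have "((\<lambda>z. upd x d z) has_derivative (\<lambda>h. \<chi> e. if e = d then h else 0)) (at z)"
  proof (subst has_derivative_componentwise_within, intro ballI)
    fix b :: "complex ^ 'a" assume "b \<in> Basis"
    then obtain e u where b: "b = axis e u" "u \<in> Basis" by (auto simp: Basis_vec_def)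
    show "((\<lambda>z. upd x d z \<bullet> b) has_derivative (\<lambda>h. (\<chi> e. if e = d then h else 0) \<bullet> b)) (at z)"
      by (cases "e = d") (auto simp: b inner_axis intro!: derivative_eq_intros)
  qed
  from diff_chain_at[OF this c]
  have "((\<lambda>z. f (upd x d z)) has_derivative (\<lambda>h. \<Sum>e\<in>UNIV. c $ e * (if e = d then h else 0))) (at z)"
    by (simp add: o_def)
  also have "(\<lambda>h. \<Sum>e\<in>UNIV. c $ e * (if e = d then h else 0)) = (*) (c $ d)"
    by (auto simp: if_distrib[of "\<lambda>h. c $ _ * h"] cong: if_cong)
  finally have "((\<lambda>z. f (upd x d z)) has_field_derivative (c $ d)) (at z)"
    by (simp add: has_field_derivative_def)
  then show "(\<lambda>z. f (upd x d z)) field_differentiable at z within ball 0 r"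
    by (auto simp: field_differentiable_def intro: DERIV_subset)
qed

lemma holomorphic_vec_continuous:
  "holomorphic_vec f U \<Longrightarrow> continuous_on U f"
  unfolding holomorphic_vec_def continuous_on_eq_continuous_within
  by (meson continuous_at_imp_continuous_at_within has_derivative_continuous)

lemma compact_closed_polydisc: "compact {x :: 'n::finite cvec. \<forall>d. cmod (x $ d) \<le> r}"
  unfolding compact_eq_bounded_closed
proof
  show "bounded {x :: 'n cvec. \<forall>d. cmod (x $ d) \<le> r}"
    unfolding bounded_iff
  proof (intro exI ballI)
    fix x :: "'n cvec" assume "x \<in> {x. \<forall>d. cmod (x $ d) \<le> r}"
    then have "(\<Sum>d\<in>UNIV. cmod (x $ d)) \<le> (\<Sum>d\<in>(UNIV::'n set). r)" by (intro sum_mono) auto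
    then show "norm x \<le> (\<Sum>d\<in>(UNIV::'n set). r)" using L2_set_le_sum[of UNIV "\<lambda>d. cmod (x $ d)"] by (simp add: norm_vec_def)
  qed
  have "closed (\<Inter>d. {x :: 'n cvec. cmod (x $ d) \<le> r})"
    by (intro closed_INT ballI closed_Collect_le continuous_intros)
  also have "(\<Inter>d. {x :: 'n cvec. cmod (x $ d) \<le> r}) = {x. \<forall>d. cmod (x $ d) \<le> r}" by auto
  finally show "closed {x :: 'n cvec. \<forall>d. cmod (x $ d) \<le> r}" .
qed

lemma cube_subset_polydisc: "(\<And>d. r \<le> \<rho> $ d) \<Longrightarrow> cube r \<subseteq> polydisc \<rho>"
  by (auto simp: polydisc_def intro: less_le_trans)

lemma holomorphic_vec_expands:
  fixes f :: "'n::finite cvec \<Rightarrow> complex"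
  assumes f: "holomorphic_vec f (polydisc \<rho>)" and r: "0 < r" "\<And>d. r \<le> \<rho> $ d"
    and B: "\<And>x. x \<in> cube r \<Longrightarrow> cmod (f x) \<le> B"
  obtains c where "expands r f c" "\<And>\<alpha>. cmod (c \<alpha>) * r ^ degree_of \<alpha> \<le> B"
proof -
  have "separately_holomorphic r f"
    unfolding separately_holomorphic_def
    using holomorphic_vec_upd[OF f _ r(2)] cube_subset_polydisc[OF r(2)] by blast
  from separately_holomorphic_expands[OF r(1) this B] obtain c
    where "expands r f c" "\<And>\<alpha>. cmod (c \<alpha>) * r ^ degree_of \<alpha> \<le> B" by blast
  then show thesis by (rule that)
qed

lemma holomorphic_vec_bounded:
  fixes f :: "'n::finite cvec \<Rightarrow> complex"
  assumes f: "holomorphic_vec f (polydisc \<rho>)" and r: "\<And>d. r < \<rho> $ d"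
  obtains B where "B > 0" "\<And>x. x \<in> cube r \<Longrightarrow> cmod (f x) \<le> B"
proof -
  let ?K = "{x :: 'n cvec. \<forall>d. cmod (x $ d) \<le> r}"
  have "?K \<subseteq> polydisc \<rho>" using r by (auto simp: polydisc_def intro: le_less_trans)
  then have "compact (f ` ?K)"
    using holomorphic_vec_continuous[OF f] compact_closed_polydisc
    by (intro compact_continuous_image) (auto intro: continuous_on_subset)
  then obtain B where "B > 0" "\<And>y. y \<in> f ` ?K \<Longrightarrow> norm y \<le> B"
    using compact_imp_bounded bounded_pos by metis
  then show ?thesis using that[of B] by (force simp: mem_cube intro: less_imp_le)
qed

text \<open>A holomorphic coefficient \<open>a(t, x)\<close> of the equation is bounded on a compact polydisc; its Taylor
  coefficients in \<open>t\<close> are then separately holomorphic in \<open>x\<close>, with a common geometric bound.\<close>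

lemma time_coefficients_expand:
  fixes a :: "complex \<Rightarrow> 'n::finite cvec \<Rightarrow> complex"
  assumes a: "holomorphic_time_vec a (ball 0 \<rho>0 \<times> polydisc \<rho>)" and \<rho>0: "\<rho>0 > 0"
    and r: "0 < r" "r < \<rho>0" "\<And>d. r < \<rho> $ d"
  obtains B where "B > 0" and
    "\<And>j. \<exists>c. expands r (\<lambda>x. fps_nth (fps_expansion (\<lambda>t. a t x) 0) j) c \<and>
         (\<forall>\<alpha>. cmod (c \<alpha>) * r ^ degree_of \<alpha> * r ^ j \<le> B)"
proof -
  let ?U = "ball 0 \<rho>0 \<times> polydisc \<rho>"
  let ?K = "cball 0 r \<times> {x :: 'n cvec. \<forall>d. cmod (x $ d) \<le> r}"
  have cont: "continuous_on ?U (\<lambda>(t, x). a t x)"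
    using a unfolding holomorphic_time_vec_def continuous_on_eq_continuous_within
    by (meson continuous_at_imp_continuous_at_within has_derivative_continuous)
  have "?K \<subseteq> ?U" using r by (auto simp: polydisc_def intro: le_less_trans)
  then have "compact ((\<lambda>(t, x). a t x) ` ?K)"
    using compact_closed_polydisc[of r] cont
    by (intro compact_continuous_image compact_Times) (auto intro: continuous_on_subset)
  then obtain B where B: "B > 0" "\<And>y. y \<in> (\<lambda>(t, x). a t x) ` ?K \<Longrightarrow> norm y \<le> B"
    using compact_imp_bounded bounded_pos by metis
  have Bb: "cmod (a t x) \<le> B" if "t \<in> ball 0 r" "x \<in> cube r" for t x
  proof (rule B(2))
    have "(t, x) \<in> ?K" using that by (auto simp: mem_cube less_imp_le)
    then show "a t x \<in> (\<lambda>(t, x). a t x) ` ?K" by (metis (no_types, lifting) case_prod_conv imageI)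
  qed
  have der: "\<exists>c0 c. ((\<lambda>(t, x). a t x) has_derivative (\<lambda>(\<tau>, h). c0 * \<tau> + (\<Sum>d\<in>UNIV. c $ d * h $ d))) (at (t, x))"
    if "t \<in> ball 0 \<rho>0" "x \<in> polydisc \<rho>" for t x
    using a that by (auto simp: holomorphic_time_vec_def)
  have hx: "holomorphic_vec (a t) (polydisc \<rho>)" if t: "t \<in> ball 0 \<rho>0" for t
    unfolding holomorphic_vec_def
  proof
    fix x assume "x \<in> polydisc \<rho>"
    from der[OF t this] obtain c0 c where
      c: "((\<lambda>(t, x). a t x) has_derivative (\<lambda>(\<tau>, h). c0 * \<tau> + (\<Sum>d\<in>UNIV. c $ d * h $ d))) (at (t, x))"
      by blast
    have "((\<lambda>x. (t, x)) has_derivative (\<lambda>h. (0, h))) (at x)" by (auto intro!: derivative_eq_intros)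
    from diff_chain_at[OF this c]
    show "\<exists>c. (a t has_derivative (\<lambda>h. \<Sum>d\<in>UNIV. c $ d * h $ d)) (at x)"
      by (auto simp: o_def)
  qed
  have ht: "(\<lambda>t. a t x) holomorphic_on ball 0 r" if x: "x \<in> polydisc \<rho>" for x
    unfolding holomorphic_on_def
  proof
    fix t :: complex assume "t \<in> ball 0 r"
    then have "t \<in> ball 0 \<rho>0" using r by auto
    from der[OF this x] obtain c0 c where
      c: "((\<lambda>(t, x). a t x) has_derivative (\<lambda>(\<tau>, h). c0 * \<tau> + (\<Sum>d\<in>UNIV. c $ d * h $ d))) (at (t, x))"
      by blast
    have "((\<lambda>t. (t, x)) has_derivative (\<lambda>h. (h, 0))) (at t)" by (auto intro!: derivative_eq_intros)
    from diff_chain_at[OF this c]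
    have "((\<lambda>t. a t x) has_field_derivative c0) (at t)"
      by (simp add: o_def has_field_derivative_def)
    then show "(\<lambda>t. a t x) field_differentiable at t within ball 0 r"
      by (auto simp: field_differentiable_def intro: DERIV_subset)
  qed
  have sub: "cube r \<subseteq> polydisc \<rho>" by (rule cube_subset_polydisc) (use r in \<open>auto intro: less_imp_le\<close>)
  show ?thesis
  proof (rule that[OF B(1)])
    fix j
    define h where "h = (\<lambda>x. (deriv ^^ j) (\<lambda>t. a t x) 0 / fact j)"
    have "separately_holomorphic r h"
      unfolding separately_holomorphic_def h_def
    proof (intro ballI allI)
      fix x :: "'n cvec" and d assume x: "x \<in> cube r"
      show "(\<lambda>z. (deriv ^^ j) (\<lambda>t. a t (upd x d z)) 0 / fact j) holomorphic_on ball 0 r"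
      proof (rule taylor_coefficient_holomorphic[where r = r and B = B])
        fix z :: complex assume "z \<in> ball 0 r"
        then have "upd x d z \<in> cube r" by (intro upd_in_cube x) auto
        then show "(\<lambda>t. a t (upd x d z)) holomorphic_on ball 0 r" using ht sub by blast
      next
        fix t :: complex assume "t \<in> ball 0 r"
        then have "t \<in> ball 0 \<rho>0" using r by auto
        from holomorphic_vec_upd[OF hx[OF this] _ less_imp_le[OF r(3)]]
        show "(\<lambda>z. a t (upd x d z)) holomorphic_on ball 0 r" using x sub by blast
      next
        fix t z :: complex assume "t \<in> ball 0 r" "z \<in> ball 0 r"
        then show "cmod (a t (upd x d z)) \<le> B" by (intro Bb upd_in_cube x) auto
      qed (use r in auto)
    qed
    moreover have "cmod (h x) \<le> B / r ^ j" if x: "x \<in> cube r" for x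
    proof -
      have "cmod (h x) * r ^ j \<le> B"
        unfolding h_def by (rule taylor_coefficient_bound) (use x sub ht Bb r in auto)
      then show ?thesis using r by (simp add: field_simps)
    qed
    ultimately obtain c where "expands r h c" "\<And>\<alpha>. cmod (c \<alpha>) * r ^ degree_of \<alpha> \<le> B / r ^ j"
      using separately_holomorphic_expands[OF r(1)] by blast
    then show "\<exists>c. expands r (\<lambda>x. fps_nth (fps_expansion (\<lambda>t. a t x) 0) j) c \<and>
         (\<forall>\<alpha>. cmod (c \<alpha>) * r ^ degree_of \<alpha> * r ^ j \<le> B)"
      using r by (intro exI[of _ c]) (auto simp: h_def fps_expansion_def field_simps)
  qed
qed

section \<open>The weights\<close>

text \<open>The left-hand side is one term of Vandermonde's sum for the right-hand side.\<close>

lemma binomial_mult_le: "(a choose k) * (b choose l) \<le> (a + b) choose (k + l)"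
proof -
  have "(a choose k) * (b choose (k + l - k)) \<le> (\<Sum>i\<le>k + l. (a choose i) * (b choose (k + l - i)))"
    by (rule member_le_sum) auto
  then show ?thesis by (simp add: vandermonde)
qed

lemma binomial_power_le: "(a choose k) ^ L \<le> (L * a) choose (L * k)"
proof (induction L)
  case (Suc L)
  have "(a choose k) ^ Suc L \<le> (a choose k) * ((L * a) choose (L * k))"
    using Suc by simp
  also have "\<dots> \<le> (a + L * a) choose (k + L * k)" by (rule binomial_mult_le)
  finally show ?case by simp
qed auto

lemma fact_add_lower: "real (a + 1) ^ k * fact a \<le> fact (a + k)"
proof (induction k)
  case (Suc k)
  have "real (a + 1) ^ Suc k * fact a = real (a + 1) * (real (a + 1) ^ k * fact a)" by simp
  also have "\<dots> \<le> real (a + k + 1) * fact (a + k)"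
    using Suc by (intro mult_mono) auto
  finally show ?case by (simp add: algebra_simps)
qed auto

lemma fact_add_upper: "fact (a + k) \<le> real (a + k) ^ k * fact a"
proof (induction k)
  case (Suc k)
  have "fact (a + Suc k) = real (a + Suc k) * fact (a + k)" by simp
  also have "\<dots> \<le> real (a + Suc k) * (real (a + k) ^ k * fact a)"
    using Suc by (intro mult_left_mono) auto
  also have "\<dots> \<le> real (a + Suc k) * (real (a + Suc k) ^ k * fact a)"
    by (intro mult_left_mono mult_right_mono power_mono) auto
  finally show ?case by (simp add: algebra_simps)
qed auto

lemma fact_power_le: "(fact j :: real) ^ L \<le> fact (L * j)"
proof (cases "L = 0")
  case False
  show ?thesis
  proof (induction j)
    case (Suc j)
    have "(fact (Suc j) :: real) ^ L = real (j + 1) ^ L * fact j ^ L"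
      by (simp only: Suc_eq_plus1[symmetric] fact_Suc power_mult_distrib)
    also have "\<dots> \<le> real (L * j + 1) ^ L * fact (L * j)"
      using Suc False mult_le_mono1[of 1 L j] by (intro mult_mono power_mono) (auto simp flip: of_nat_mult)
    also have "\<dots> \<le> fact (L * j + L)" by (rule fact_add_lower)
    finally show ?case by (simp add: algebra_simps)
  qed auto
qed simp

text \<open>Cut \<open>(L j)!\<close> into blocks of \<open>L\<close> consecutive factors; the factors of the \<open>i\<close>-th block are at most
  \<open>L i\<close>.\<close>

lemma fact_mult_le: "fact (L * j) \<le> (real L ^ j * fact j) ^ L"
proof (induction j)
  case (Suc j)
  have "fact (L * Suc j) = (fact (L * j + L) :: real)" by (simp add: add.commute)
  also have "\<dots> \<le> real (L * j + L) ^ L * fact (L * j)" by (rule fact_add_upper)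
  also have "\<dots> \<le> real (L * j + L) ^ L * (real L ^ j * fact j) ^ L"
    using Suc by (intro mult_left_mono) auto
  also have "\<dots> = (real (L * j + L) * (real L ^ j * fact j)) ^ L"
    by (rule power_mult_distrib[symmetric])
  also have "real (L * j + L) * (real L ^ j * fact j) = real L ^ Suc j * fact (Suc j)"
    by (simp add: algebra_simps)
  finally show ?case .
qed auto

lemma fact_add_binomial: "fact (a + b) = real ((a + b) choose a) * fact a * fact b"
proof -
  have "fact a * fact b * ((a + b) choose a) = (fact (a + b) :: nat)"
    using binomial_fact_lemma[of a "a + b"] by simp
  then have "real (fact a * fact b * ((a + b) choose a)) = real (fact (a + b))" by (rule arg_cong)
  then show ?thesis by (simp add: mult_ac)
qed

text \<open>The product \<open>L \<beta> = s\<^sub>0 + \<sigma>\<close> is the order of growth per step in \<open>j\<close>; splitting it with \<open>L\<close> integral makes all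
  weights quotients of factorials, and \<open>\<beta> \<le> 1\<close> keeps the cost of a derivative in \<open>x\<^sub>d\<close> below
  \<open>s\<^sub>d \<ge> 1\<close>.\<close>

locale gevrey_weight =
  fixes s0 \<sigma> \<beta> :: real and L :: nat
  assumes s0: "0 < s0" and \<sigma>: "0 \<le> \<sigma>" and \<beta>: "0 < \<beta>" "\<beta> \<le> 1" and L: "1 \<le> L"
    and L\<beta>: "real L * \<beta> = s0 + \<sigma>"
begin

definition F :: "nat \<Rightarrow> nat \<Rightarrow> real" where
  "F j n = (fact (L * j + n) / fact n) powr \<beta> / fact j powr s0"

lemma F_pos: "F j n > 0" by (simp add: F_def)

lemma F_0_0: "F 0 0 = 1" by (simp add: F_def)

text \<open>The quotient of the two sides is a power \<open>\<beta>\<close> of a quotient of binomial coefficients over a power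
  \<open>s\<^sub>0\<close> of one. By Vandermonde the former is at least \<open>(j\<^sub>1 + j\<^sub>2) choose j\<^sub>1\<close> to the power
  \<open>L \<beta> = s\<^sub>0 + \<sigma>\<close>, which beats the latter.\<close>

lemma F_mult: "F j1 n1 * F j2 n2 \<le> F (j1 + j2) (n1 + n2)"
proof -
  define b where "b = real ((j1 + j2) choose j1)"
  define c where "c = real ((n1 + n2) choose n1)"
  define C where "C = real ((L * j1 + n1 + (L * j2 + n2)) choose (L * j1 + n1))"
  have b1: "b \<ge> 1" and c0: "c > 0" and C0: "C > 0"
    unfolding b_def c_def C_def by (auto simp: Suc_leI)
  have "((j1 + j2) choose j1) ^ L * ((n1 + n2) choose n1) \<le>
        (L * (j1 + j2) + (n1 + n2)) choose (L * j1 + n1)"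
    by (rule order_trans[OF mult_right_mono[OF binomial_power_le] binomial_mult_le]) auto
  also have "L * (j1 + j2) + (n1 + n2) = L * j1 + n1 + (L * j2 + n2)" by (simp add: algebra_simps)
  finally have "real (((j1 + j2) choose j1) ^ L * ((n1 + n2) choose n1)) \<le> C"
    unfolding C_def by (simp only: of_nat_le_iff)
  then have bcC: "b ^ L \<le> C / c" using c0 by (simp add: b_def c_def field_simps)
  have "b powr s0 \<le> b powr (real L * \<beta>)" using b1 \<sigma> by (intro powr_mono) (auto simp: L\<beta>)
  also have "\<dots> = (b ^ L) powr \<beta>" using b1 by (simp add: powr_powr powr_realpow[symmetric])
  also have "\<dots> \<le> (C / c) powr \<beta>" using bcC b1 \<beta> by (intro powr_mono2) auto
  finally have key: "b powr s0 \<le> (C / c) powr \<beta>" .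
  have "F (j1 + j2) (n1 + n2) =
     (fact (L * j1 + n1 + (L * j2 + n2)) / fact (n1 + n2)) powr \<beta> / fact (j1 + j2) powr s0"
    by (simp add: F_def algebra_simps)
  also have "\<dots> = (C / c * (fact (L * j1 + n1) / fact n1) * (fact (L * j2 + n2) / fact n2)) powr \<beta>
                   / (b * fact j1 * fact j2) powr s0"
    unfolding fact_add_binomial b_def c_def C_def by (simp add: field_simps)
  also have "\<dots> = ((C / c) powr \<beta> / b powr s0) * (F j1 n1 * F j2 n2)"
    using b1 c0 C0 by (simp add: F_def powr_mult powr_divide mult_ac)
  finally have "F (j1 + j2) (n1 + n2) = ((C / c) powr \<beta> / b powr s0) * (F j1 n1 * F j2 n2)" .
  moreover have "1 * (F j1 n1 * F j2 n2) \<le> ((C / c) powr \<beta> / b powr s0) * (F j1 n1 * F j2 n2)"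
    using key b1 F_pos[of j1 n1] F_pos[of j2 n2] by (intro mult_right_mono) auto
  ultimately show ?thesis by simp
qed

lemma F_Suc_j:
  "F (Suc j) n * real (j + 1) powr s0 = F j n * (fact (L * j + n + L) / fact (L * j + n)) powr \<beta>"
proof -
  have "fact (L * Suc j + n) = (fact (L * j + n + L) :: real)" by (simp add: algebra_simps)
  then show ?thesis
    by (simp add: F_def powr_mult powr_divide field_simps del: fact_Suc mult_Suc_right) (simp add: powr_mult)
qed

lemma powr_L\<beta>: "x > 0 \<Longrightarrow> (x ^ L) powr \<beta> = x powr (s0 + \<sigma>)"
  by (simp add: powr_powr powr_realpow[symmetric] L\<beta>)

lemma F_Suc_j_lower: "F j n * real (j + n + 1) powr (s0 + \<sigma>) \<le> F (Suc j) n * real (j + 1) powr s0"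
proof -
  have "real (j + n + 1) ^ L \<le> real (L * j + n + 1) ^ L"
    using L mult_le_mono1[OF L, of j] by (intro power_mono) (auto simp del: of_nat_add of_nat_mult of_nat_Suc)
  also have "\<dots> \<le> fact (L * j + n + L) / fact (L * j + n)"
    using fact_add_lower[of "L * j + n" L] by (simp add: pos_le_divide_eq)
  finally have "(real (j + n + 1) ^ L) powr \<beta> \<le> (fact (L * j + n + L) / fact (L * j + n)) powr \<beta>"
    using \<beta> by (intro powr_mono2) auto
  then show ?thesis
    unfolding F_Suc_j using F_pos[of j n] by (subst (asm) powr_L\<beta>) (auto intro!: mult_left_mono)
qed

lemma F_Suc_j_upper:
  "F (Suc j) n * real (j + 1) powr s0 \<le> F j n * (real L powr (s0 + \<sigma>) * real (j + n + 1) powr (s0 + \<sigma>))"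
proof -
  have "fact (L * j + n + L) / fact (L * j + n) \<le> real (L * j + n + L) ^ L"
    using fact_add_upper[of "L * j + n" L] by (simp add: pos_divide_le_eq)
  also have "\<dots> \<le> real (L * (j + n + 1)) ^ L"
    using mult_le_mono1[OF L, of n] by (intro power_mono) (auto simp: algebra_simps simp flip: of_nat_add of_nat_mult)
  finally have "(fact (L * j + n + L) / fact (L * j + n)) powr \<beta> \<le> (real (L * (j + n + 1)) ^ L) powr \<beta>"
    using \<beta> by (intro powr_mono2) auto
  also have "\<dots> = real L powr (s0 + \<sigma>) * real (j + n + 1) powr (s0 + \<sigma>)"
    using L by (subst powr_L\<beta>) (simp_all add: powr_mult del: of_nat_add mult_Suc_right add_Suc_right)
  finally show ?thesis
    unfolding F_Suc_j using F_pos[of j n] by (auto intro!: mult_left_mono)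
qed

lemma F_Suc_n: "F j (Suc n) = F j n * (real (L * j + n + 1) / real (n + 1)) powr \<beta>"
  by (simp add: F_def powr_mult[symmetric])
     (simp add: field_simps powr_mult powr_divide)

text \<open>A derivative in \<open>x\<^sub>d\<close> multiplies by \<open>(n + 1)\<^sup>s\<close> and shifts \<open>n\<close>. The shift costs
  \<open>((L j + n + 1) / (n + 1))\<^sup>\<beta>\<close>, at most a constant times \<open>((j + n + 1) / (n + 1))\<^sup>s\<close> because
  \<open>\<beta> \<le> 1 \<le> s\<close>; the powers of \<open>n + 1\<close> cancel.\<close>

lemma F_Suc_n_upper:
  assumes "s \<ge> 1"
  shows "real (n + 1) powr s * F j (Suc n) \<le> F j n * (real L powr \<beta> * real (j + n + 1) powr s)"
proof -
  let ?q = "real (j + n + 1) / real (n + 1)"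
  have "(real (L * j + n + 1) / real (n + 1)) powr \<beta> \<le> (real L * ?q) powr \<beta>"
  proof (intro powr_mono2)
    have "L * j + n + 1 \<le> L * (j + n + 1)"
      using mult_le_mono1[OF L, of "n + 1"] by (simp add: algebra_simps)
    then have "real (L * j + n + 1) \<le> real L * real (j + n + 1)"
      by (simp flip: of_nat_mult del: of_nat_Suc of_nat_add)
    then show "real (L * j + n + 1) / real (n + 1) \<le> real L * ?q"
      by (simp add: divide_right_mono)
  qed (use \<beta> in auto)
  also have "\<dots> = real L powr \<beta> * ?q powr \<beta>" by (rule powr_mult)
  also have "\<dots> \<le> real L powr \<beta> * ?q powr s"
    using \<beta> assms by (intro mult_left_mono powr_mono) auto
  also have "\<dots> = real L powr \<beta> * (real (j + n + 1) powr s / real (n + 1) powr s)"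
    by (subst powr_divide) auto
  finally have "F j n * (real (L * j + n + 1) / real (n + 1)) powr \<beta> \<le>
     F j n * (real L powr \<beta> * (real (j + n + 1) powr s / real (n + 1) powr s))"
    using F_pos[of j n] by (intro mult_left_mono) auto
  then have "real (n + 1) powr s * F j (Suc n) \<le>
      real (n + 1) powr s * (F j n * (real L powr \<beta> * (real (j + n + 1) powr s / real (n + 1) powr s)))"
    unfolding F_Suc_n by (rule mult_left_mono) auto
  then show ?thesis by simp
qed

lemma F_lower: "fact j powr \<sigma> \<le> F j n"
proof -
  have "(fact j :: real) ^ L \<le> fact (L * j)" by (rule fact_power_le)
  also have "\<dots> \<le> fact (L * j + n) / fact n"
  proof -
    have "1 * fact (L * j) * fact n \<le> real ((L * j + n) choose (L * j)) * fact (L * j) * fact n"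
      by (intro mult_right_mono) (auto simp: Suc_leI)
    then show ?thesis by (simp add: fact_add_binomial pos_le_divide_eq)
  qed
  finally have "((fact j :: real) ^ L) powr \<beta> \<le> (fact (L * j + n) / fact n) powr \<beta>"
    using \<beta> by (intro powr_mono2) auto
  then have "(fact j :: real) powr (s0 + \<sigma>) \<le> (fact (L * j + n) / fact n) powr \<beta>"
    by (subst (asm) powr_L\<beta>) auto
  then show ?thesis by (simp add: F_def powr_add pos_le_divide_eq mult.commute)
qed

lemma F_upper:
  obtains C where "C \<ge> 1" "\<And>j n. F j n \<le> C ^ (j + n) * fact j powr \<sigma>"
proof
  define A where "A = 2 ^ L * real L ^ L"
  have A1: "A \<ge> 1" unfolding A_def using L by (auto intro!: mult_ge1_I)
  define C where "C = 2 * A"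
  show "2 * A \<ge> 1" using A1 by simp
  fix j n
  have "fact (L * j + n) / fact n = real ((L * j + n) choose (L * j)) * fact (L * j)"
    by (simp add: fact_add_binomial)
  also have "\<dots> \<le> 2 ^ (L * j + n) * (real L ^ j * fact j) ^ L"
  proof (intro mult_mono fact_mult_le)
    have "(L * j + n) choose (L * j) \<le> 2 ^ (L * j + n)" by (rule binomial_le_pow2)
    then show "real ((L * j + n) choose (L * j)) \<le> 2 ^ (L * j + n)"
      by (metis of_nat_le_iff of_nat_numeral of_nat_power)
  qed auto
  also have "\<dots> = 2 ^ n * A ^ j * fact j ^ L"
    by (simp add: A_def power_add power_mult power_mult_distrib) (simp add: mult_ac flip: power_mult)
  finally have "(fact (L * j + n) / fact n) powr \<beta> \<le> (2 ^ n * A ^ j * fact j ^ L) powr \<beta>"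
    using \<beta> by (intro powr_mono2) auto
  also have "\<dots> = (2 ^ n * A ^ j) powr \<beta> * fact j powr (s0 + \<sigma>)"
    using A1 by (simp add: powr_mult powr_L\<beta>)
  also have "(2 ^ n * A ^ j) powr \<beta> \<le> (2 ^ n * A ^ j) powr 1"
    using \<beta> A1 by (intro powr_mono) (auto intro!: mult_ge1_I)
  also have "(2 ^ n * A ^ j) powr 1 = 2 ^ n * A ^ j" using A1 by simp
  also have "2 ^ n * A ^ j \<le> (2 * A) ^ (j + n)"
  proof -
    have "1 * (1 * (2 ^ n * A ^ j)) \<le> 2 ^ j * (A ^ n * (2 ^ n * A ^ j))"
      using A1 by (intro mult_mono) auto
    then show ?thesis by (simp add: power_add power_mult_distrib mult_ac)
  qed
  finally have "(fact (L * j + n) / fact n) powr \<beta> \<le> (2 * A) ^ (j + n) * fact j powr (s0 + \<sigma>)"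
    by (simp add: mult_right_mono)
  then show "F j n \<le> (2 * A) ^ (j + n) * fact j powr \<sigma>"
    by (simp add: F_def powr_add pos_divide_le_eq mult_ac)
qed

text \<open>Multiplication by \<open>t\<close> raises \<open>j\<close> by one without any moment quotient. The gain is
  \<open>(j + n + 1)\<close> to the power \<open>s\<^sub>0 + \<sigma>\<close> over \<open>(j + 1)\<close> to the power \<open>s\<^sub>0\<close>, hence at least the power
  \<open>\<sigma>\<close> of \<open>j + n + 1\<close>.\<close>

lemma F_shift_\<sigma>: "F i n * real (i + n + 1) powr (\<sigma> * real v) \<le> F (i + v) n"
proof (induction v)
  case 0
  then show ?case by simp
next
  case (Suc v)
  have "F i n * real (i + n + 1) powr (\<sigma> * real (Suc v)) =
        F i n * real (i + n + 1) powr (\<sigma> * real v) * real (i + n + 1) powr \<sigma>"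
    by (simp add: powr_add distrib_left)
  also have "\<dots> \<le> F (i + v) n * real (i + v + n + 1) powr \<sigma>"
    using Suc \<sigma> F_pos[of "i + v" n] by (intro mult_mono powr_mono2) auto
  also have "\<dots> \<le> F (Suc (i + v)) n"
  proof (rule mult_right_le_imp_le)
    have "F (i + v) n * real (i + v + n + 1) powr \<sigma> * real (i + v + 1) powr s0 \<le>
               F (i + v) n * real (i + v + n + 1) powr \<sigma> * real (i + v + n + 1) powr s0"
      using s0 F_pos[of "i + v" n] by (intro mult_left_mono powr_mono2) auto
    also have "\<dots> = F (i + v) n * real (i + v + n + 1) powr (s0 + \<sigma>)"
      by (simp add: powr_add mult_ac)
    also have "\<dots> \<le> F (Suc (i + v)) n * real (i + v + 1) powr s0" by (rule F_Suc_j_lower)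
    finally show "F (i + v) n * real (i + v + n + 1) powr \<sigma> * real (i + v + 1) powr s0 \<le>
        F (Suc (i + v)) n * real (i + v + 1) powr s0" .
  qed auto
  finally show ?case by simp
qed

text \<open>Solving for the coefficient with index \<open>j + \<kappa>\<close> divides by \<open>m\<^sub>0(j + \<kappa>) / m\<^sub>0(j)\<close>, which is of the
  size of the factor on the right; with it, the full power \<open>s\<^sub>0 + \<sigma>\<close> is gained in each of the
  \<open>\<kappa>\<close> steps.\<close>

lemma F_shift_S: "F j n * real (j + n + 1) powr ((s0 + \<sigma>) * real \<kappa>) \<le> F (j + \<kappa>) n * (fact (j + \<kappa>) / fact j) powr s0"
proof (induction \<kappa>)
  case 0
  then show ?case by simp
next
  case (Suc k)
  let ?S = "s0 + \<sigma>"
  have "F j n * real (j + n + 1) powr (?S * real (Suc k)) =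
        F j n * real (j + n + 1) powr (?S * real k) * real (j + n + 1) powr ?S"
    by (simp add: powr_add distrib_left)
  also have "\<dots> \<le> F (j + k) n * (fact (j + k) / fact j) powr s0 * real (j + k + n + 1) powr ?S"
    using \<sigma> s0 F_pos[of "j + k" n] by (intro mult_mono[OF Suc] powr_mono2) auto
  also have "\<dots> = F (j + k) n * real (j + k + n + 1) powr ?S * (fact (j + k) / fact j) powr s0" by simp
  also have "\<dots> \<le> F (Suc (j + k)) n * real (j + k + 1) powr s0 * (fact (j + k) / fact j) powr s0"
    by (intro mult_right_mono F_Suc_j_lower) auto
  also have "\<dots> = F (j + Suc k) n * (real (j + k + 1) * (fact (j + k) / fact j)) powr s0"
    by (simp only: powr_mult mult_ac add_Suc_right)
  also have "real (j + k + 1) * (fact (j + k) / fact j) = fact (j + Suc k) / fact j"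
    by simp
  finally show ?case .
qed

text \<open>The inequality behind the critical value: a term with the factor \<open>t\<^sup>v\<close> may cost the power
  \<open>E\<close> of \<open>i + n + 1\<close> when the index rises from \<open>i\<close> to \<open>i + v + \<kappa>\<close>.\<close>

lemma F_critical:
  assumes "E \<le> (s0 + \<sigma>) * real \<kappa> + \<sigma> * real v"
  shows "F i n * real (i + n + 1) powr E \<le>
         F (i + v + \<kappa>) n * (fact (i + v + \<kappa>) / fact (i + v)) powr s0"
proof -
  have "F i n * real (i + n + 1) powr E \<le> F i n * real (i + n + 1) powr (\<sigma> * real v + (s0 + \<sigma>) * real \<kappa>)"
    using assms F_pos[of i n] by (intro mult_left_mono powr_mono) auto
  also have "\<dots> = F i n * real (i + n + 1) powr (\<sigma> * real v) * real (i + n + 1) powr ((s0 + \<sigma>) * real \<kappa>)"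
    by (simp add: powr_add)
  also have "\<dots> \<le> F (i + v) n * real (i + v + n + 1) powr ((s0 + \<sigma>) * real \<kappa>)"
    using F_shift_\<sigma>[of i n v] F_pos[of "i + v" n] s0 \<sigma> by (intro mult_mono powr_mono2) auto
  also have "\<dots> \<le> F (i + v + \<kappa>) n * (fact (i + v + \<kappa>) / fact (i + v)) powr s0"
    by (rule F_shift_S)
  finally show ?thesis .
qed

end

lemma gevrey_weight_exists:
  assumes "0 < s0" "0 \<le> \<sigma>"
  obtains \<beta> L where "gevrey_weight s0 \<sigma> \<beta> L"
proof
  let ?L = "nat \<lceil>s0 + \<sigma>\<rceil>"
  have L: "real ?L \<ge> s0 + \<sigma>" "?L \<ge> 1" using assms by linarith+
  then show "gevrey_weight s0 \<sigma> ((s0 + \<sigma>) / real ?L) ?L"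
    using assms by unfold_locales (auto simp: field_simps)
qed

text \<open>Pointwise bounds by \<open>F\<close> alone are not stable under products, since a Cauchy product has
  polynomially many terms. A summable factor whose convolution square is again of the same size
  repairs this.\<close>

definition decay :: "nat \<Rightarrow> 'n::finite multi_index \<Rightarrow> real" where
  "decay j \<alpha> = 1 / (real (j + 1) ^ 2 * (\<Prod>d\<in>UNIV. real (\<alpha> $ d + 1) ^ 2))"

lemma sum_inverse_squares_le: "(\<Sum>i\<le>n. 1 / real (i + 1) ^ 2) \<le> 2 - 1 / real (n + 1)"
proof (induction n)
  case (Suc n)
  have "1 / real (Suc n + 1) ^ 2 \<le> 1 / real (n + 1) - 1 / real (Suc n + 1)"
  proof -
    have "1 / real (n + 1) - 1 / real (Suc n + 1) = 1 / (real (n + 1) * real (Suc n + 1))"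
      by (simp add: field_simps)
    moreover have "1 / real (Suc n + 1) ^ 2 \<le> 1 / (real (n + 1) * real (Suc n + 1))"
      by (intro divide_left_mono) (auto simp: power2_eq_square)
    ultimately show ?thesis by simp
  qed
  then show ?case using Suc by simp
qed auto

text \<open>With \<open>a = i + 1\<close> and \<open>b = n - i + 1\<close>, use \<open>(n + 1)\<^sup>2 \<le> (a + b)\<^sup>2 \<le> 2 (a\<^sup>2 + b\<^sup>2)\<close>, so that each
  term is at most \<open>2 (1 / a\<^sup>2 + 1 / b\<^sup>2) / (n + 1)\<^sup>2\<close>.\<close>

lemma inverse_squares_convolution:
  "(\<Sum>i\<le>n. 1 / real (i + 1) ^ 2 * (1 / real (n - i + 1) ^ 2)) \<le> 8 / real (n + 1) ^ 2"
proof -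
  have sq: "(a + b) ^ 2 \<le> 2 * (a ^ 2 + b ^ 2)" for a b :: real
    using sum_squares_bound[of a b] by (simp add: power2_sum)
  have tm: "1 / real (i + 1) ^ 2 * (1 / real (n - i + 1) ^ 2) \<le>
      2 / real (n + 1) ^ 2 * (1 / real (i + 1) ^ 2 + 1 / real (n - i + 1) ^ 2)" if "i \<le> n" for i
  proof -
    let ?a = "real (i + 1)" let ?b = "real (n - i + 1)"
    have ab: "real (n + 1) \<le> ?a + ?b" using that by simp
    have "real (n + 1) ^ 2 \<le> (?a + ?b) ^ 2" using ab by (intro power_mono) auto
    also have "\<dots> \<le> 2 * (?a ^ 2 + ?b ^ 2)" by (rule sq)
    finally have "real (n + 1) ^ 2 \<le> 2 * (?a ^ 2 + ?b ^ 2)" .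
    then have "real (n + 1) ^ 2 / (?a ^ 2 * ?b ^ 2 * real (n + 1) ^ 2) \<le> 2 * (?a ^ 2 + ?b ^ 2) / (?a ^ 2 * ?b ^ 2 * real (n + 1) ^ 2)"
      by (intro divide_right_mono) auto
    then show ?thesis by (simp add: field_simps del: of_nat_Suc of_nat_add)
  qed
  have "(\<Sum>i\<le>n. 1 / real (i + 1) ^ 2 * (1 / real (n - i + 1) ^ 2)) \<le>
        (\<Sum>i\<le>n. 2 / real (n + 1) ^ 2 * (1 / real (i + 1) ^ 2 + 1 / real (n - i + 1) ^ 2))"
    by (intro sum_mono tm) auto
  also have "\<dots> = 2 / real (n + 1) ^ 2 * ((\<Sum>i\<le>n. 1 / real (i + 1) ^ 2) + (\<Sum>i\<le>n. 1 / real (n - i + 1) ^ 2))"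
    by (simp only: sum_distrib_left[symmetric] sum.distrib)
  also have "(\<Sum>i\<le>n. 1 / real (n - i + 1) ^ 2) = (\<Sum>i\<le>n. 1 / real (i + 1) ^ 2)"
    by (rule sum.reindex_bij_witness[of _ "\<lambda>i. n - i" "\<lambda>i. n - i"]) auto
  also have "2 / real (n + 1) ^ 2 * ((\<Sum>i\<le>n. 1 / real (i + 1) ^ 2) + (\<Sum>i\<le>n. 1 / real (i + 1) ^ 2))
     \<le> 2 / real (n + 1) ^ 2 * (2 + 2)"
  proof (intro mult_left_mono add_mono)
    have "0 \<le> 1 / real (n + 1)" by simp
    then show "(\<Sum>i\<le>n. 1 / real (i + 1) ^ 2) \<le> 2" using sum_inverse_squares_le[of n] by linarith
    then show "(\<Sum>i\<le>n. 1 / real (i + 1) ^ 2) \<le> 2" .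
  qed auto
  finally show ?thesis by simp
qed

lemma decay_pos: "decay j \<alpha> > 0"
  by (auto simp: decay_def intro!: divide_pos_pos mult_pos_pos prod_pos)

lemma decay_alt: "decay j \<alpha> = 1 / real (j + 1) ^ 2 * (\<Prod>d\<in>UNIV. 1 / real (\<alpha> $ d + 1) ^ 2)"
  by (simp add: decay_def prod_dividef)

lemma sum_multi_splits:
  "(\<Sum>(\<beta>, \<gamma>)\<in>multi_splits \<alpha>. f \<beta> \<gamma>) = (\<Sum>\<beta> | \<forall>d. \<beta> $ d \<in> {..\<alpha> $ d}. f \<beta> (\<alpha> - \<beta>))"
proof (rule sum.reindex_bij_witness[of _ "\<lambda>\<beta>. (\<beta>, \<alpha> - \<beta>)" fst])
  fix \<beta> assume "\<beta> \<in> {\<beta>. \<forall>d. \<beta> $ d \<in> {..\<alpha> $ d}}"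
  then show "(\<beta>, \<alpha> - \<beta>) \<in> multi_splits \<alpha>" by (auto simp: multi_splits_def vec_eq_iff)
qed (auto simp: multi_splits_def)

lemma decay_convolution:
  fixes \<alpha> :: "'n::finite multi_index"
  shows "(\<Sum>i\<le>j. \<Sum>(\<beta>, \<gamma>)\<in>multi_splits \<alpha>. decay i \<beta> * decay (j - i) \<gamma>) \<le> 8 ^ (CARD('n) + 1) * decay j \<alpha>"
proof -
  let ?s = "\<lambda>k. 1 / real (k + 1) ^ 2"
  have "(\<Sum>(\<beta>, \<gamma>)\<in>multi_splits \<alpha>. (\<Prod>d\<in>UNIV. ?s (\<beta> $ d)) * (\<Prod>d\<in>UNIV. ?s (\<gamma> $ d))) =
        (\<Sum>\<beta> | \<forall>d. \<beta> $ d \<in> {..\<alpha> $ d}. \<Prod>d\<in>UNIV. ?s (\<beta> $ d) * ?s (\<alpha> $ d - \<beta> $ d))"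
    unfolding sum_multi_splits by (simp only: prod.distrib vector_minus_component)
  also have "\<dots> = (\<Prod>d\<in>UNIV. \<Sum>k\<in>{..\<alpha> $ d}. ?s k * ?s (\<alpha> $ d - k))"
    by (rule sum_prod_multi_index) auto
  also have "\<dots> \<le> (\<Prod>d\<in>UNIV. 8 * ?s (\<alpha> $ d))"
    by (intro prod_mono conjI sum_nonneg order_trans[OF inverse_squares_convolution]) auto
  also have "\<dots> = 8 ^ CARD('n) * (\<Prod>d\<in>UNIV. ?s (\<alpha> $ d))"
    by (simp only: prod.distrib prod_constant)
  finally have x: "(\<Sum>(\<beta>, \<gamma>)\<in>multi_splits \<alpha>. (\<Prod>d\<in>UNIV. ?s (\<beta> $ d)) * (\<Prod>d\<in>UNIV. ?s (\<gamma> $ d)))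
     \<le> 8 ^ CARD('n) * (\<Prod>d\<in>UNIV. ?s (\<alpha> $ d))" .
  have "(\<Sum>i\<le>j. \<Sum>(\<beta>, \<gamma>)\<in>multi_splits \<alpha>. decay i \<beta> * decay (j - i) \<gamma>) =
     (\<Sum>i\<le>j. ?s i * ?s (j - i)) *
     (\<Sum>(\<beta>, \<gamma>)\<in>multi_splits \<alpha>. (\<Prod>d\<in>UNIV. ?s (\<beta> $ d)) * (\<Prod>d\<in>UNIV. ?s (\<gamma> $ d)))"
    unfolding sum_product decay_alt by (intro sum.cong refl) (auto simp: mult_ac)
  also have "\<dots> \<le> (8 * ?s j) * (8 ^ CARD('n) * (\<Prod>d\<in>UNIV. ?s (\<alpha> $ d)))"
    using inverse_squares_convolution[of j] x
    by (intro mult_mono) (auto intro!: sum_nonneg mult_nonneg_nonneg prod_nonneg simp: case_prod_unfold)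
  also have "\<dots> = 8 ^ (CARD('n) + 1) * decay j \<alpha>" by (simp add: decay_alt)
  finally show ?thesis .
qed

lemma decay_axis: "decay j (\<alpha> + axis d 1) \<le> decay j \<alpha>"
  unfolding decay_def
  by (intro divide_left_mono mult_left_mono prod_mono mult_pos_pos prod_pos) (auto simp: power_mono)

lemma decay_Suc: "decay (Suc j) \<alpha> \<le> decay j \<alpha>"
  unfolding decay_def
  by (intro divide_left_mono mult_right_mono mult_pos_pos prod_pos prod_nonneg) (auto simp: power_mono)

lemma decay_shift: "decay j \<alpha> \<le> real (k + 1) ^ 2 * decay (j + k) \<alpha>"
proof -
  let ?P = "(\<Prod>d\<in>UNIV. real (\<alpha> $ d + 1) ^ 2)"
  have P: "?P > 0" by (intro prod_pos) auto
  have "real (j + k + 1) ^ 2 \<le> (real (k + 1) * real (j + 1)) ^ 2" by (intro power_mono) (auto simp: algebra_simps)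
  then have "real (j + k + 1) ^ 2 \<le> real (k + 1) ^ 2 * real (j + 1) ^ 2" by (simp add: power_mult_distrib)
  then show ?thesis unfolding decay_def using P
    by (simp add: frac_le pos_le_divide_eq pos_divide_le_eq divide_simps mult_ac del: of_nat_add of_nat_Suc)
qed

text \<open>Introducing the decaying factor into a bound costs at most a larger geometric rate.\<close>

lemma decay_lower: "1 \<le> decay j \<alpha> * 4 ^ j * 4 ^ degree_of \<alpha>"
proof -
  have sq: "real (k + 1) ^ 2 \<le> 4 ^ k" for k
  proof -
    have "real (k + 1) \<le> 2 ^ k"
      by (metis Suc_eq_plus1 Suc_leI less_exp of_nat_le_iff of_nat_numeral of_nat_power)
    then have "real (k + 1) ^ 2 \<le> (2 ^ k) ^ 2" by (intro power_mono) auto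
    also have "\<dots> = 4 ^ k" by (simp flip: power_mult add: mult.commute[of k] power_mult)
    finally show ?thesis .
  qed
  have "real (j + 1) ^ 2 * (\<Prod>d\<in>UNIV. real (\<alpha> $ d + 1) ^ 2) \<le> 4 ^ j * (\<Prod>d\<in>UNIV. 4 ^ (\<alpha> $ d))"
    by (intro mult_mono sq prod_mono conjI) (auto intro!: prod_nonneg)
  also have "\<dots> = 4 ^ j * 4 ^ degree_of \<alpha>" by (simp add: degree_of_def power_sum)
  finally have "real (j + 1) ^ 2 * (\<Prod>d\<in>UNIV. real (\<alpha> $ d + 1) ^ 2) \<le> 4 ^ j * 4 ^ degree_of \<alpha>" .
  moreover have "0 < real (j + 1) ^ 2 * (\<Prod>d\<in>UNIV. real (\<alpha> $ d + 1) ^ 2)"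
    by (intro mult_pos_pos prod_pos) auto
  ultimately show ?thesis by (simp add: decay_def pos_le_divide_eq)
qed

lemma decay_le_1: "decay j \<alpha> \<le> 1"
proof -
  have "1 * 1 \<le> real (j + 1) ^ 2 * (\<Prod>d\<in>UNIV. real (\<alpha> $ d + 1) ^ 2)"
    by (intro mult_mono prod_ge_1) auto
  then show ?thesis by (simp add: decay_def divide_le_eq)
qed

section \<open>Calculus of majorants\<close>

text \<open>The recursion constructs, for each coefficient of the solution, an expansion that obeys the bound,
  so the predicate asserts the existence of such an expansion.\<close>

definition coef_bounded :: "real \<Rightarrow> ('n::finite multi_index \<Rightarrow> real) \<Rightarrow> ('n cvec \<Rightarrow> complex) \<Rightarrow> bool" where
  "coef_bounded \<delta> w f \<longleftrightarrow> (\<exists>c. expands \<delta> f c \<and> (\<forall>\<alpha>. cmod (c \<alpha>) \<le> w \<alpha>))"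

lemma coef_bounded_mono:
  "coef_bounded \<delta> w f \<Longrightarrow> (\<And>\<alpha>. w \<alpha> \<le> w' \<alpha>) \<Longrightarrow> coef_bounded \<delta> w' f"
  unfolding coef_bounded_def by (meson order_trans)

lemma coef_bounded_cong:
  "coef_bounded \<delta> w f \<Longrightarrow> (\<And>x. x \<in> cube \<delta> \<Longrightarrow> f x = g x) \<Longrightarrow> coef_bounded \<delta> w g"
  unfolding coef_bounded_def using expands_cong by blast

lemma coef_bounded_subset: "coef_bounded \<delta> w f \<Longrightarrow> \<delta>' \<le> \<delta> \<Longrightarrow> coef_bounded \<delta>' w f"
  unfolding coef_bounded_def using expands_subset by blast

lemma coef_bounded_0: "(\<And>\<alpha>. 0 \<le> w \<alpha>) \<Longrightarrow> coef_bounded \<delta> w (\<lambda>x. 0)"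
  unfolding coef_bounded_def using expands_0 by (intro exI[of _ "\<lambda>\<alpha>. 0"]) auto

lemma coef_bounded_add:
  "coef_bounded \<delta> w f \<Longrightarrow> coef_bounded \<delta> w' g \<Longrightarrow> coef_bounded \<delta> (\<lambda>\<alpha>. w \<alpha> + w' \<alpha>) (\<lambda>x. f x + g x)"
  unfolding coef_bounded_def
proof (elim exE conjE)
  fix c c' assume "expands \<delta> f c" "\<forall>\<alpha>. cmod (c \<alpha>) \<le> w \<alpha>" "expands \<delta> g c'" "\<forall>\<alpha>. cmod (c' \<alpha>) \<le> w' \<alpha>"
  then show "\<exists>c. expands \<delta> (\<lambda>x. f x + g x) c \<and> (\<forall>\<alpha>. cmod (c \<alpha>) \<le> w \<alpha> + w' \<alpha>)"
    using expands_add[of \<delta> f c g c']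
    by (intro exI[of _ "\<lambda>\<alpha>. c \<alpha> + c' \<alpha>"]) (auto intro: norm_triangle_le add_mono)
qed

lemma coef_bounded_cmult:
  "coef_bounded \<delta> w f \<Longrightarrow> coef_bounded \<delta> (\<lambda>\<alpha>. cmod k * w \<alpha>) (\<lambda>x. k * f x)"
  unfolding coef_bounded_def
proof (elim exE conjE)
  fix c assume "expands \<delta> f c" "\<forall>\<alpha>. cmod (c \<alpha>) \<le> w \<alpha>"
  then show "\<exists>c. expands \<delta> (\<lambda>x. k * f x) c \<and> (\<forall>\<alpha>. cmod (c \<alpha>) \<le> cmod k * w \<alpha>)"
    using expands_cmult[of \<delta> f c k]
    by (intro exI[of _ "\<lambda>\<alpha>. k * c \<alpha>"]) (auto simp: norm_mult mult_left_mono)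
qed

lemma coef_bounded_sum:
  assumes "\<And>i. i \<in> I \<Longrightarrow> coef_bounded \<delta> (w i) (f i)"
  shows "coef_bounded \<delta> (\<lambda>\<alpha>. \<Sum>i\<in>I. w i \<alpha>) (\<lambda>x. \<Sum>i\<in>I. f i x)"
  using assms
  by (induction I rule: infinite_finite_induct) (auto intro!: coef_bounded_0 coef_bounded_add)

lemma coef_bounded_mult:
  assumes "coef_bounded \<delta> w f" "coef_bounded \<delta> w' g"
  shows "coef_bounded \<delta> (\<lambda>\<alpha>. \<Sum>(\<beta>, \<gamma>)\<in>multi_splits \<alpha>. w \<beta> * w' \<gamma>) (\<lambda>x. f x * g x)"
proof -
  obtain c c' where c: "expands \<delta> f c" "\<And>\<alpha>. cmod (c \<alpha>) \<le> w \<alpha>" "expands \<delta> g c'" "\<And>\<alpha>. cmod (c' \<alpha>) \<le> w' \<alpha>"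
    using assms by (auto simp: coef_bounded_def)
  show ?thesis
    unfolding coef_bounded_def
  proof (intro exI conjI allI)
    show "expands \<delta> (\<lambda>x. f x * g x) (\<lambda>\<alpha>. \<Sum>(\<beta>, \<gamma>)\<in>multi_splits \<alpha>. c \<beta> * c' \<gamma>)"
      by (rule expands_mult[OF c(1,3)])
    fix \<alpha>
    show "cmod (\<Sum>(\<beta>, \<gamma>)\<in>multi_splits \<alpha>. c \<beta> * c' \<gamma>) \<le> (\<Sum>(\<beta>, \<gamma>)\<in>multi_splits \<alpha>. w \<beta> * w' \<gamma>)"
    proof (rule sum_norm_le, clarify)
      fix \<beta> \<gamma>
      have "0 \<le> w \<beta>" using c(2)[of \<beta>] norm_ge_zero order_trans by blast
      then show "cmod (c \<beta> * c' \<gamma>) \<le> w \<beta> * w' \<gamma>"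
        unfolding norm_mult by (intro mult_mono c) auto
    qed
  qed
qed

text \<open>The cut-off \<open>J\<close> is what the induction on the coefficients needs: only the first ones are known to
  be bounded at any stage.\<close>

definition majorized ::
    "real \<Rightarrow> nat \<Rightarrow> (nat \<Rightarrow> 'n::finite multi_index \<Rightarrow> real) \<Rightarrow> ('n cvec \<Rightarrow> complex fps) \<Rightarrow> bool" where
  "majorized \<delta> J w h \<longleftrightarrow> (\<forall>j\<le>J. coef_bounded \<delta> (w j) (\<lambda>x. fps_nth (h x) j))"

lemma majorized_mono:
  "majorized \<delta> J w h \<Longrightarrow> J' \<le> J \<Longrightarrow> (\<And>j \<alpha>. w j \<alpha> \<le> w' j \<alpha>) \<Longrightarrow> majorized \<delta> J' w' h"
  unfolding majorized_def by (meson coef_bounded_mono order_trans)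

lemma mult_mono3:
  fixes p x y z :: real
  assumes "0 \<le> p" "x \<le> x'" "y \<le> y'" "z \<le> z'" "0 \<le> x" "0 \<le> y" "0 \<le> z"
  shows "p * x * y * z \<le> p * x' * y' * z'"
  using assms by (intro mult_mono mult_nonneg_nonneg) auto

context gevrey_weight
begin

text \<open>The exponent \<open>e\<close> records the accumulated order of differentiation. The operations below change
  only \<open>M\<close> and \<open>e\<close>, with constants that may depend on \<open>R\<close> but not on \<open>K\<close>: in the end \<open>K\<close> is
  chosen after all of them.\<close>

definition W :: "real \<Rightarrow> real \<Rightarrow> real \<Rightarrow> real \<Rightarrow> nat \<Rightarrow> 'n::finite multi_index \<Rightarrow> real" where
  "W M K R e j \<alpha> =
     M * K ^ j * R ^ degree_of \<alpha> * F j (degree_of \<alpha>) * real (j + degree_of \<alpha> + 1) powr e * decay j \<alpha>"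

lemma W_mono: "M \<le> M' \<Longrightarrow> 0 \<le> K \<Longrightarrow> 0 \<le> R \<Longrightarrow> W M K R e j \<alpha> \<le> W M' K R e j \<alpha>"
  unfolding W_def using F_pos[of j "degree_of \<alpha>"] decay_pos[of j \<alpha>]
  by (intro mult_right_mono) auto

lemma W_nonneg: "0 \<le> M \<Longrightarrow> 0 \<le> K \<Longrightarrow> 0 \<le> R \<Longrightarrow> 0 \<le> W M K R e j \<alpha>"
  unfolding W_def using F_pos[of j "degree_of \<alpha>"] decay_pos[of j \<alpha>] by simp

lemma W_scale: "W (c * M) K R e j \<alpha> = c * W M K R e j \<alpha>"
  by (simp add: W_def)

lemma W_convolution:
  fixes \<alpha> :: "'n::finite multi_index"
  assumes "0 \<le> M1" "0 \<le> M2" "0 \<le> K" "0 \<le> R" "0 \<le> e1" "0 \<le> e2"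
  shows "(\<Sum>i\<le>j. \<Sum>(\<beta>, \<gamma>)\<in>multi_splits \<alpha>. W M1 K R e1 i \<beta> * W M2 K R e2 (j - i) \<gamma>)
    \<le> W (8 ^ (CARD('n) + 1) * M1 * M2) K R (e1 + e2) j \<alpha>"
proof -
  let ?n = "degree_of \<alpha>"
  let ?X = "M1 * M2 * K ^ j * R ^ ?n * F j ?n * real (j + ?n + 1) powr (e1 + e2)"
  have X0: "0 \<le> ?X" using assms F_pos[of j ?n] by simp
  have le: "W M1 K R e1 i \<beta> * W M2 K R e2 (j - i) \<gamma> \<le> ?X * (decay i \<beta> * decay (j - i) \<gamma>)"
    if "i \<le> j" "(\<beta>, \<gamma>) \<in> multi_splits \<alpha>" for i \<beta> \<gamma>
  proof -
    let ?b = "degree_of \<beta>" let ?c = "degree_of \<gamma>"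
    have n: "?n = ?b + ?c" using that by (auto simp: multi_splits_def degree_of_add)
    have F: "F i ?b * F (j - i) ?c \<le> F j ?n" using F_mult[of i ?b "j - i" ?c] that by (simp add: n)
    have P: "real (i + ?b + 1) powr e1 * real (j - i + ?c + 1) powr e2 \<le> real (j + ?n + 1) powr (e1 + e2)"
      unfolding powr_add using that assms by (intro mult_mono powr_mono2) (auto simp: n)
    have "W M1 K R e1 i \<beta> * W M2 K R e2 (j - i) \<gamma> =
       M1 * M2 * (K ^ i * K ^ (j - i)) * (R ^ ?b * R ^ ?c) * (F i ?b * F (j - i) ?c) *
       (real (i + ?b + 1) powr e1 * real (j - i + ?c + 1) powr e2) * (decay i \<beta> * decay (j - i) \<gamma>)"
      by (simp only: W_def mult_ac)
    also have "K ^ i * K ^ (j - i) = K ^ j" using that by (simp flip: power_add)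
    also have "R ^ ?b * R ^ ?c = R ^ ?n" by (simp add: n power_add)
    also have "M1 * M2 * K ^ j * R ^ ?n * (F i ?b * F (j - i) ?c) *
       (real (i + ?b + 1) powr e1 * real (j - i + ?c + 1) powr e2) * (decay i \<beta> * decay (j - i) \<gamma>)
       \<le> ?X * (decay i \<beta> * decay (j - i) \<gamma>)"
      using assms F_pos[of j ?n] F_pos[of i ?b] F_pos[of "j - i" ?c] decay_pos[of i \<beta>] decay_pos[of "j - i" \<gamma>]
      by (intro mult_right_mono mult_mono mult_nonneg_nonneg F P order_refl) (auto simp: less_imp_le)
    finally show ?thesis .
  qed
  have "(\<Sum>i\<le>j. \<Sum>(\<beta>, \<gamma>)\<in>multi_splits \<alpha>. W M1 K R e1 i \<beta> * W M2 K R e2 (j - i) \<gamma>)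
     \<le> (\<Sum>i\<le>j. \<Sum>(\<beta>, \<gamma>)\<in>multi_splits \<alpha>. ?X * (decay i \<beta> * decay (j - i) \<gamma>))"
  proof (intro sum_mono)
    fix i p assume "i \<in> {..j}" "p \<in> multi_splits \<alpha>"
    then show "(case p of (\<beta>, \<gamma>) \<Rightarrow> W M1 K R e1 i \<beta> * W M2 K R e2 (j - i) \<gamma>) \<le>
        (case p of (\<beta>, \<gamma>) \<Rightarrow> ?X * (decay i \<beta> * decay (j - i) \<gamma>))"
      using le[of i "fst p" "snd p"] by (cases p) simp
  qed
  also have "\<dots> = ?X * (\<Sum>i\<le>j. \<Sum>(\<beta>, \<gamma>)\<in>multi_splits \<alpha>. decay i \<beta> * decay (j - i) \<gamma>)"
    by (simp add: sum_distrib_left case_prod_unfold)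
  also have "\<dots> \<le> ?X * (8 ^ (CARD('n) + 1) * decay j \<alpha>)"
    by (intro mult_left_mono decay_convolution X0)
  also have "\<dots> = W (8 ^ (CARD('n) + 1) * M1 * M2) K R (e1 + e2) j \<alpha>" by (simp add: W_def)
  finally show ?thesis .
qed

lemma majorized_mult:
  fixes h1 h2 :: "'n::finite cvec \<Rightarrow> complex fps"
  assumes "majorized \<delta> J (W M1 K R e1) h1" "majorized \<delta> J (W M2 K R e2) h2"
    and "0 \<le> M1" "0 \<le> M2" "0 \<le> K" "0 \<le> R" "0 \<le> e1" "0 \<le> e2"
  shows "majorized \<delta> J (W (8 ^ (CARD('n) + 1) * M1 * M2) K R (e1 + e2)) (\<lambda>x. h1 x * h2 x)"
  unfolding majorized_def
proof (intro allI impI)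
  fix j assume j: "j \<le> J"
  have "coef_bounded \<delta> (\<lambda>\<alpha>. \<Sum>i\<le>j. \<Sum>(\<beta>, \<gamma>)\<in>multi_splits \<alpha>. W M1 K R e1 i \<beta> * W M2 K R e2 (j - i) \<gamma>)
          (\<lambda>x. \<Sum>i\<le>j. fps_nth (h1 x) i * fps_nth (h2 x) (j - i))"
    using assms(1,2) j by (intro coef_bounded_sum coef_bounded_mult) (auto simp: majorized_def)
  then have "coef_bounded \<delta> (W (8 ^ (CARD('n) + 1) * M1 * M2) K R (e1 + e2) j)
          (\<lambda>x. \<Sum>i\<le>j. fps_nth (h1 x) i * fps_nth (h2 x) (j - i))"
    by (rule coef_bounded_mono) (intro W_convolution assms)
  then show "coef_bounded \<delta> (W (8 ^ (CARD('n) + 1) * M1 * M2) K R (e1 + e2) j) (\<lambda>x. fps_nth (h1 x * h2 x) j)"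
    by (simp add: fps_mult_nth atLeast0AtMost)
qed

lemma expands_const: "expands \<delta> (\<lambda>x. k) (\<lambda>\<alpha>. if \<alpha> = 0 then k else 0)"
  unfolding expands_def
proof
  fix x :: "'n::finite cvec"
  have "((\<lambda>\<alpha>. (if \<alpha> = 0 then k else 0) * mpow x \<alpha>) has_sum k) {0}"
    by (rule has_sum_finiteI) (auto simp: mpow_def)
  then show "((\<lambda>\<alpha>. (if \<alpha> = 0 then k else 0) * mpow x \<alpha>) has_sum k) UNIV"
    by (rule has_sum_cong_neutral[THEN iffD1, rotated -1]) auto
qed

lemma majorized_one:
  assumes "0 \<le> K" "0 \<le> R"
  shows "majorized \<delta> J (W 1 K R 0) (\<lambda>x :: 'n::finite cvec. 1)"
  unfolding majorized_def
proof (intro allI impI)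
  fix j
  show "coef_bounded \<delta> (W 1 K R 0 j) (\<lambda>x :: 'n cvec. fps_nth 1 j)"
  proof (cases "j = 0")
    case True
    have "W 1 K R 0 0 (0 :: 'n multi_index) = 1" by (simp add: W_def degree_of_def F_0_0 decay_def)
    then show ?thesis
      using True W_nonneg[of 1 K R 0 0] assms unfolding coef_bounded_def
      by (intro exI[of _ "\<lambda>\<alpha>. if \<alpha> = 0 then 1 else 0"]) (auto intro: expands_const)
  qed (use assms in \<open>auto intro!: coef_bounded_0 W_nonneg\<close>)
qed

lemma majorized_power:
  fixes h :: "'n::finite cvec \<Rightarrow> complex fps"
  assumes "majorized \<delta> J (W M K R e) h" "0 \<le> M" "0 \<le> K" "0 \<le> R" "0 \<le> e"
  shows "majorized \<delta> J (W ((8 ^ (CARD('n) + 1) * M) ^ r) K R (real r * e)) (\<lambda>x. h x ^ r)"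
proof (induction r)
  case 0
  then show ?case using majorized_one assms by simp
next
  case (Suc r)
  have "majorized \<delta> J (W (8 ^ (CARD('n) + 1) * M * (8 ^ (CARD('n) + 1) * M) ^ r) K R (e + real r * e)) (\<lambda>x. h x * h x ^ r)"
    by (rule majorized_mult[OF assms(1) Suc]) (use assms in auto)
  then show ?case by (simp add: algebra_simps)
qed

text \<open>The powers of \<open>K\<close> that come from derivatives in \<open>t\<close> are kept apart from the constant, because they
  have to be compared with the power of \<open>K\<close> that the recursion gains.\<close>

lemma majorized_prod_list:
  fixes h :: "nat \<Rightarrow> 'q \<Rightarrow> 'n::finite cvec \<Rightarrow> complex fps"
  assumes "\<And>i q r. (i, q, r) \<in> set w \<Longrightarrow> majorized \<delta> J (W (B * K ^ i) K R (e i q)) (h i q)"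
    and "\<And>i q r. (i, q, r) \<in> set w \<Longrightarrow> 0 \<le> e i q"
    and "0 \<le> B" "0 \<le> K" "0 \<le> R"
  shows "majorized \<delta> J (W ((\<Prod>(i, q, r)\<leftarrow>w. 8 ^ (CARD('n) + 1) * (8 ^ (CARD('n) + 1) * B) ^ r) * K ^ (\<Sum>(i, q, r)\<leftarrow>w. r * i))
             K R (\<Sum>(i, q, r)\<leftarrow>w. real r * e i q)) (\<lambda>x. \<Prod>(i, q, r)\<leftarrow>w. h i q x ^ r)"
  using assms(1,2)
proof (induction w)
  case Nil
  then show ?case using majorized_one assms by simp
next
  case (Cons p w)
  obtain i q r where p: "p = (i, q, r)" by (cases p)
  let ?c = "8 ^ (CARD('n) + 1) :: real"
  let ?P = "(\<Prod>(i, q, r)\<leftarrow>w. ?c * (?c * B) ^ r)"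
  have P0: "0 \<le> ?P" by (induction w) (use assms in auto)
  have e0: "0 \<le> (\<Sum>(i, q, r)\<leftarrow>w. real r * e i q)"
  proof (rule sum_list_nonneg)
    fix y assume "y \<in> set (map (\<lambda>(i, q, r). real r * e i q) w)"
    then obtain i q r where "(i, q, r) \<in> set w" "y = real r * e i q" by auto
    then show "0 \<le> y" using Cons.prems(2)[of i q r] by simp
  qed
  have eiq: "0 \<le> e i q" using Cons.prems(2)[of i q r] p by simp
  have mj: "majorized \<delta> J (W (B * K ^ i) K R (e i q)) (h i q)" using Cons.prems(1)[of i q r] p by simp
  have "majorized \<delta> J (W ((?c * (B * K ^ i)) ^ r) K R (real r * e i q)) (\<lambda>x. h i q x ^ r)"
    by (rule majorized_power[OF mj]) (use eiq assms in auto)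
  moreover have "majorized \<delta> J (W (?P * K ^ (\<Sum>(i, q, r)\<leftarrow>w. r * i)) K R (\<Sum>(i, q, r)\<leftarrow>w. real r * e i q))
           (\<lambda>x. \<Prod>(i, q, r)\<leftarrow>w. h i q x ^ r)"
    by (rule Cons.IH) (meson Cons.prems list.set_intros(2))+
  ultimately have "majorized \<delta> J (W (?c * (?c * (B * K ^ i)) ^ r * (?P * K ^ (\<Sum>(i, q, r)\<leftarrow>w. r * i))) K R
      (real r * e i q + (\<Sum>(i, q, r)\<leftarrow>w. real r * e i q))) (\<lambda>x. h i q x ^ r * (\<Prod>(i, q, r)\<leftarrow>w. h i q x ^ r))"
    by (rule majorized_mult) (use assms eiq P0 e0 in auto)
  moreover have "?c * (?c * (B * K ^ i)) ^ r * (?P * K ^ (\<Sum>(i, q, r)\<leftarrow>w. r * i)) =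
      (?c * (?c * B) ^ r * ?P) * K ^ (r * i + (\<Sum>(i, q, r)\<leftarrow>w. r * i))"
    by (simp only: power_mult_distrib power_add power_mult mult_ac)
  ultimately show ?case by (simp only: p list.map prod_list.Cons sum_list.Cons prod.case)
qed

lemma coef_bounded_moment_deriv_var:
  fixes f :: "'n::finite cvec \<Rightarrow> complex"
  assumes m: "\<And>j. cmod (m (of_nat (j + 1)) / m (of_nat j)) \<le> A * real (j + 1) powr s"
    and s: "s \<ge> 1" and A: "A > 0" and R: "R > 0" and e: "e \<ge> 0" and M: "M \<ge> 0" and K: "K \<ge> 0"
    and f: "coef_bounded \<delta> (W M K R e j) f"
  shows "coef_bounded \<delta> (W (A * R * real L powr \<beta> * 2 powr e * M) K R (e + s) j) (moment_deriv_var m d f)"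
proof -
  obtain c where c: "expands \<delta> f c" "\<And>\<alpha>. cmod (c \<alpha>) \<le> W M K R e j \<alpha>"
    using f by (auto simp: coef_bounded_def)
  show ?thesis
    unfolding coef_bounded_def
  proof (intro exI conjI allI)
    show "expands \<delta> (moment_deriv_var m d f)
       (\<lambda>\<alpha>. m (of_nat (\<alpha> $ d + 1)) / m (of_nat (\<alpha> $ d)) * c (\<alpha> + axis d 1))"
      by (rule expands_moment_deriv_var[OF c(1) m])
    fix \<alpha> :: "'n multi_index"
    let ?n = "degree_of \<alpha>"
    let ?x = "real (j + ?n + 1)"
    have deg: "degree_of (\<alpha> + axis d 1) = ?n + 1" by (simp add: degree_of_add)
    have "cmod (m (of_nat (\<alpha> $ d + 1)) / m (of_nat (\<alpha> $ d)) * c (\<alpha> + axis d 1)) \<le>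
          (A * real (?n + 1) powr s) * W M K R e j (\<alpha> + axis d 1)"
      unfolding norm_mult
    proof (intro mult_mono c)
      have "A * real (\<alpha> $ d + 1) powr s \<le> A * real (?n + 1) powr s"
        using A s le_degree_of[of \<alpha> d] by (intro mult_left_mono powr_mono2) auto
      then show "cmod (m (of_nat (\<alpha> $ d + 1)) / m (of_nat (\<alpha> $ d))) \<le> A * real (?n + 1) powr s"
        using m[of "\<alpha> $ d"] by linarith
    qed (use A in auto)
    also have "\<dots> = A * R * M * K ^ j * R ^ ?n * (real (?n + 1) powr s * F j (Suc ?n)) *
                    real (j + ?n + 2) powr e * decay j (\<alpha> + axis d 1)"
      unfolding W_def deg by (simp add: mult_ac)
    also have "\<dots> \<le> A * R * M * K ^ j * R ^ ?n * (F j ?n * (real L powr \<beta> * ?x powr s)) *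
                    (2 powr e * ?x powr e) * decay j \<alpha>"
    proof (rule mult_mono3[OF _ F_Suc_n_upper[OF s] _ decay_axis])
      have "real (j + ?n + 2) powr e \<le> (2 * ?x) powr e" using e by (intro powr_mono2) auto
      also have "\<dots> = 2 powr e * ?x powr e" by (rule powr_mult)
      finally show "real (j + ?n + 2) powr e \<le> 2 powr e * ?x powr e" .
    qed (use A R M K F_pos[of j ?n] F_pos[of j "Suc ?n"] decay_pos[of j \<alpha>] decay_pos[of j "\<alpha> + axis d 1"] in \<open>auto simp: less_imp_le\<close>)
    also have "\<dots> = W (A * R * real L powr \<beta> * 2 powr e * M) K R (e + s) j \<alpha>"
      by (simp add: W_def powr_add mult_ac)
    finally show "cmod (m (of_nat (\<alpha> $ d + 1)) / m (of_nat (\<alpha> $ d)) * c (\<alpha> + axis d 1)) \<le>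
        W (A * R * real L powr \<beta> * 2 powr e * M) K R (e + s) j \<alpha>" .
  qed
qed

text \<open>An operator in \<open>x\<close> that raises the exponent from \<open>e\<close> to \<open>e'\<close>, uniformly in \<open>M\<close>, \<open>K\<close> and \<open>j\<close>.\<close>

definition coef_controlled ::
    "real \<Rightarrow> real \<Rightarrow> real \<Rightarrow> real \<Rightarrow> real \<Rightarrow> (('n::finite cvec \<Rightarrow> complex) \<Rightarrow> 'n cvec \<Rightarrow> complex) \<Rightarrow> bool" where
  "coef_controlled \<delta> R e e' C T \<longleftrightarrow> 0 < C \<and> (\<forall>M\<ge>0. \<forall>K\<ge>0. \<forall>j f.
     coef_bounded \<delta> (W M K R e j) f \<longrightarrow> coef_bounded \<delta> (W (C * M) K R e' j) (T f))"

lemma coef_controlled_comp: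
  fixes T T' :: "('n::finite cvec \<Rightarrow> complex) \<Rightarrow> 'n cvec \<Rightarrow> complex"
  assumes T: "coef_controlled \<delta> R e e' C T" and T': "coef_controlled \<delta> R e' e'' C' T'"
  shows "coef_controlled \<delta> R e e'' (C' * C) (\<lambda>f. T' (T f))"
  unfolding coef_controlled_def
proof (intro conjI allI impI)
  note T = T[unfolded coef_controlled_def] and T' = T'[unfolded coef_controlled_def]
  show "0 < C' * C" using T T' by simp
  fix M K :: real and j and f :: "'n cvec \<Rightarrow> complex" assume a: "M \<ge> 0" "K \<ge> 0" "coef_bounded \<delta> (W M K R e j) f"
  have "C * M \<ge> 0" using T a by simp
  from conjunct2[OF T', rule_format, OF this a(2) conjunct2[OF T, rule_format, OF a]]
  show "coef_bounded \<delta> (W (C' * C * M) K R e'' j) (T' (T f))" by (simp add: mult.assoc)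
qed

lemma coef_controlled_moment_deriv_var_power:
  assumes m: "\<And>j. cmod (m (of_nat (j + 1)) / m (of_nat j)) \<le> A * real (j + 1) powr s"
    and s: "s \<ge> 1" and A: "A > 0" and R: "R > 0" and e: "e \<ge> 0"
  shows "\<exists>C. coef_controlled \<delta> R e (e + real k * s) C (moment_deriv_var m d ^^ k)"
proof (induction k)
  case 0
  show ?case by (intro exI[of _ 1]) (simp add: coef_controlled_def)
next
  case (Suc k)
  then obtain C where C: "coef_controlled \<delta> R e (e + real k * s) C (moment_deriv_var m d ^^ k)" ..
  have e': "e + real k * s \<ge> 0" using e s by simp
  have "coef_controlled \<delta> R (e + real k * s) (e + real k * s + s)
      (A * R * real L powr \<beta> * 2 powr (e + real k * s)) (moment_deriv_var m d)"
    unfolding coef_controlled_def using coef_bounded_moment_deriv_var[OF m s A R e'] A R L by auto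
  from coef_controlled_comp[OF C this] show ?case by (auto simp: algebra_simps)
qed

lemma coef_controlled_moment_deriv_list:
  fixes q :: "'n::finite multi_index"
  assumes m: "\<And>d j. cmod (m d (of_nat (j + 1)) / m d (of_nat j)) \<le> A d * real (j + 1) powr s d"
    and s: "\<And>d. s d \<ge> 1" and A: "\<And>d. A d > 0" and R: "R > 0"
  shows "\<exists>C. coef_controlled \<delta> R 0 (\<Sum>d\<leftarrow>ds. s d * real (q $ d)) C
             (foldr (\<lambda>d. moment_deriv_var (m d) d ^^ (q $ d)) ds)"
proof (induction ds)
  case Nil
  show ?case by (intro exI[of _ 1]) (simp add: coef_controlled_def)
next
  case (Cons d ds)
  then obtain C where C: "coef_controlled \<delta> R 0 (\<Sum>d\<leftarrow>ds. s d * real (q $ d)) C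
             (foldr (\<lambda>d. moment_deriv_var (m d) d ^^ (q $ d)) ds)" ..
  let ?e = "\<Sum>d\<leftarrow>ds. s d * real (q $ d)"
  have "0 \<le> s d" for d using s[of d] by simp
  then have e: "?e \<ge> 0" by (intro sum_list_nonneg) auto
  obtain C' where "coef_controlled \<delta> R ?e (?e + real (q $ d) * s d) C' (moment_deriv_var (m d) d ^^ (q $ d))"
    using coef_controlled_moment_deriv_var_power[where m = "m d" and A = "A d" and s = "s d", OF m s A R e] by blast
  from coef_controlled_comp[OF C this] show ?case by (auto simp: o_def algebra_simps)
qed

lemma majorized_moment_deriv:
  assumes m: "\<And>j. cmod (m (of_nat (j + 1)) / m (of_nat j)) \<le> A * real (j + 1) powr s0"
    and A: "A > 0" and R: "R \<ge> 0" and e: "e \<ge> 0" and M: "M \<ge> 0" and K: "K \<ge> 0"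
    and h: "majorized \<delta> (Suc J) (W M K R e) h"
  shows "majorized \<delta> J (W (A * real L powr (s0 + \<sigma>) * 2 powr e * M * K) K R (e + (s0 + \<sigma>))) (\<lambda>x. moment_deriv m (h x))"
  unfolding majorized_def
proof (intro allI impI)
  fix j assume j: "j \<le> J"
  let ?r = "m (of_nat (j + 1)) / m (of_nat j)"
  have "coef_bounded \<delta> (W M K R e (Suc j)) (\<lambda>x. fps_nth (h x) (Suc j))"
    using h j by (auto simp: majorized_def)
  from coef_bounded_cmult[OF this, of ?r]
  have "coef_bounded \<delta> (\<lambda>\<alpha>. cmod ?r * W M K R e (Suc j) \<alpha>) (\<lambda>x. fps_nth (moment_deriv m (h x)) j)"
    by (simp add: moment_deriv_def)
  then show "coef_bounded \<delta> (W (A * real L powr (s0 + \<sigma>) * 2 powr e * M * K) K R (e + (s0 + \<sigma>)) j)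
       (\<lambda>x. fps_nth (moment_deriv m (h x)) j)"
  proof (rule coef_bounded_mono)
    fix \<alpha>
    let ?n = "degree_of \<alpha>"
    let ?x = "real (j + ?n + 1)"
    have "cmod ?r * W M K R e (Suc j) \<alpha> \<le> (A * real (j + 1) powr s0) * W M K R e (Suc j) \<alpha>"
      by (intro mult_right_mono m W_nonneg M K R)
    also have "\<dots> = A * M * K ^ Suc j * R ^ ?n * (F (Suc j) ?n * real (j + 1) powr s0) *
                    real (j + ?n + 2) powr e * decay (Suc j) \<alpha>"
      by (simp add: W_def mult_ac)
    also have "\<dots> \<le> A * M * K ^ Suc j * R ^ ?n * (F j ?n * (real L powr (s0 + \<sigma>) * ?x powr (s0 + \<sigma>))) *
                    (2 powr e * ?x powr e) * decay j \<alpha>"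
    proof (rule mult_mono3[OF _ F_Suc_j_upper _ decay_Suc])
      have "real (j + ?n + 2) powr e \<le> (2 * ?x) powr e" using e by (intro powr_mono2) auto
      also have "\<dots> = 2 powr e * ?x powr e" by (rule powr_mult)
      finally show "real (j + ?n + 2) powr e \<le> 2 powr e * ?x powr e" .
    qed (use A R M K F_pos[of j ?n] F_pos[of "Suc j" ?n] decay_pos[of j \<alpha>] decay_pos[of "Suc j" \<alpha>] in \<open>auto simp: less_imp_le\<close>)
    also have "\<dots> = W (A * real L powr (s0 + \<sigma>) * 2 powr e * M * K) K R (e + (s0 + \<sigma>)) j \<alpha>"
      by (simp add: W_def powr_add mult_ac)
    finally show "cmod ?r * W M K R e (Suc j) \<alpha> \<le> W (A * real L powr (s0 + \<sigma>) * 2 powr e * M * K) K R (e + (s0 + \<sigma>)) j \<alpha>" .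
  qed
qed

text \<open>The analogue for operators on series that consume \<open>k\<close> further coefficients, each at the price
  of a factor \<open>K\<close>.\<close>

definition controlled ::
    "real \<Rightarrow> real \<Rightarrow> nat \<Rightarrow> real \<Rightarrow> real \<Rightarrow> real \<Rightarrow> (('n::finite cvec \<Rightarrow> complex fps) \<Rightarrow> 'n cvec \<Rightarrow> complex fps) \<Rightarrow> bool" where
  "controlled \<delta> R k e e' C T \<longleftrightarrow> 0 < C \<and> (\<forall>M\<ge>0. \<forall>K\<ge>0. \<forall>J h.
     majorized \<delta> (J + k) (W M K R e) h \<longrightarrow> majorized \<delta> J (W (C * M * K ^ k) K R e') (T h))"

lemma controlledD:
  fixes T :: "('n::finite cvec \<Rightarrow> complex fps) \<Rightarrow> 'n cvec \<Rightarrow> complex fps"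
  assumes "controlled \<delta> R k e e' C T" "M \<ge> 0" "K \<ge> 0" "majorized \<delta> (J + k) (W M K R e) h"
  shows "majorized \<delta> J (W (C * M * K ^ k) K R e') (T h)"
  by (rule conjunct2[OF assms(1)[unfolded controlled_def], rule_format, OF assms(2-4)])

lemma controlled_comp:
  fixes T T' :: "('n::finite cvec \<Rightarrow> complex fps) \<Rightarrow> 'n cvec \<Rightarrow> complex fps"
  assumes T: "controlled \<delta> R k e e' C T" and T': "controlled \<delta> R k' e' e'' C' T'"
  shows "controlled \<delta> R (k + k') e e'' (C' * C) (\<lambda>h. T' (T h))"
  unfolding controlled_def
proof (intro conjI allI impI)
  have C: "0 < C" "0 < C'" using T T' by (auto simp: controlled_def)
  then show "0 < C' * C" by simp
  fix M K :: real and J and h :: "'n cvec \<Rightarrow> complex fps" assume a: "M \<ge> 0" "K \<ge> 0" "majorized \<delta> (J + (k + k')) (W M K R e) h"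
  have "C * M * K ^ k \<ge> 0" using C a by simp
  moreover have "majorized \<delta> (J + k') (W (C * M * K ^ k) K R e') (T h)"
    by (rule controlledD[OF T a(1,2)]) (use a(3) in \<open>simp add: add_ac\<close>)
  ultimately have "majorized \<delta> J (W (C' * (C * M * K ^ k) * K ^ k') K R e'') (T' (T h))"
    by (rule controlledD[OF T' _ a(2)])
  then show "majorized \<delta> J (W (C' * C * M * K ^ (k + k')) K R e'') (T' (T h))"
    by (simp add: power_add mult_ac)
qed

lemma controlled_moment_deriv_power:
  assumes m: "\<And>j. cmod (m (of_nat (j + 1)) / m (of_nat j)) \<le> A * real (j + 1) powr s0"
    and A: "A > 0" and R: "R \<ge> 0" and e: "e \<ge> 0"
  shows "\<exists>C. controlled \<delta> R i e (e + real i * (s0 + \<sigma>)) C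
           (\<lambda>(h :: 'n::finite cvec \<Rightarrow> complex fps) x. (moment_deriv m ^^ i) (h x))"
proof (induction i)
  case 0
  show ?case by (intro exI[of _ 1]) (simp add: controlled_def)
next
  case (Suc i)
  let ?e = "e + real i * (s0 + \<sigma>)"
  obtain C where C: "controlled \<delta> R i e ?e C (\<lambda>(h :: 'n cvec \<Rightarrow> complex fps) x. (moment_deriv m ^^ i) (h x))" using Suc ..
  have e': "?e \<ge> 0" using e s0 \<sigma> by simp
  have "controlled \<delta> R 1 ?e (?e + (s0 + \<sigma>)) (A * real L powr (s0 + \<sigma>) * 2 powr ?e) (\<lambda>h x. moment_deriv m (h x))"
    unfolding controlled_def using majorized_moment_deriv[OF m A R e'] A L by auto
  from controlled_comp[OF C this] show ?case by (auto simp: algebra_simps)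
qed

lemma geometric_le_W:
  assumes "0 \<le> k" "0 \<le> \<rho>" "4 * k \<le> K" "4 * \<rho> \<le> R" "0 \<le> M"
  shows "M * k ^ j * \<rho> ^ degree_of \<alpha> * fact j powr \<sigma> \<le> W M K R 0 j \<alpha>"
proof -
  let ?n = "degree_of \<alpha>"
  have "M * k ^ j * \<rho> ^ ?n * fact j powr \<sigma> * 1 \<le>
        M * k ^ j * \<rho> ^ ?n * F j ?n * (decay j \<alpha> * 4 ^ j * 4 ^ ?n)"
    using assms F_lower[of j ?n] F_pos[of j ?n] decay_lower[of j \<alpha>]
    by (intro mult_mono mult_left_mono) auto
  also have "\<dots> = M * (4 * k) ^ j * (4 * \<rho>) ^ ?n * F j ?n * decay j \<alpha>"
    by (simp add: power_mult_distrib)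
  also have "\<dots> \<le> M * K ^ j * R ^ ?n * F j ?n * decay j \<alpha>"
    using assms F_pos[of j ?n] decay_pos[of j \<alpha>]
    by (intro mult_right_mono mult_mono mult_left_mono power_mono) auto
  also have "\<dots> = W M K R 0 j \<alpha>" by (simp add: W_def)
  finally show ?thesis by simp
qed

lemma W_le_geometric:
  assumes "0 \<le> M" "1 \<le> K" "1 \<le> R" "0 \<le> e"
  obtains M' K' R' where "0 \<le> M'" "1 \<le> K'" "1 \<le> R'"
    "\<And>j \<alpha>. W M K R e j \<alpha> \<le> M' * K' ^ j * R' ^ degree_of \<alpha> * fact j powr \<sigma>"
proof -
  obtain C where C: "C \<ge> 1" "\<And>j n. F j n \<le> C ^ (j + n) * fact j powr \<sigma>"
    using F_upper by blast
  obtain G where G: "\<And>n. real (n + 1) powr e * (1/2) ^ n \<le> G" "G \<ge> 0"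
    using power_times_geometric_bounded[of "1/2" e] by auto
  have G2: "real (n + 1) powr e \<le> G * 2 ^ n" for n
    using G(1)[of n] by (simp add: power_one_over field_simps)
  show ?thesis
  proof (rule that)
    show "0 \<le> M * G" "1 \<le> K * C * 2" "1 \<le> R * C * 2"
      using assms C G by (auto intro!: mult_ge1_I)
    fix j and \<alpha> :: "'a multi_index"
    let ?n = "degree_of \<alpha>"
    have "W M K R e j \<alpha> \<le> M * K ^ j * R ^ ?n * (C ^ (j + ?n) * fact j powr \<sigma>) * (G * 2 ^ (j + ?n)) * 1"
      unfolding W_def
      using assms C G F_pos[of j ?n] decay_pos[of j \<alpha>]
      by (intro mult_mono mult_nonneg_nonneg C(2) G2 decay_le_1 order_refl) (auto simp: less_imp_le)
    also have "\<dots> = M * G * (K * C * 2) ^ j * (R * C * 2) ^ ?n * fact j powr \<sigma>"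
      by (simp add: power_add power_mult_distrib)
    finally show "W M K R e j \<alpha> \<le> M * G * (K * C * 2) ^ j * (R * C * 2) ^ ?n * fact j powr \<sigma>" .
  qed
qed

text \<open>One step of the recursion: a term \<open>t\<^sup>v a \<Prod> \<dots>\<close> bounded with exponent \<open>E\<close>, which carries the
  power \<open>p = \<Sum> r\<^sub>\<ell> i\<^sub>\<ell>\<close> of \<open>K\<close>, contributes to the coefficient with index \<open>i + v + \<kappa>\<close> a multiple
  of its bound that is small for large \<open>K\<close>, as \<open>p < v + \<kappa>\<close>. The first factor on the right is
  compensated by the moment quotient.\<close>

lemma W_step:
  assumes "E \<le> (s0 + \<sigma>) * real \<kappa> + \<sigma> * real v" "p < v + \<kappa>" "1 \<le> K" "0 \<le> R" "0 \<le> C"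
  shows "W (C * K ^ p) K R E i \<alpha> \<le>
         (fact (i + v + \<kappa>) / fact (i + v)) powr s0 * (C * real (v + \<kappa> + 1) ^ 2 / K * W 1 K R 0 (i + v + \<kappa>) \<alpha>)"
proof -
  let ?n = "degree_of \<alpha>"
  have "K ^ (p + i) \<le> K ^ (i + v + \<kappa> - 1)" using assms by (intro power_increasing) auto
  also have "K ^ (i + v + \<kappa> - 1) = K ^ (i + v + \<kappa>) / K"
    using assms by (cases "i + v + \<kappa>") auto
  finally have K: "K ^ (p + i) \<le> K ^ (i + v + \<kappa>) / K" .
  have "W (C * K ^ p) K R E i \<alpha> = C * K ^ (p + i) * R ^ ?n * (F i ?n * real (i + ?n + 1) powr E) * decay i \<alpha>"
    by (simp add: W_def power_add)
  also have "\<dots> \<le> C * (K ^ (i + v + \<kappa>) / K) * R ^ ?n *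
      (F (i + v + \<kappa>) ?n * (fact (i + v + \<kappa>) / fact (i + v)) powr s0) * (real (v + \<kappa> + 1) ^ 2 * decay (i + (v + \<kappa>)) \<alpha>)"
    using assms F_pos[of i ?n] F_pos[of "i + v + \<kappa>" ?n] decay_pos[of i \<alpha>] decay_pos[of "i + (v + \<kappa>)" \<alpha>]
    by (intro mult_mono K F_critical[OF assms(1)] decay_shift order_refl) (auto simp: less_imp_le)
  also have "\<dots> = (fact (i + v + \<kappa>) / fact (i + v)) powr s0 * (C * real (v + \<kappa> + 1) ^ 2 / K * W 1 K R 0 (i + v + \<kappa>) \<alpha>)"
    by (simp add: W_def add.assoc)
  finally show ?thesis .
qed

end

section \<open>Moment functions\<close>

text \<open>The integrand is real on the positive axis, so the integral, which is \<open>0\<close> by convention if it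
  diverges, is invariant under conjugation.\<close>

lemma moment_function_real:
  assumes "moment_function s m"
  shows "m (of_nat j) \<in> \<real>"
proof -
  obtain p :: nat and e E where p: "p \<ge> 1" "kernel_pair (s / real p) e E"
    and m: "\<And>z. Re z \<ge> 0 \<Longrightarrow> m z = moment_integral (\<lambda>t. e (t powr (1 / of_nat p)) / of_nat p) z"
    using assms by (auto simp: moment_function_def)
  have er: "e (of_real t) \<in> \<real>" if "t > 0" for t :: real
    using p that by (auto simp: kernel_pair_def)
  let ?g = "\<lambda>t. of_real t powr (of_nat j - 1) * (e (of_real t powr (1 / of_nat p)) / of_nat p) :: complex"
  have g: "cnj (?g t) = ?g t" if t: "t > 0" for t :: real
  proof -
    have "complex_of_real t powr (1 / of_nat p) = of_real (t powr (1 / real p))"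
      using powr_of_real[of t "1 / real p"] t by simp
    then have 1: "e (of_real t powr (1 / of_nat p)) \<in> \<real>" using er[of "t powr (1 / real p)"] t by simp
    have "complex_of_real t powr (of_nat j - 1) = of_real (t powr (real j - 1))"
      using powr_of_real[of t "real j - 1"] t by simp
    then have "?g t \<in> \<real>" using 1 by (auto intro!: Reals_mult Reals_divide)
    then show ?thesis by (simp add: Reals_cnj_iff)
  qed
  have "0 \<le> Re (of_nat j)" by simp
  from m[OF this] have mj: "m (of_nat j) = (LINT t|lborel. indicator {0<..} t *\<^sub>R ?g t)"
    unfolding moment_integral_def set_lebesgue_integral_def .
  have "cnj (m (of_nat j)) = (LINT t|lborel. cnj (indicator {0<..} t *\<^sub>R ?g t))"
    unfolding mj by (rule Bochner_Integration.integral_cnj[symmetric])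
  also have "\<dots> = (LINT t|lborel. indicator {0<..} t *\<^sub>R ?g t)"
  proof (rule Bochner_Integration.integral_cong[OF refl])
    fix t
    show "cnj (indicator {0<..} t *\<^sub>R ?g t) = indicator {0<..} t *\<^sub>R ?g t"
      using g[of t] by (cases "t > 0") auto
  qed
  finally have "cnj (m (of_nat j)) = m (of_nat j)" unfolding mj .
  then show ?thesis by (simp add: Reals_cnj_iff)
qed

text \<open>Since the moments are real, the bounds on the real part of the quotients in the definition of
  regularity are bounds on their modulus; the lower bound also excludes zero moments.\<close>

lemma regular_moment_function_bounds:
  assumes "regular_moment_function s m"
  obtains a A where "a > 0" "A > 0" "\<And>j. m (of_nat j) \<noteq> 0"
    "\<And>j. a * real (j + 1) powr s \<le> cmod (m (of_nat (j + 1)) / m (of_nat j))"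
    "\<And>j. cmod (m (of_nat (j + 1)) / m (of_nat j)) \<le> A * real (j + 1) powr s"
proof -
  from assms obtain a A where a: "a > 0" and A: "A > 0" and
    l: "\<And>j. a * real (j + 1) powr s \<le> Re (m (of_nat (j + 1)) / m (of_nat j))" and
    u: "\<And>j. Re (m (of_nat (j + 1)) / m (of_nat j)) \<le> A * real (j + 1) powr s"
    unfolding regular_moment_function_def by blast
  have mf: "moment_function s m" using assms by (simp add: regular_moment_function_def)
  have pos: "0 < a * real (j + 1) powr s" for j using a by simp
  show ?thesis
  proof (rule that[OF a A])
    show "m (of_nat j) \<noteq> 0" for j
      using l[of j] pos[of j] by auto
    show "a * real (j + 1) powr s \<le> cmod (m (of_nat (j + 1)) / m (of_nat j))" for j
      using l[of j] complex_Re_le_cmod order_trans by blast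
    show "cmod (m (of_nat (j + 1)) / m (of_nat j)) \<le> A * real (j + 1) powr s" for j
    proof -
      have "m (of_nat (j + 1)) / m (of_nat j) \<in> \<real>"
        by (intro Reals_divide moment_function_real[OF mf])
      then have "cmod (m (of_nat (j + 1)) / m (of_nat j)) = \<bar>Re (m (of_nat (j + 1)) / m (of_nat j))\<bar>"
        by (rule in_Reals_norm)
      then show ?thesis using u[of j] l[of j] pos[of j] by linarith
    qed
  qed
qed

lemma moment_deriv_power_nth:
  assumes "\<And>j. m (of_nat j) \<noteq> 0"
  shows "fps_nth ((moment_deriv m ^^ i) h) j = m (of_nat (j + i)) / m (of_nat j) * fps_nth h (j + i)"
proof (induction i arbitrary: j)
  case 0
  then show ?case using assms by simp
next
  case (Suc i)
  have "fps_nth ((moment_deriv m ^^ Suc i) h) j =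
        m (of_nat (j + 1)) * fps_nth ((moment_deriv m ^^ i) h) (j + 1) / m (of_nat j)"
    by (simp add: moment_deriv_def)
  also have "\<dots> = m (of_nat (j + Suc i)) / m (of_nat j) * fps_nth h (j + Suc i)"
    unfolding Suc using assms[of "j + 1"] by (simp add: field_simps del: of_nat_Suc of_nat_add)
  finally show ?case .
qed

lemma moment_ratio_lower:
  assumes a: "a > 0" "\<And>j. m (of_nat j) \<noteq> 0"
    "\<And>j. a * real (j + 1) powr s \<le> cmod (m (of_nat (j + 1)) / m (of_nat j))"
  shows "a ^ k * (fact (j + k) / fact j) powr s \<le> cmod (m (of_nat (j + k)) / m (of_nat j))"
proof (induction k)
  case 0
  then show ?case using a by simp
next
  case (Suc k)
  have "a ^ Suc k * (fact (j + Suc k) / fact j) powr s =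
        (a * real (j + k + 1) powr s) * (a ^ k * (fact (j + k) / fact j) powr s)"
  proof -
    have "fact (j + Suc k) / fact j = real (j + k + 1) * (fact (j + k) / fact j)" by simp
    then show ?thesis by (simp only: powr_mult power_Suc mult_ac)
  qed
  also have "\<dots> \<le> cmod (m (of_nat (j + k + 1)) / m (of_nat (j + k))) * cmod (m (of_nat (j + k)) / m (of_nat j))"
    using a by (intro mult_mono Suc a(3)) auto
  also have "\<dots> = cmod (m (of_nat (j + Suc k)) / m (of_nat j))"
    using a(2)[of "j + k"] unfolding norm_mult[symmetric] by (simp del: of_nat_add)
  finally show ?case .
qed

section \<open>Growth of the Gamma function\<close>

lemma ln_Gamma_convex:
  fixes x y t :: real
  assumes "0 < x" "0 < y" "0 \<le> t" "t \<le> 1"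
  shows "ln (Gamma ((1 - t) * x + t * y)) \<le> (1 - t) * ln (Gamma x) + t * ln (Gamma y)"
  using convex_onD[OF log_convex_Gamma_real, of t x y] assms by simp

lemma Gamma_plus1_real: "0 < (x :: real) \<Longrightarrow> Gamma (x + 1) = x * Gamma x"
  by (rule Gamma_plus1) (auto elim!: nonpos_Ints_cases)

text \<open>For \<open>s \<le> 1\<close> this is convexity of \<open>ln Gamma\<close> between \<open>x\<close> and \<open>x + 1\<close>; the functional equation
  gives the other \<open>s\<close>.\<close>

lemma Gamma_add_le:
  fixes x s :: real
  assumes x: "0 < x" and s: "0 \<le> s"
  shows "Gamma (x + s) \<le> (x + s) powr s * Gamma x"
proof -
  have base: "Gamma (x + s) \<le> (x + s) powr s * Gamma x" if s: "0 \<le> s" "s \<le> 1" for s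
  proof -
    have "ln (Gamma (x + s)) \<le> (1 - s) * ln (Gamma x) + s * ln (Gamma (x + 1))"
      using ln_Gamma_convex[of x "x + 1" s] x s by (simp add: algebra_simps)
    also have "Gamma (x + 1) = x * Gamma x" using x by (intro Gamma_plus1_real) auto
    also have "(1 - s) * ln (Gamma x) + s * ln (x * Gamma x) = s * ln x + ln (Gamma x)"
      using x Gamma_real_pos[OF x, THEN less_imp_neq] by (simp add: ln_mult algebra_simps)
    also have "\<dots> \<le> s * ln (x + s) + ln (Gamma x)" using x s by (intro add_right_mono mult_left_mono) auto
    also have "\<dots> = ln ((x + s) powr s * Gamma x)"
      using x s Gamma_real_pos[OF x, THEN less_imp_neq] by (simp add: ln_mult ln_powr)
    finally show ?thesis
      using x s Gamma_real_pos[OF x] Gamma_real_pos[of "x + s"] by (subst (asm) ln_le_cancel_iff) auto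
  qed
  have "Gamma (x + (s + real n)) \<le> (x + (s + real n)) powr (s + real n) * Gamma x" if "0 \<le> s" "s \<le> 1" for s n
  proof (induction n)
    case 0
    then show ?case using base that by simp
  next
    case (Suc n)
    let ?y = "x + (s + real n)"
    have y: "?y > 0" using x that by simp
    have "Gamma (?y + 1) = ?y * Gamma ?y" using y by (intro Gamma_plus1_real) auto
    also have "\<dots> \<le> ?y * (?y powr (s + real n) * Gamma x)" using Suc y by (intro mult_left_mono) auto
    also have "\<dots> = ?y powr (s + real (Suc n)) * Gamma x" using y by (simp add: powr_add)
    also have "\<dots> \<le> (?y + 1) powr (s + real (Suc n)) * Gamma x"
      using y that Gamma_real_pos[OF x] by (intro mult_right_mono powr_mono2) auto
    finally show ?case by (simp add: add_ac)
  qed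
  from this[of "frac s" "nat \<lfloor>s\<rfloor>"] show ?thesis
    using s frac_lt_1[of s] by (simp add: frac_def)
qed

text \<open>For \<open>s \<ge> 1\<close> this is convexity of \<open>ln Gamma\<close> at \<open>x + 1\<close> between \<open>x\<close> and \<open>x + s\<close>; smaller \<open>s\<close> are
  reduced to \<open>s + 1\<close> by the functional equation.\<close>

lemma Gamma_add_ge:
  fixes x s :: real
  assumes x: "1 \<le> x" and s: "0 \<le> s"
  shows "x powr s * Gamma x \<le> (1 + s) * Gamma (x + s)"
proof -
  have x0: "x > 0" using x by simp
  have base: "x powr s * Gamma x \<le> Gamma (x + s)" if s: "1 \<le> s" for s
  proof -
    have "ln (Gamma (x + 1)) \<le> (1 - 1 / s) * ln (Gamma x) + 1 / s * ln (Gamma (x + s))"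
    proof -
      have "(1 - 1 / s) * x + 1 / s * (x + s) = x + 1" using s by (simp add: field_simps)
      then show ?thesis using ln_Gamma_convex[of x "x + s" "1 / s"] x s by simp
    qed
    also have "Gamma (x + 1) = x * Gamma x" using x by (intro Gamma_plus1_real) auto
    also have "ln (x * Gamma x) = ln x + ln (Gamma x)"
      using x Gamma_real_pos[OF x0, THEN less_imp_neq] by (simp add: ln_mult)
    finally have "s * (ln x + ln (Gamma x)) \<le> s * ((1 - 1 / s) * ln (Gamma x) + 1 / s * ln (Gamma (x + s)))"
      using s by (intro mult_left_mono) auto
    also have "\<dots> = (s - 1) * ln (Gamma x) + ln (Gamma (x + s))"
      using s by (simp add: field_simps)
    finally have "s * ln x + ln (Gamma x) \<le> ln (Gamma (x + s))" by (simp add: algebra_simps)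
    then have "ln (x powr s * Gamma x) \<le> ln (Gamma (x + s))"
      using x s Gamma_real_pos[OF x0, THEN less_imp_neq] by (simp add: ln_mult ln_powr)
    then show ?thesis
      using x s Gamma_real_pos[OF x0] Gamma_real_pos[of "x + s"] by (subst (asm) ln_le_cancel_iff) auto
  qed
  have "x * (x powr s * Gamma x) = x powr (s + 1) * Gamma x" using x by (simp add: powr_add)
  also have "\<dots> \<le> Gamma (x + s + 1)" using base[of "s + 1"] s by (simp add: add_ac)
  also have "\<dots> = (x + s) * Gamma (x + s)" using x s by (intro Gamma_plus1_real) auto
  also have "\<dots> \<le> (x * (1 + s)) * Gamma (x + s)"
    using x s Gamma_real_pos[of "x + s"] mult_right_mono[of 1 x s] by (intro mult_right_mono) (auto simp: algebra_simps)
  finally have "x * (x powr s * Gamma x) \<le> x * ((1 + s) * Gamma (x + s))" by (simp add: mult_ac)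
  then show ?thesis using x by simp
qed

text \<open>Both sides are products over \<open>j\<close> whose successive factors are comparable to \<open>(j + 1)\<^sup>\<sigma>\<close>.\<close>

lemma Gamma_fact_powr:
  assumes \<sigma>: "0 \<le> (\<sigma> :: real)"
  obtains C where "C \<ge> 1" "\<And>j. Gamma (1 + \<sigma> * real j) \<le> C ^ j * fact j powr \<sigma>"
    "\<And>j. fact j powr \<sigma> \<le> C ^ j * Gamma (1 + \<sigma> * real j)"
proof -
  \<comment> \<open>a lower bound for \<open>(1 + \<sigma> j) / (1 + j)\<close>; for \<open>\<sigma> = 0\<close> it must only be positive, as all powers are then \<open>1\<close>\<close>
  define \<mu> where "\<mu> = (if \<sigma> = 0 then 1 else min 1 \<sigma>)"
  have \<mu>: "\<mu> > 0" using \<sigma> by (auto simp: \<mu>_def)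
  have \<mu>1: "(\<mu> * real (j + 1)) powr \<sigma> \<le> (1 + \<sigma> * real j) powr \<sigma>" for j
  proof (cases "\<sigma> = 0")
    case False
    have "\<mu> * real j \<le> \<sigma> * real j" "\<mu> \<le> 1" using \<sigma> False by (auto simp: \<mu>_def intro: mult_right_mono)
    then have "\<mu> * real (j + 1) \<le> 1 + \<sigma> * real j" by (simp add: algebra_simps)
    then show ?thesis using \<sigma> \<mu> by (intro powr_mono2) auto
  qed (simp add: \<mu>_def)
  define A where "A = (1 + \<sigma>) powr \<sigma>"
  define B where "B = (1 + \<sigma>) / \<mu> powr \<sigma>"
  have AB: "A > 0" "B > 0" using \<sigma> \<mu> by (auto simp: A_def B_def)
  define C where "C = max 1 (max A B)"
  have up: "Gamma (1 + \<sigma> * real j) \<le> A ^ j * fact j powr \<sigma>" for j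
  proof (induction j)
    case (Suc j)
    have "Gamma (1 + \<sigma> * real (Suc j)) = Gamma (1 + \<sigma> * real j + \<sigma>)" by (simp add: algebra_simps)
    also have "\<dots> \<le> (1 + \<sigma> * real j + \<sigma>) powr \<sigma> * Gamma (1 + \<sigma> * real j)"
      using \<sigma> by (intro Gamma_add_le) (auto intro: add_pos_nonneg)
    also have "\<dots> \<le> ((1 + \<sigma>) * real (Suc j)) powr \<sigma> * (A ^ j * fact j powr \<sigma>)"
      using \<sigma> Suc by (intro mult_mono powr_mono2) (auto simp: algebra_simps intro!: less_imp_le[OF Gamma_real_pos] add_pos_nonneg)
    also have "\<dots> = A ^ Suc j * fact (Suc j) powr \<sigma>" by (simp only: A_def powr_mult fact_Suc power_Suc mult_ac)
    finally show ?case .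
  qed auto
  have lo: "fact j powr \<sigma> \<le> B ^ j * Gamma (1 + \<sigma> * real j)" for j
  proof (induction j)
    case (Suc j)
    let ?x = "1 + \<sigma> * real j"
    have G: "0 < Gamma ?x" using \<sigma> by (intro Gamma_real_pos add_pos_nonneg) auto
    have "fact (Suc j) powr \<sigma> = real (j + 1) powr \<sigma> * fact j powr \<sigma>" by (simp only: Suc_eq_plus1[symmetric] fact_Suc powr_mult)
    also have "\<dots> \<le> real (j + 1) powr \<sigma> * (B ^ j * Gamma ?x)" using Suc by (intro mult_left_mono) auto
    also have "\<dots> = B ^ j / \<mu> powr \<sigma> * ((\<mu> * real (j + 1)) powr \<sigma> * Gamma ?x)"
      using \<mu> by (simp add: powr_mult del: of_nat_add)
    also have "\<dots> \<le> B ^ j / \<mu> powr \<sigma> * (?x powr \<sigma> * Gamma ?x)"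
      using AB \<mu>1[of j] G by (intro mult_left_mono mult_right_mono) auto
    also have "\<dots> \<le> B ^ j / \<mu> powr \<sigma> * ((1 + \<sigma>) * Gamma (?x + \<sigma>))"
      using AB \<sigma> by (intro mult_left_mono Gamma_add_ge) auto
    also have "?x + \<sigma> = 1 + \<sigma> * real (Suc j)" by (simp add: algebra_simps)
    also have "B ^ j / \<mu> powr \<sigma> * ((1 + \<sigma>) * Gamma (1 + \<sigma> * real (Suc j))) = B ^ Suc j * Gamma (1 + \<sigma> * real (Suc j))"
      by (simp add: B_def del: of_nat_Suc)
    finally show ?case .
  qed auto
  show ?thesis
  proof (rule that)
    show "C \<ge> 1" by (simp add: C_def)
    fix j
    have G: "0 < Gamma (1 + \<sigma> * real j)" using \<sigma> by (intro Gamma_real_pos add_pos_nonneg) auto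
    have "A ^ j \<le> C ^ j" "B ^ j \<le> C ^ j" using AB by (auto simp: C_def intro!: power_mono)
    then show "Gamma (1 + \<sigma> * real j) \<le> C ^ j * fact j powr \<sigma>" "fact j powr \<sigma> \<le> C ^ j * Gamma (1 + \<sigma> * real j)"
      using up[of j] lo[of j] G by (meson mult_right_mono order_trans powr_ge_zero less_imp_le)+
  qed
qed

section \<open>Gevrey series and their Taylor coefficients\<close>

text \<open>The Gevrey property in terms of Taylor coefficients at \<open>0\<close>. Factorials replace the Gamma function,
  which changes only the constants, and the polydisc may shrink.\<close>

definition factorially_bounded :: "real \<Rightarrow> ('n::finite cvec \<Rightarrow> complex fps) \<Rightarrow> bool" where
  "factorially_bounded \<sigma> h \<longleftrightarrow> (\<exists>\<delta>>0. \<exists>M\<ge>0. \<exists>K\<ge>1. \<exists>R\<ge>1. \<forall>j.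
     coef_bounded \<delta> (\<lambda>\<alpha>. M * K ^ j * R ^ degree_of \<alpha> * fact j powr \<sigma>) (\<lambda>x. fps_nth (h x) j))"

lemma factorially_boundedE:
  assumes "factorially_bounded \<sigma> h"
  obtains \<delta> M K R where "\<delta> > 0" "M \<ge> 0" "K \<ge> 1" "R \<ge> 1"
    "\<And>j. coef_bounded \<delta> (\<lambda>\<alpha>. M * K ^ j * R ^ degree_of \<alpha> * fact j powr \<sigma>) (\<lambda>x. fps_nth (h x) j)"
  using assms unfolding factorially_bounded_def by blast

lemma factorially_boundedI:
  assumes "\<delta> > 0" "M \<ge> 0" "K \<ge> 1" "R \<ge> 1"
    "\<And>j. coef_bounded \<delta> (\<lambda>\<alpha>. M * K ^ j * R ^ degree_of \<alpha> * fact j powr \<sigma>) (\<lambda>x. fps_nth (h x) j)"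
  shows "factorially_bounded \<sigma> h"
  using assms unfolding factorially_bounded_def by blast

lemma positive_vec_min:
  fixes \<rho> :: "'n::finite rvec"
  assumes "\<And>d. 0 < \<rho> $ d"
  obtains r where "r > 0" "\<And>d. r < \<rho> $ d"
proof -
  let ?m = "Min (range (\<lambda>d. \<rho> $ d))"
  have "?m \<in> range (\<lambda>d. \<rho> $ d)" by (intro Min_in) auto
  then have "?m > 0" using assms by auto
  moreover have "?m \<le> \<rho> $ d" for d by (intro Min_le) auto
  ultimately have "?m / 2 < \<rho> $ d" for d by (smt (verit) field_sum_of_halves)
  with \<open>?m > 0\<close> show ?thesis by (intro that[of "?m / 2"]) auto
qed

text \<open>Cauchy's estimates on the polydisc on which the Gevrey bound holds.\<close>

lemma gevrey_imp_factorially_bounded: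
  fixes h :: "'n::finite cvec \<Rightarrow> complex fps"
  assumes g: "gevrey \<rho> \<sigma> h" and h: "holomorphic_fps \<rho> h" and \<sigma>: "0 \<le> \<sigma>"
  shows "factorially_bounded \<sigma> h"
proof -
  obtain r C K where r: "r > 0" "\<And>d. r < \<rho> $ d" and C: "C > 0" and K: "K > 0"
    and b: "\<And>x j. x \<in> cube r \<Longrightarrow> cmod (fps_nth (h x) j) \<le> C * K ^ j * Gamma (1 + \<sigma> * real j)"
    using g unfolding gevrey_def by blast
  obtain G where G: "G \<ge> 1" "\<And>j. Gamma (1 + \<sigma> * real j) \<le> G ^ j * fact j powr \<sigma>"
    using Gamma_fact_powr[OF \<sigma>] by metis
  let ?K = "max 1 (K * G)" and ?R = "max 1 (1 / r)"
  show ?thesis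
  proof (rule factorially_boundedI)
    show "r > 0" "C \<ge> 0" "?K \<ge> 1" "?R \<ge> 1" using r C by auto
    fix j
    have "holomorphic_vec (\<lambda>x. fps_nth (h x) j) (polydisc \<rho>)" using h by (simp add: holomorphic_fps_def)
    from holomorphic_vec_expands[OF this r(1) less_imp_le[OF r(2)] b]
    obtain c where c: "expands r (\<lambda>x. fps_nth (h x) j) c"
       "\<And>\<alpha>. cmod (c \<alpha>) * r ^ degree_of \<alpha> \<le> C * K ^ j * Gamma (1 + \<sigma> * real j)" by blast
    show "coef_bounded r (\<lambda>\<alpha>. C * ?K ^ j * ?R ^ degree_of \<alpha> * fact j powr \<sigma>) (\<lambda>x. fps_nth (h x) j)"
      unfolding coef_bounded_def
    proof (intro exI conjI allI)
      fix \<alpha>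
      have "cmod (c \<alpha>) \<le> C * K ^ j * Gamma (1 + \<sigma> * real j) * (1 / r) ^ degree_of \<alpha>"
        using c(2)[of \<alpha>] r by (simp add: field_simps)
      also have "\<dots> \<le> C * K ^ j * (G ^ j * fact j powr \<sigma>) * ?R ^ degree_of \<alpha>"
        using C K r G by (intro mult_mono mult_left_mono G power_mono) auto
      also have "\<dots> = C * (K * G) ^ j * ?R ^ degree_of \<alpha> * fact j powr \<sigma>"
        by (simp add: power_mult_distrib)
      also have "\<dots> \<le> C * ?K ^ j * ?R ^ degree_of \<alpha> * fact j powr \<sigma>"
        using C K r G by (intro mult_right_mono mult_left_mono power_mono) auto
      finally show "cmod (c \<alpha>) \<le> C * ?K ^ j * ?R ^ degree_of \<alpha> * fact j powr \<sigma>" .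
    qed (rule c)
  qed
qed

text \<open>On a polydisc of radius at most \<open>1 / (2 R)\<close> the power series are dominated by a geometric series
  of ratio \<open>1 / 2\<close>.\<close>

lemma factorially_bounded_imp_gevrey:
  fixes h :: "'n::finite cvec \<Rightarrow> complex fps"
  assumes f: "factorially_bounded \<sigma> h" and \<rho>: "\<And>d. 0 < \<rho> $ d" and \<sigma>: "0 \<le> \<sigma>"
  shows "gevrey \<rho> \<sigma> h"
proof -
  obtain \<delta> M K R where d: "\<delta> > 0" "M \<ge> 0" "K \<ge> 1" "R \<ge> 1" and
    b: "\<And>j. coef_bounded \<delta> (\<lambda>\<alpha>. M * K ^ j * R ^ degree_of \<alpha> * fact j powr \<sigma>) (\<lambda>x. fps_nth (h x) j)"
    using f unfolding factorially_bounded_def by blast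
  obtain r0 where r0: "r0 > 0" "\<And>d. r0 < \<rho> $ d" using positive_vec_min[OF \<rho>] by blast
  define r where "r = min r0 (min \<delta> (1 / (2 * R)))"
  have r_le: "r \<le> r0" "r \<le> \<delta>" "r \<le> 1 / (2 * R)" unfolding r_def by auto
  have r: "r > 0" "r \<le> \<delta>" "R * r \<le> 1 / 2" "\<And>d. r < \<rho> $ d"
  proof -
    show "r > 0" using r0 d by (auto simp: r_def)
    have "R * r \<le> R * (1 / (2 * R))" using r_le(3) d by (intro mult_left_mono) auto
    then show "R * r \<le> 1 / 2" using d by simp
  qed (use r_le r0 in \<open>auto intro: le_less_trans\<close>)
  obtain G where G: "G \<ge> 1" "\<And>j. fact j powr \<sigma> \<le> G ^ j * Gamma (1 + \<sigma> * real j)"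
    using Gamma_fact_powr[OF \<sigma>] by metis
  define T where "T = infsum (\<lambda>\<alpha> :: 'n multi_index. (1 / 2 :: real) ^ degree_of \<alpha>) UNIV"
  have T: "((\<lambda>\<alpha> :: 'n multi_index. (1 / 2 :: real) ^ degree_of \<alpha>) has_sum T) UNIV"
    unfolding T_def by (intro has_sum_infsum geometric_multi_summable) auto
  then have T0: "0 \<le> T" by (rule has_sum_nonneg) auto
  show ?thesis
    unfolding gevrey_def
  proof (rule exI[of _ r], intro conjI allI, goal_cases)
    case 3
    show ?case
    proof (rule exI[of _ "M * T + 1"], rule conjI[rotated], rule exI[of _ "K * G"], intro conjI allI ballI)
      fix x :: "'n cvec" and j assume x: "x \<in> cube r"
      obtain c where c: "expands \<delta> (\<lambda>x. fps_nth (h x) j) c"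
        "\<And>\<alpha>. cmod (c \<alpha>) \<le> M * K ^ j * R ^ degree_of \<alpha> * fact j powr \<sigma>"
        using b[of j] by (auto simp: coef_bounded_def)
      have xd: "x \<in> cube \<delta>" using x r(2) unfolding mem_cube by (blast intro: less_le_trans)
      have "cmod (fps_nth (h x) j) \<le> M * K ^ j * fact j powr \<sigma> * T"
      proof (rule norm_infsum_le[OF expandsD[OF c(1) xd] has_sum_cmult_right[OF T]])
        fix \<alpha> :: "'n multi_index"
        let ?n = "degree_of \<alpha>"
        have "cmod (c \<alpha> * mpow x \<alpha>) \<le> (M * K ^ j * R ^ ?n * fact j powr \<sigma>) * r ^ ?n"
          unfolding norm_mult using x d
          by (intro mult_mono c norm_mpow_le) (auto simp: mem_cube less_imp_le)
        also have "\<dots> = M * K ^ j * fact j powr \<sigma> * (R * r) ^ ?n" by (simp add: power_mult_distrib)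
        also have "\<dots> \<le> M * K ^ j * fact j powr \<sigma> * (1 / 2) ^ ?n"
          using d r by (intro mult_left_mono power_mono) auto
        finally show "cmod (c \<alpha> * mpow x \<alpha>) \<le> M * K ^ j * fact j powr \<sigma> * (1 / 2) ^ ?n" .
      qed
      also have "\<dots> \<le> M * K ^ j * (G ^ j * Gamma (1 + \<sigma> * real j)) * T"
        using d T0 by (intro mult_right_mono mult_left_mono G) auto
      also have "\<dots> = (M * T) * (K * G) ^ j * Gamma (1 + \<sigma> * real j)"
        by (simp add: power_mult_distrib)
      also have "\<dots> \<le> (M * T + 1) * (K * G) ^ j * Gamma (1 + \<sigma> * real j)"
        using d G \<sigma> by (intro mult_right_mono) (auto intro!: less_imp_le[OF Gamma_real_pos] add_pos_nonneg)
      finally show "cmod (fps_nth (h x) j) \<le> (M * T + 1) * (K * G) ^ j * Gamma (1 + \<sigma> * real j)" .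
    qed (use r d G T0 in \<open>auto intro!: add_nonneg_pos\<close>)
  qed (use r in auto)
qed

lemma factorially_bounded_mono:
  assumes "factorially_bounded \<sigma> h" "\<sigma> \<le> \<sigma>'"
  shows "factorially_bounded \<sigma>' h"
  using assms(1)
proof (rule factorially_boundedE)
  fix \<delta> M K R assume a: "\<delta> > 0" "M \<ge> 0" "K \<ge> 1" "R \<ge> 1"
    "\<And>j. coef_bounded \<delta> (\<lambda>\<alpha>. M * K ^ j * R ^ degree_of \<alpha> * fact j powr \<sigma>) (\<lambda>x. fps_nth (h x) j)"
  show ?thesis
    by (rule factorially_boundedI[OF a(1-4)], rule coef_bounded_mono[OF a(5)])
       (use a assms(2) in \<open>auto intro!: mult_left_mono powr_mono\<close>)
qed

lemma factorially_bounded_cong: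
  assumes h: "factorially_bounded \<sigma> h" and \<rho>: "\<And>d. 0 < \<rho> $ d" and eq: "\<And>x. x \<in> polydisc \<rho> \<Longrightarrow> h x = h' x"
  shows "factorially_bounded \<sigma> h'"
  using h
proof (rule factorially_boundedE)
  fix \<delta> M K R assume a: "\<delta> > 0" "M \<ge> 0" "K \<ge> 1" "R \<ge> 1"
    "\<And>j. coef_bounded \<delta> (\<lambda>\<alpha>. M * K ^ j * R ^ degree_of \<alpha> * fact j powr \<sigma>) (\<lambda>x. fps_nth (h x) j)"
  obtain r where r: "r > 0" "\<And>d. r < \<rho> $ d" using positive_vec_min[OF \<rho>] by blast
  have sub: "cube (min \<delta> r) \<subseteq> polydisc \<rho>"
    by (rule cube_subset_polydisc) (use r(2) in \<open>auto simp: min_le_iff_disj less_imp_le\<close>)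
  show ?thesis
  proof (rule factorially_boundedI[OF _ a(2-4)])
    show "min \<delta> r > 0" using a r by simp
    show "coef_bounded (min \<delta> r) (\<lambda>\<alpha>. M * K ^ j * R ^ degree_of \<alpha> * fact j powr \<sigma>) (\<lambda>x. fps_nth (h' x) j)" for j
      by (rule coef_bounded_cong[OF coef_bounded_subset[OF a(5)]]) (use eq sub in auto)
  qed
qed

lemma factorially_bounded_add:
  assumes "factorially_bounded \<sigma> h" "factorially_bounded \<sigma> h'"
  shows "factorially_bounded \<sigma> (\<lambda>x. h x + h' x)"
proof -
  obtain \<delta> M K R where a: "\<delta> > 0" "M \<ge> 0" "K \<ge> 1" "R \<ge> 1"
    "\<And>j. coef_bounded \<delta> (\<lambda>\<alpha>. M * K ^ j * R ^ degree_of \<alpha> * fact j powr \<sigma>) (\<lambda>x. fps_nth (h x) j)"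
    using assms(1) unfolding factorially_bounded_def by blast
  obtain \<delta>' M' K' R' where a': "\<delta>' > 0" "M' \<ge> 0" "K' \<ge> 1" "R' \<ge> 1"
    "\<And>j. coef_bounded \<delta>' (\<lambda>\<alpha>. M' * K' ^ j * R' ^ degree_of \<alpha> * fact j powr \<sigma>) (\<lambda>x. fps_nth (h' x) j)"
    using assms(2) unfolding factorially_bounded_def by blast
  let ?\<delta> = "min \<delta> \<delta>'" and ?K = "max K K'" and ?R = "max R R'"
  show ?thesis
  proof (rule factorially_boundedI)
    show "?\<delta> > 0" "M + M' \<ge> 0" "?K \<ge> 1" "?R \<ge> 1" using a a' by auto
    fix j
    have "coef_bounded ?\<delta> (\<lambda>\<alpha>. M * K ^ j * R ^ degree_of \<alpha> * fact j powr \<sigma> + M' * K' ^ j * R' ^ degree_of \<alpha> * fact j powr \<sigma>)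
       (\<lambda>x. fps_nth (h x) j + fps_nth (h' x) j)"
      by (intro coef_bounded_add coef_bounded_subset[OF a(5)] coef_bounded_subset[OF a'(5)]) auto
    then show "coef_bounded ?\<delta> (\<lambda>\<alpha>. (M + M') * ?K ^ j * ?R ^ degree_of \<alpha> * fact j powr \<sigma>) (\<lambda>x. fps_nth (h x + h' x) j)"
      unfolding fps_add_nth
    proof (rule coef_bounded_mono)
      fix \<alpha> :: "'a multi_index"
      have "M * K ^ j * R ^ degree_of \<alpha> * fact j powr \<sigma> \<le> M * ?K ^ j * ?R ^ degree_of \<alpha> * fact j powr \<sigma>"
        using a by (intro mult_mono mult_left_mono mult_right_mono power_mono) auto
      moreover have "M' * K' ^ j * R' ^ degree_of \<alpha> * fact j powr \<sigma> \<le> M' * ?K ^ j * ?R ^ degree_of \<alpha> * fact j powr \<sigma>"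
        using a' by (intro mult_mono mult_left_mono mult_right_mono power_mono) auto
      ultimately show "M * K ^ j * R ^ degree_of \<alpha> * fact j powr \<sigma> + M' * K' ^ j * R' ^ degree_of \<alpha> * fact j powr \<sigma>
         \<le> (M + M') * ?K ^ j * ?R ^ degree_of \<alpha> * fact j powr \<sigma>"
        by (simp add: algebra_simps)
    qed
  qed
qed

lemma factorially_bounded_uminus:
  assumes "factorially_bounded \<sigma> h"
  shows "factorially_bounded \<sigma> (\<lambda>x. - h x)"
  using assms
proof (rule factorially_boundedE)
  fix \<delta> M K R assume a: "\<delta> > 0" "M \<ge> 0" "K \<ge> 1" "R \<ge> 1"
    "\<And>j. coef_bounded \<delta> (\<lambda>\<alpha>. M * K ^ j * R ^ degree_of \<alpha> * fact j powr \<sigma>) (\<lambda>x. fps_nth (h x) j)"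
  show ?thesis
    by (rule factorially_boundedI[OF a(1-4)]) (use coef_bounded_cmult[OF a(5), of "-1"] in simp)
qed

lemma factorially_bounded_0: "factorially_bounded \<sigma> (\<lambda>x. 0)"
  by (rule factorially_boundedI[of 1 0 1 1]) (auto intro!: coef_bounded_0)

lemma factorially_bounded_sum:
  "(\<And>i. i \<in> I \<Longrightarrow> factorially_bounded \<sigma> (h i)) \<Longrightarrow> factorially_bounded \<sigma> (\<lambda>x. \<Sum>i\<in>I. h i x)"
  by (induction I rule: infinite_finite_induct) (auto intro!: factorially_bounded_0 factorially_bounded_add)

lemma factorially_bounded_X_power:
  assumes h: "factorially_bounded \<sigma> h" and \<sigma>: "0 \<le> \<sigma>"
  shows "factorially_bounded \<sigma> (\<lambda>x. fps_X ^ v * h x)"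
  using h
proof (rule factorially_boundedE)
  fix \<delta> M K R assume a: "\<delta> > 0" "M \<ge> 0" "K \<ge> 1" "R \<ge> 1"
    "\<And>j. coef_bounded \<delta> (\<lambda>\<alpha>. M * K ^ j * R ^ degree_of \<alpha> * fact j powr \<sigma>) (\<lambda>x. fps_nth (h x) j)"
  show ?thesis
  proof (rule factorially_boundedI[OF a(1-4)])
    fix j
    show "coef_bounded \<delta> (\<lambda>\<alpha>. M * K ^ j * R ^ degree_of \<alpha> * fact j powr \<sigma>) (\<lambda>x. fps_nth (fps_X ^ v * h x) j)"
    proof (cases "j < v")
      case True
      then show ?thesis using a by (auto simp: fps_X_power_mult_nth intro!: coef_bounded_0)
    next
      case False
      have "coef_bounded \<delta> (\<lambda>\<alpha>. M * K ^ j * R ^ degree_of \<alpha> * fact j powr \<sigma>) (\<lambda>x. fps_nth (h x) (j - v))"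
      proof (rule coef_bounded_mono[OF a(5)])
        fix \<alpha> :: "'a multi_index"
        show "M * K ^ (j - v) * R ^ degree_of \<alpha> * fact (j - v) powr \<sigma> \<le> M * K ^ j * R ^ degree_of \<alpha> * fact j powr \<sigma>"
          using a \<sigma> by (intro mult_mono mult_left_mono mult_right_mono power_increasing powr_mono2 fact_mono) auto
      qed
      then show ?thesis using False by (simp add: fps_X_power_mult_nth)
    qed
  qed
qed

section \<open>The Cauchy problem\<close>

definition nonlinear_factor ::
    "('n::{finite,linorder}) cauchy_problem \<Rightarrow> nat \<Rightarrow> 'n multi_index \<Rightarrow> ('n cvec \<Rightarrow> complex fps) \<Rightarrow> 'n cvec \<Rightarrow> complex fps" where
  "nonlinear_factor P i q u x = (moment_deriv (mom_t P) ^^ i) (moment_deriv_coeffs (mom_x P) q u x)"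

definition nonlinear_term ::
    "('n::{finite,linorder}) cauchy_problem \<Rightarrow> 'n index_tuple \<Rightarrow> ('n cvec \<Rightarrow> complex fps) \<Rightarrow> 'n cvec \<Rightarrow> complex fps" where
  "nonlinear_term P w u x =
     fps_expansion (\<lambda>t. coef P w t x) 0 * (\<Prod>(i, q, r)\<leftarrow>w. nonlinear_factor P i q u x ^ r)"

text \<open>The exponent \<open>E\<close> that a term of the equation costs: each derivative in \<open>t\<close> counts
  \<open>s\<^sub>0 + \<sigma>\<close>, each one in \<open>x\<^sub>d\<close> counts \<open>s\<^sub>d\<close>.\<close>

definition term_order :: "('n::{finite,linorder}) cauchy_problem \<Rightarrow> real \<Rightarrow> 'n index_tuple \<Rightarrow> real" where
  "term_order P \<sigma> w = (\<Sum>(i, q, r)\<leftarrow>w. real r * (lambda_sq P q + real i * (ord_t P + \<sigma>)))"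

definition t_order :: "('n::{finite,linorder}) index_tuple \<Rightarrow> nat" where
  "t_order w = (\<Sum>(i, q, r)\<leftarrow>w. r * i)"

lemma term_order_eq: "term_order P \<sigma> w = total_order P w + \<sigma> * real (t_order w)"
  unfolding term_order_def total_order_def t_order_def
  by (induction w) (auto simp: algebra_simps)

lemma formal_solutionD:
  assumes "formal_solution P u" "x \<in> polydisc (rad_x P)"
  shows "(moment_deriv (mom_t P) ^^ kappa P) (u x) =
    inhom P x + (\<Sum>n\<in>degrees P. \<Sum>w\<in>Lam P n. fps_X ^ t_exp P w * nonlinear_term P w u x)"
  using assms unfolding formal_solution_def nonlinear_term_def nonlinear_factor_def
  by (auto simp: diff_eq_eq mult.assoc)

lemma t_order_less:
  assumes "order_condition P" "n \<in> degrees P" "w \<in> Lam P n"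
  shows "t_order w < t_exp P w + kappa P"
  using assms unfolding order_condition_def t_order_def by fastforce

lemma critical_value_bounds:
  assumes d: "cauchy_data P" "order_condition P"
  shows "0 \<le> critical_value P"
    and "w \<in> crit_tuples P \<Longrightarrow> total_order P w - ord_t P * real (kappa P) \<le>
           (real (kappa P) + real (t_exp P w) - real (t_order w)) * critical_value P"
proof -
  let ?num = "\<lambda>w. real (kappa P) + real (t_exp P w) - real (t_order w)"
  let ?den = "\<lambda>w. total_order P w - ord_t P * real (kappa P)"
  let ?S = "(\<lambda>w. ?num w / ?den w) ` crit_tuples P"
  have fin: "finite (crit_tuples P)"
    using d(1) by (auto simp: crit_tuples_def cauchy_data_def)
  have num: "?num w > 0" if "w \<in> crit_tuples P" for w
    using that t_order_less[OF d(2), of _ w] by (fastforce simp: crit_tuples_def)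
  have den: "?den w > 0" if "w \<in> crit_tuples P" for w
    using that by (auto simp: crit_tuples_def)
  have sum_eq: "(\<Sum>(i, q, r)\<leftarrow>w. real r * real i) = real (t_order w)" for w :: "'a index_tuple"
    unfolding t_order_def by (induction w) auto
  have cv: "critical_value P = 1 / Min ?S" if "crit_tuples P \<noteq> {}"
    using that unfolding critical_value_def sum_eq by simp
  have pos: "Min ?S > 0" if "crit_tuples P \<noteq> {}"
    using that fin num den by (subst Min_gr_iff) auto
  show "0 \<le> critical_value P"
    using cv pos by (cases "crit_tuples P = {}") (auto simp: critical_value_def)
  assume w: "w \<in> crit_tuples P"
  then have ne: "crit_tuples P \<noteq> {}" by blast
  have "Min ?S \<le> ?num w / ?den w" using w fin by (intro Min_le) auto
  then have "Min ?S * ?den w \<le> ?num w" using den[OF w] by (simp add: pos_le_divide_eq)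
  then show "?den w \<le> ?num w * critical_value P"
    using pos[OF ne] by (simp add: cv[OF ne] pos_le_divide_eq mult.commute)
qed

text \<open>This is the meaning of the critical value. By \<open>term_order_eq\<close> the claim reads
  \<open>T - s\<^sub>0 \<kappa> \<le> \<sigma> (\<kappa> + v - \<Sum> r\<^sub>\<ell> i\<^sub>\<ell>)\<close> with the total order \<open>T\<close>. For critical terms this is
  \<open>\<sigma> \<ge> \<sigma>\<^sub>c\<close>, for the others the left-hand side is not positive.\<close>

lemma term_order_le:
  assumes d: "cauchy_data P" "order_condition P" and \<sigma>: "critical_value P \<le> \<sigma>" "0 \<le> \<sigma>"
    and w: "n \<in> degrees P" "w \<in> Lam P n"
  shows "term_order P \<sigma> w \<le> (ord_t P + \<sigma>) * real (kappa P) + \<sigma> * real (t_exp P w)"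
proof -
  let ?num = "\<lambda>w. real (kappa P) + real (t_exp P w) - real (t_order w)"
  let ?den = "\<lambda>w. total_order P w - ord_t P * real (kappa P)"
  have num: "?num w > 0" if "n \<in> degrees P" "w \<in> Lam P n" for n w
    using t_order_less[OF d(2) that] by linarith
  show ?thesis
  proof (cases "w \<in> crit_tuples P")
    case False
    then have "total_order P w \<le> ord_t P * real (kappa P)"
      using w by (auto simp: crit_tuples_def)
    moreover have "0 \<le> \<sigma> * ?num w" using \<sigma> num[OF w] by simp
    ultimately show ?thesis by (simp add: term_order_eq algebra_simps)
  next
    case True
    then have "?den w \<le> ?num w * critical_value P" by (rule critical_value_bounds(2)[OF d])
    also have "\<dots> \<le> ?num w * \<sigma>" using \<sigma> num[OF w] by (intro mult_left_mono) auto
    finally show ?thesis by (simp add: term_order_eq algebra_simps)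
  qed
qed

lemma lambda_sq_nonneg: "cauchy_data P \<Longrightarrow> 0 \<le> lambda_sq P q"
  unfolding lambda_sq_def cauchy_data_def
  by (intro sum_nonneg mult_nonneg_nonneg) (auto intro: order_trans[OF zero_le_one])

context gevrey_weight
begin

lemma controlled_moment_deriv_coeffs:
  fixes P :: "('n::{finite,linorder}) cauchy_problem"
  assumes d: "cauchy_data P" and R: "R > 0"
  shows "\<exists>C. controlled \<delta> R 0 0 (lambda_sq P q) C (moment_deriv_coeffs (mom_x P) q)"
proof -
  have reg: "regular_moment_function (ord_x P $ e) (mom_x P e)" and s: "ord_x P $ e \<ge> 1" for e
    using d by (auto simp: cauchy_data_def)
  have "\<exists>A>0. \<forall>j. cmod (mom_x P e (of_nat (j + 1)) / mom_x P e (of_nat j)) \<le> A * real (j + 1) powr (ord_x P $ e)" for e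
    using regular_moment_function_bounds[OF reg[of e]] by metis
  then obtain A where A: "\<And>e. A e > 0"
    "\<And>e j. cmod (mom_x P e (of_nat (j + 1)) / mom_x P e (of_nat j)) \<le> A e * real (j + 1) powr (ord_x P $ e)"
    by metis
  have "(\<Sum>d\<leftarrow>sorted_list_of_set UNIV. ord_x P $ d * real (q $ d)) = lambda_sq P q"
    by (simp add: lambda_sq_def sum_list_distinct_conv_sum_set)
  then obtain C where "coef_controlled \<delta> R 0 (lambda_sq P q) C (moment_deriv_vec (mom_x P) q)"
    using coef_controlled_moment_deriv_list[where m = "mom_x P" and A = A and s = "\<lambda>e. ord_x P $ e"
      and ds = "sorted_list_of_set UNIV" and q = q, OF A(2) s A(1) R, of \<delta>]
    by (auto simp: moment_deriv_vec_def[abs_def])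
  then show ?thesis
    by (intro exI[of _ C]) (auto simp: controlled_def coef_controlled_def majorized_def moment_deriv_coeffs_def)
qed

lemma controlled_nonlinear_factor:
  fixes P :: "('n::{finite,linorder}) cauchy_problem"
  assumes d: "cauchy_data P" and s0P: "ord_t P = s0" and R: "R > 0"
  shows "\<exists>C. controlled \<delta> R i 0 (lambda_sq P q + real i * (ord_t P + \<sigma>)) C (nonlinear_factor P i q)"
proof -
  obtain C1 where C1: "controlled \<delta> R 0 0 (lambda_sq P q) C1 (moment_deriv_coeffs (mom_x P) q)"
    using controlled_moment_deriv_coeffs[OF d R] ..
  have "regular_moment_function s0 (mom_t P)" using d s0P by (auto simp: cauchy_data_def)
  then obtain A where A: "A > 0" "\<And>j. cmod (mom_t P (of_nat (j + 1)) / mom_t P (of_nat j)) \<le> A * real (j + 1) powr s0"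
    using regular_moment_function_bounds by metis
  obtain C2 where "controlled \<delta> R i (lambda_sq P q) (lambda_sq P q + real i * (s0 + \<sigma>)) C2
      (\<lambda>(h :: 'n cvec \<Rightarrow> complex fps) x. (moment_deriv (mom_t P) ^^ i) (h x))"
    using controlled_moment_deriv_power[OF A(2) A(1) less_imp_le[OF R] lambda_sq_nonneg[OF d]] ..
  from controlled_comp[OF C1 this]
  show ?thesis by (auto simp: s0P nonlinear_factor_def[abs_def])
qed

text \<open>The coefficient with index \<open>J\<close> of a term involves \<open>u\<close> only up to index \<open>J + \<kappa> - 1\<close>, because
  derivatives in \<open>t\<close> have order less than \<open>\<kappa>\<close>. The bound \<open>M\<close> for \<open>u\<close> is fixed beforehand since the
  dependence of the constant on it is not linear.\<close>

definition term_bound ::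
    "('n::{finite,linorder}) cauchy_problem \<Rightarrow> 'n index_tuple \<Rightarrow> real \<Rightarrow> real \<Rightarrow> real \<Rightarrow> real \<Rightarrow> real \<Rightarrow> bool" where
  "term_bound P w \<delta> R M C K0 \<longleftrightarrow> 0 \<le> C \<and> (\<forall>K\<ge>K0. \<forall>J u. majorized \<delta> (J + kappa P - 1) (W M K R 0) u \<longrightarrow>
     majorized \<delta> J (W (C * K ^ t_order w) K R (term_order P \<sigma> w)) (nonlinear_term P w u))"

lemma nonlinear_term_majorized:
  fixes P :: "('n::{finite,linorder}) cauchy_problem"
  assumes d: "cauchy_data P" and s0P: "ord_t P = s0" and n: "n \<in> degrees P" "w \<in> Lam P n"
    and r0: "0 < r0" "r0 < rad_t P" "\<And>d. r0 < rad_x P $ d" and \<delta>: "\<delta> \<le> r0" and R: "4 / r0 \<le> R" and M: "M \<ge> 0"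
  shows "\<exists>C K0. term_bound P w \<delta> R M C K0"
proof -
  have "4 / r0 > 0" using r0 by simp
  with R have R0: "R > 0" by linarith
  have w: "i < kappa P" if "(i, q, r) \<in> set w" for i q r
    using d n that unfolding cauchy_data_def by fast
  have hol: "holomorphic_time_vec (coef P w) (ball 0 (rad_t P) \<times> polydisc (rad_x P))" and radt: "rad_t P > 0"
    using d n by (auto simp: cauchy_data_def)
  obtain B where B: "B > 0"
    "\<And>j. \<exists>c. expands r0 (\<lambda>x. fps_nth (fps_expansion (\<lambda>t. coef P w t x) 0) j) c \<and>
         (\<forall>\<alpha>. cmod (c \<alpha>) * r0 ^ degree_of \<alpha> * r0 ^ j \<le> B)"
    using time_coefficients_expand[OF hol radt r0] by blast
  have coefs: "majorized \<delta> J (W B K R 0) (\<lambda>x. fps_expansion (\<lambda>t. coef P w t x) 0)" if K: "K \<ge> 4 / r0" for J K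
    unfolding majorized_def
  proof (intro allI impI)
    fix j
    obtain c where c: "expands r0 (\<lambda>x. fps_nth (fps_expansion (\<lambda>t. coef P w t x) 0) j) c"
       "\<And>\<alpha>. cmod (c \<alpha>) * r0 ^ degree_of \<alpha> * r0 ^ j \<le> B" using B(2)[of j] by blast
    show "coef_bounded \<delta> (W B K R 0 j) (\<lambda>x. fps_nth (fps_expansion (\<lambda>t. coef P w t x) 0) j)"
      unfolding coef_bounded_def
    proof (intro exI conjI allI)
      show "expands \<delta> (\<lambda>x. fps_nth (fps_expansion (\<lambda>t. coef P w t x) 0) j) c"
        by (rule expands_subset[OF c(1) \<delta>])
      fix \<alpha>
      have "cmod (c \<alpha>) \<le> B * (1 / r0) ^ j * (1 / r0) ^ degree_of \<alpha> * 1"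
        using c(2)[of \<alpha>] r0 by (simp add: field_simps)
      also have "\<dots> \<le> B * (1 / r0) ^ j * (1 / r0) ^ degree_of \<alpha> * fact j powr \<sigma>"
        using B r0 \<sigma> by (intro mult_left_mono ge_one_powr_ge_zero) auto
      also have "\<dots> \<le> W B K R 0 j \<alpha>"
        by (rule geometric_le_W) (use B r0 R K in auto)
      finally show "cmod (c \<alpha>) \<le> W B K R 0 j \<alpha>" .
    qed
  qed
  have "\<forall>i q. \<exists>C. controlled \<delta> R i 0 (lambda_sq P q + real i * (ord_t P + \<sigma>)) C (nonlinear_factor P i q)"
    using controlled_nonlinear_factor[OF d s0P R0] by blast
  then obtain C where C: "\<And>i q. controlled \<delta> R i 0 (lambda_sq P q + real i * (ord_t P + \<sigma>)) (C i q) (nonlinear_factor P i q)"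
    by metis
  define D where "D = (\<Sum>p\<in>set w. C (fst p) (fst (snd p)))"
  have C0: "C i q \<ge> 0" for i q using C[of i q] by (simp add: controlled_def)
  have D0: "D \<ge> 0" unfolding D_def using C0 by (intro sum_nonneg) auto
  have CD: "C i q \<le> D" if "(i, q, r) \<in> set w" for i q r
    unfolding D_def using member_le_sum[OF that, of "\<lambda>p. C (fst p) (fst (snd p))"] C0 by auto
  let ?c = "8 ^ (CARD('n) + 1) :: real"
  let ?Pi = "\<Prod>(i, q, r)\<leftarrow>w. ?c * (?c * (D * M)) ^ r"
  have Pi0: "0 \<le> ?Pi" using D0 M by (induction w) auto
  show ?thesis
    unfolding term_bound_def
  proof (rule exI[of _ "?c * B * ?Pi"], rule exI[of _ "4 / r0"], intro conjI allI impI)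
    show "0 \<le> ?c * B * ?Pi" using B Pi0 by simp
    fix K :: real and J and u :: "'n cvec \<Rightarrow> complex fps"
    assume K: "4 / r0 \<le> K" and u: "majorized \<delta> (J + kappa P - 1) (W M K R 0) u"
    have K0: "K \<ge> 0" using K \<open>4 / r0 > 0\<close> by linarith
    have E0: "0 \<le> lambda_sq P q + real i * (ord_t P + \<sigma>)" for i q
      using lambda_sq_nonneg[OF d, of q] s0 \<sigma> by (simp add: s0P)
    have fac: "majorized \<delta> J (W (D * M * K ^ i) K R (lambda_sq P q + real i * (ord_t P + \<sigma>))) (nonlinear_factor P i q u)"
      if p: "(i, q, r) \<in> set w" for i q r
    proof -
      have "majorized \<delta> (J + i) (W M K R 0) u"
        by (rule majorized_mono[OF u]) (use w[OF p] in auto)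
      then have "majorized \<delta> J (W (C i q * M * K ^ i) K R (lambda_sq P q + real i * (ord_t P + \<sigma>))) (nonlinear_factor P i q u)"
        by (rule controlledD[OF C M K0])
      then show ?thesis
        by (rule majorized_mono) (use CD[OF p] M K0 R0 in \<open>auto intro!: W_mono mult_right_mono\<close>)
    qed
    have "majorized \<delta> J (W (?Pi * K ^ t_order w) K R (term_order P \<sigma> w)) (\<lambda>x. \<Prod>(i, q, r)\<leftarrow>w. nonlinear_factor P i q u x ^ r)"
      unfolding t_order_def term_order_def
      by (rule majorized_prod_list[where h = "\<lambda>i q. nonlinear_factor P i q u"]) (use fac E0 D0 M K0 R0 in auto)
    note prod = this
    have T0: "0 \<le> term_order P \<sigma> w"
      unfolding term_order_def
    proof (rule sum_list_nonneg)
      fix y assume "y \<in> set (map (\<lambda>(i, q, r). real r * (lambda_sq P q + real i * (ord_t P + \<sigma>))) w)"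
      then show "0 \<le> y" using E0 by auto
    qed
    have "majorized \<delta> J (W (?c * B * (?Pi * K ^ t_order w)) K R (0 + term_order P \<sigma> w)) (nonlinear_term P w u)"
      unfolding nonlinear_term_def[abs_def]
      by (rule majorized_mult[OF coefs[OF K] prod]) (use B Pi0 K0 R0 T0 in auto)
    then show "majorized \<delta> J (W (?c * B * ?Pi * K ^ t_order w) K R (term_order P \<sigma> w)) (nonlinear_term P w u)"
      by (simp add: mult.assoc)
  qed
qed

lemma factorially_bounded_if_majorized:
  fixes h :: "'n::finite cvec \<Rightarrow> complex fps"
  assumes "\<delta> > 0" "0 \<le> M" "1 \<le> K" "1 \<le> R" "0 \<le> e" "\<And>J. majorized \<delta> J (W M K R e) h"
  shows "factorially_bounded \<sigma> h"
proof -
  obtain M' K' R' where b: "0 \<le> M'" "1 \<le> K'" "1 \<le> R'"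
    "\<And>j (\<alpha> :: 'n multi_index). W M K R e j \<alpha> \<le> M' * K' ^ j * R' ^ degree_of \<alpha> * fact j powr \<sigma>"
    using W_le_geometric[OF assms(2-5)] by blast
  show ?thesis
    by (rule factorially_boundedI[OF assms(1) b(1-3)], rule coef_bounded_mono[OF _ b(4)])
       (use assms(6) in \<open>auto simp: majorized_def\<close>)
qed

lemma majorized_if_coef_bounded:
  assumes "\<And>j. coef_bounded \<delta> (\<lambda>\<alpha>. M * k ^ j * \<rho> ^ degree_of \<alpha> * fact j powr \<sigma>) (\<lambda>x. fps_nth (h x) j)"
    and "0 \<le> k" "0 \<le> \<rho>" "4 * k \<le> K" "4 * \<rho> \<le> R" "0 \<le> M" "\<delta>' \<le> \<delta>"
  shows "majorized \<delta>' J (W M K R 0) h"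
  unfolding majorized_def
  by (intro allI impI coef_bounded_mono[OF coef_bounded_subset[OF assms(1,7)]] geometric_le_W assms)

text \<open>When \<open>f\<close> is computed from \<open>u\<close>, losses such as \<open>(j + n + 1)\<^sup>E\<close> are absorbed by the geometric
  factors.\<close>

theorem inhom_bounded_if_solution_bounded:
  fixes P :: "('n::{finite,linorder}) cauchy_problem"
  assumes d: "cauchy_data P" and s0P: "ord_t P = s0"
    and u: "formal_solution P u" and fb: "factorially_bounded \<sigma> u"
  shows "factorially_bounded \<sigma> (inhom P)"
proof -
  obtain \<delta>1 M k \<rho> where a: "\<delta>1 > 0" "M \<ge> 0" "k \<ge> 1" "\<rho> \<ge> 1"
    "\<And>j. coef_bounded \<delta>1 (\<lambda>\<alpha>. M * k ^ j * \<rho> ^ degree_of \<alpha> * fact j powr \<sigma>) (\<lambda>x. fps_nth (u x) j)"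
    using fb unfolding factorially_bounded_def by blast
  have rad: "\<And>d. 0 < rad_x P $ d" "0 < rad_t P" using d by (auto simp: cauchy_data_def)
  obtain r1 where r1: "r1 > 0" "\<And>d. r1 < rad_x P $ d" using positive_vec_min[OF rad(1)] by blast
  define r0 where "r0 = min r1 (rad_t P / 2)"
  have r0: "0 < r0" "r0 < rad_t P" "\<And>d. r0 < rad_x P $ d"
    using r1 rad by (auto simp: r0_def min_less_iff_disj)
  define \<delta> where "\<delta> = min r0 \<delta>1"
  have \<delta>: "\<delta> > 0" "\<delta> \<le> r0" "\<delta> \<le> \<delta>1" using r0 a by (auto simp: \<delta>_def)
  define R where "R = max (4 / r0) (4 * \<rho>)"
  have R: "4 / r0 \<le> R" "4 * \<rho> \<le> R" "1 \<le> R" using a by (auto simp: R_def)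
  have maj: "majorized \<delta> J (W M K R 0) u" if "4 * k \<le> K" for K J
    by (rule majorized_if_coef_bounded[OF a(5)]) (use a R \<delta> that in auto)
  have tm: "factorially_bounded \<sigma> (\<lambda>x. fps_X ^ t_exp P w * nonlinear_term P w u x)"
    if w: "n \<in> degrees P" "w \<in> Lam P n" for n w
  proof -
    obtain C K0 where C: "term_bound P w \<delta> R M C K0"
      using nonlinear_term_majorized[OF d s0P w r0 \<delta>(2) R(1) a(2)] by blast
    let ?K = "max K0 (4 * k)"
    have K: "?K \<ge> 1" "4 * k \<le> ?K" "K0 \<le> ?K" using a by auto
    have "factorially_bounded \<sigma> (nonlinear_term P w u)"
    proof (rule factorially_bounded_if_majorized[OF \<delta>(1) _ K(1) R(3)])
      show "0 \<le> C * ?K ^ t_order w" using C K by (simp add: term_bound_def)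
      show "0 \<le> term_order P \<sigma> w"
        unfolding term_order_def
      proof (rule sum_list_nonneg)
        fix y assume "y \<in> set (map (\<lambda>(i, q, r). real r * (lambda_sq P q + real i * (ord_t P + \<sigma>))) w)"
        then show "0 \<le> y" using lambda_sq_nonneg[OF d] s0 \<sigma> by (auto simp: s0P)
      qed
      show "majorized \<delta> J (W (C * ?K ^ t_order w) ?K R (term_order P \<sigma> w)) (nonlinear_term P w u)" for J
        using C K(3) maj[OF K(2)] unfolding term_bound_def by blast
    qed
    then show ?thesis by (rule factorially_bounded_X_power[OF _ \<sigma>])
  qed
  have "regular_moment_function s0 (mom_t P)" using d s0P by (auto simp: cauchy_data_def)
  then obtain A where A: "A > 0" "\<And>j. cmod (mom_t P (of_nat (j + 1)) / mom_t P (of_nat j)) \<le> A * real (j + 1) powr s0"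
    using regular_moment_function_bounds by metis
  have R0: "0 \<le> R" using R by simp
  obtain C where C: "controlled \<delta> R (kappa P) 0 (0 + real (kappa P) * (s0 + \<sigma>)) C
      (\<lambda>(h :: 'n cvec \<Rightarrow> complex fps) x. (moment_deriv (mom_t P) ^^ kappa P) (h x))"
    using controlled_moment_deriv_power[OF A(2) A(1) R0 order_refl] ..
  have dt: "factorially_bounded \<sigma> (\<lambda>x. (moment_deriv (mom_t P) ^^ kappa P) (u x))"
  proof (rule factorially_bounded_if_majorized[OF \<delta>(1) _ _ R(3)])
    show "0 \<le> C * M * (4 * k) ^ kappa P" "1 \<le> 4 * k" "0 \<le> 0 + real (kappa P) * (s0 + \<sigma>)"
      using C a s0 \<sigma> by (auto simp: controlled_def)
    show "majorized \<delta> J (W (C * M * (4 * k) ^ kappa P) (4 * k) R (0 + real (kappa P) * (s0 + \<sigma>)))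
        (\<lambda>x. (moment_deriv (mom_t P) ^^ kappa P) (u x))" for J
      by (rule controlledD[OF C]) (use maj a in auto)
  qed
  have "factorially_bounded \<sigma> (\<lambda>x. (moment_deriv (mom_t P) ^^ kappa P) (u x) +
     - (\<Sum>n\<in>degrees P. \<Sum>w\<in>Lam P n. fps_X ^ t_exp P w * nonlinear_term P w u x))"
    by (intro factorially_bounded_add dt factorially_bounded_uminus factorially_bounded_sum tm)
  then show ?thesis
    by (rule factorially_bounded_cong[OF _ rad(1)]) (simp add: formal_solutionD[OF u])
qed

text \<open>The order of the choices matters. The radius \<open>R\<close> depends on the data only; \<open>M\<close> is then taken from
  the first \<open>\<kappa>\<close> coefficients of \<open>u\<close>; this fixes the constants \<open>C\<close> of the terms; finally \<open>K\<close> is taken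
  so large that the sum \<open>Q\<close> of all contributions to one step, divided by \<open>K\<close>, is at most \<open>1\<close> after
  solving for the highest coefficient.\<close>

theorem solution_bounded_if_inhom_bounded:
  fixes P :: "('n::{finite,linorder}) cauchy_problem"
  assumes d: "cauchy_data P" "order_condition P" and s0P: "ord_t P = s0"
    and u: "formal_solution P u" and fb: "factorially_bounded \<sigma> (inhom P)"
    and crit: "critical_value P \<le> \<sigma>"
  shows "factorially_bounded \<sigma> u"
proof -
  obtain \<delta>1 Mf k \<rho> where a: "\<delta>1 > 0" "Mf \<ge> 0" "k \<ge> 1" "\<rho> \<ge> 1"
    "\<And>j. coef_bounded \<delta>1 (\<lambda>\<alpha>. Mf * k ^ j * \<rho> ^ degree_of \<alpha> * fact j powr \<sigma>) (\<lambda>x. fps_nth (inhom P x) j)"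
    using fb unfolding factorially_bounded_def by blast
  have rad: "\<And>d. 0 < rad_x P $ d" "0 < rad_t P" and \<kappa>: "kappa P \<ge> 1"
    using d by (auto simp: cauchy_data_def)
  obtain r1 where r1: "r1 > 0" "\<And>d. r1 < rad_x P $ d" using positive_vec_min[OF rad(1)] by blast
  define r0 where "r0 = min r1 (rad_t P / 2)"
  have r0: "0 < r0" "r0 < rad_t P" "\<And>d. r0 < rad_x P $ d"
    using r1 rad by (auto simp: r0_def min_less_iff_disj)
  define \<delta> where "\<delta> = min r0 \<delta>1"
  have \<delta>: "\<delta> > 0" "\<delta> \<le> r0" "\<delta> \<le> \<delta>1" using r0 a by (auto simp: \<delta>_def)
  define R where "R = max (4 / r0) (4 * \<rho>)"
  have R: "4 / r0 \<le> R" "4 * \<rho> \<le> R" "1 \<le> R" using a by (auto simp: R_def)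
  have sub: "cube \<delta> \<subseteq> polydisc (rad_x P)"
    by (rule cube_subset_polydisc) (use \<delta> r0 in \<open>meson less_imp_le order_trans\<close>)

  have hol: "holomorphic_vec (\<lambda>x. fps_nth (u x) j) (polydisc (rad_x P))" for j
    using u by (auto simp: formal_solution_def holomorphic_fps_def)
  have "\<exists>B>0. \<forall>x\<in>cube r0. cmod (fps_nth (u x) j) \<le> B" for j
    using holomorphic_vec_bounded[OF hol r0(3)] by metis
  then obtain B where B: "\<And>j. B j > 0" "\<And>j x. x \<in> cube r0 \<Longrightarrow> cmod (fps_nth (u x) j) \<le> B j"
    by metis
  define M where "M = 1 + (\<Sum>j<kappa P. B j)"
  have "0 \<le> (\<Sum>j<kappa P. B j)" by (intro sum_nonneg less_imp_le B(1))
  then have M1: "M \<ge> 1" by (simp add: M_def)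
  have BM: "B j \<le> M" if "j < kappa P" for j
    using member_le_sum[of j "{..<kappa P}" B] that B(1) by (auto simp: M_def less_imp_le intro: order_trans)
  \<comment> \<open>the coefficients \<open>u\<^sub>j\<close> with \<open>j < \<kappa>\<close>\<close>
  have init: "coef_bounded \<delta> (W M K R 0 j) (\<lambda>x. fps_nth (u x) j)" if j: "j < kappa P" and K: "K \<ge> 4" for j K
  proof -
    obtain c where c: "expands r0 (\<lambda>x. fps_nth (u x) j) c" "\<And>\<alpha>. cmod (c \<alpha>) * r0 ^ degree_of \<alpha> \<le> B j"
      using holomorphic_vec_expands[OF hol r0(1) less_imp_le[OF r0(3)] B(2)] by blast
    show ?thesis
      unfolding coef_bounded_def
    proof (intro exI conjI allI)
      show "expands \<delta> (\<lambda>x. fps_nth (u x) j) c" by (rule expands_subset[OF c(1) \<delta>(2)])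
      fix \<alpha>
      have "cmod (c \<alpha>) \<le> B j * 1 ^ j * (1 / r0) ^ degree_of \<alpha> * 1"
        using c(2)[of \<alpha>] r0 by (simp add: field_simps)
      also have "\<dots> \<le> M * 1 ^ j * (1 / r0) ^ degree_of \<alpha> * fact j powr \<sigma>"
        using B(1)[of j] r0 \<sigma> BM[OF j] M1 by (intro mult_mono ge_one_powr_ge_zero) auto
      also have "\<dots> \<le> W M K R 0 j \<alpha>"
        by (rule geometric_le_W) (use r0 R K M1 in auto)
      finally show "cmod (c \<alpha>) \<le> W M K R 0 j \<alpha>" .
    qed
  qed

  have reg: "regular_moment_function s0 (mom_t P)" using d s0P by (auto simp: cauchy_data_def)
  obtain aa where aa: "aa > 0" "\<And>j. mom_t P (of_nat j) \<noteq> 0"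
    "\<And>j. aa * real (j + 1) powr s0 \<le> cmod (mom_t P (of_nat (j + 1)) / mom_t P (of_nat j))"
    using regular_moment_function_bounds[OF reg] by metis

  define T where "T = Sigma (degrees P) (Lam P)"
  have finT: "finite T" using d(1) by (auto simp: T_def cauchy_data_def)
  have "\<forall>p\<in>T. \<exists>C K0. term_bound P (snd p) \<delta> R M C K0"
  proof
    fix p assume "p \<in> T"
    then have p: "fst p \<in> degrees P" "snd p \<in> Lam P (fst p)" by (auto simp: T_def)
    show "\<exists>C K0. term_bound P (snd p) \<delta> R M C K0"
      using nonlinear_term_majorized[OF d(1) s0P p r0 \<delta>(2) R(1), of M] M1 by auto
  qed
  then obtain C K0 where CK: "\<And>p. p \<in> T \<Longrightarrow> term_bound P (snd p) \<delta> R M (C p) (K0 p)"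
    by metis
  have C0: "0 \<le> C p" if "p \<in> T" for p using CK[OF that] by (simp add: term_bound_def)
  define Q where "Q = Mf * real (0 + kappa P + 1) ^ 2 + (\<Sum>p\<in>T. C p * real (t_exp P (snd p) + kappa P + 1) ^ 2)"
  define K where "K = 4 + 4 * k + Q / aa ^ kappa P + (\<Sum>p\<in>T. \<bar>K0 p\<bar>)"
  have Q0: "Q \<ge> 0" unfolding Q_def using a C0 by (intro add_nonneg_nonneg sum_nonneg) auto
  have K0s: "0 \<le> (\<Sum>p\<in>T. \<bar>K0 p\<bar>)" by (intro sum_nonneg) auto
  have Qa: "0 \<le> Q / aa ^ kappa P" using Q0 aa by simp
  have K: "K \<ge> 4" "4 * k \<le> K" "Q / aa ^ kappa P \<le> K" "K \<ge> 1"
    using K0s Qa a unfolding K_def by linarith+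
  have KK: "K0 p \<le> K" if "p \<in> T" for p
  proof -
    have "\<bar>K0 p\<bar> \<le> (\<Sum>p\<in>T. \<bar>K0 p\<bar>)" using member_le_sum[OF that, of "\<lambda>p. \<bar>K0 p\<bar>"] finT by auto
    then show ?thesis using Qa a unfolding K_def by linarith
  qed

  \<comment> \<open>the induction step: the coefficient with index \<open>J + \<kappa>\<close> from the preceding ones\<close>
  have step: "coef_bounded \<delta> (W M K R 0 (J + kappa P)) (\<lambda>x. fps_nth (u x) (J + kappa P))"
    if maj: "majorized \<delta> (J + kappa P - 1) (W M K R 0) u" for J
  proof -
    let ?\<kappa> = "kappa P"
    let ?\<rho> = "(fact (J + ?\<kappa>) / fact J) powr s0 :: real"
    let ?w = "\<lambda>\<alpha>. W 1 K R 0 (J + ?\<kappa>) \<alpha>"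
    let ?m = "mom_t P (of_nat (J + ?\<kappa>)) / mom_t P (of_nat J)"
    have R0: "0 \<le> R" using R by simp
    have w0: "0 \<le> ?w \<alpha>" for \<alpha> :: "'n multi_index" by (rule W_nonneg) (use K R in auto)
    have f: "coef_bounded \<delta> (\<lambda>\<alpha>. ?\<rho> * (Mf * real (0 + ?\<kappa> + 1) ^ 2 / K * ?w \<alpha>)) (\<lambda>x. fps_nth (inhom P x) J)"
    proof (rule coef_bounded_mono)
      have "majorized \<delta> J (W Mf K R 0) (inhom P)"
        by (rule majorized_if_coef_bounded[OF a(5)]) (use a R \<delta> K in auto)
      then show "coef_bounded \<delta> (W Mf K R 0 J) (\<lambda>x. fps_nth (inhom P x) J)" by (simp add: majorized_def)
      show "W Mf K R 0 J \<alpha> \<le> ?\<rho> * (Mf * real (0 + ?\<kappa> + 1) ^ 2 / K * ?w \<alpha>)" for \<alpha> :: "'n multi_index"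
        using W_step[of 0 ?\<kappa> 0 0 K R Mf J \<alpha>] s0 \<sigma> \<kappa> K R a by simp
    qed
    have t: "coef_bounded \<delta> (\<lambda>\<alpha>. ?\<rho> * (C p * real (t_exp P (snd p) + ?\<kappa> + 1) ^ 2 / K * ?w \<alpha>))
        (\<lambda>x. fps_nth (fps_X ^ t_exp P (snd p) * nonlinear_term P (snd p) u x) J)" if p: "p \<in> T" for p
    proof (cases "J < t_exp P (snd p)")
      case True
      show ?thesis using True w0 K C0[OF p] by (auto simp: fps_X_power_mult_nth intro!: coef_bounded_0)
    next
      case False
      let ?v = "t_exp P (snd p)" and ?o = "t_order (snd p)" and ?E = "term_order P \<sigma> (snd p)"
      have pw: "fst p \<in> degrees P" "snd p \<in> Lam P (fst p)" using p by (auto simp: T_def)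
      have "majorized \<delta> J (W (C p * K ^ ?o) K R ?E) (nonlinear_term P (snd p) u)"
        using CK[OF p] KK[OF p] maj unfolding term_bound_def by blast
      then have "coef_bounded \<delta> (W (C p * K ^ ?o) K R ?E (J - ?v)) (\<lambda>x. fps_nth (nonlinear_term P (snd p) u x) (J - ?v))"
        by (simp add: majorized_def)
      then have "coef_bounded \<delta> (\<lambda>\<alpha>. ?\<rho> * (C p * real (?v + ?\<kappa> + 1) ^ 2 / K * ?w \<alpha>))
          (\<lambda>x. fps_nth (nonlinear_term P (snd p) u x) (J - ?v))"
      proof (rule coef_bounded_mono)
        fix \<alpha> :: "'n multi_index"
        have E: "?E \<le> (s0 + \<sigma>) * real ?\<kappa> + \<sigma> * real ?v"
          using term_order_le[OF d crit \<sigma> pw] by (simp add: s0P)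
        have o: "?o < ?v + ?\<kappa>" by (rule t_order_less[OF d(2) pw])
        from W_step[OF E o K(4) R0 C0[OF p], of "J - ?v" \<alpha>] False
        show "W (C p * K ^ ?o) K R ?E (J - ?v) \<alpha> \<le> ?\<rho> * (C p * real (?v + ?\<kappa> + 1) ^ 2 / K * ?w \<alpha>)"
          by simp
      qed
      then show ?thesis using False by (simp add: fps_X_power_mult_nth)
    qed
    have "coef_bounded \<delta> (\<lambda>\<alpha>. cmod (1 / ?m) * (?\<rho> * (Mf * real (0 + ?\<kappa> + 1) ^ 2 / K * ?w \<alpha>) +
             (\<Sum>p\<in>T. ?\<rho> * (C p * real (t_exp P (snd p) + ?\<kappa> + 1) ^ 2 / K * ?w \<alpha>))))
          (\<lambda>x. 1 / ?m * (fps_nth (inhom P x) J +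
             (\<Sum>p\<in>T. fps_nth (fps_X ^ t_exp P (snd p) * nonlinear_term P (snd p) u x) J)))"
      by (intro coef_bounded_cmult coef_bounded_add coef_bounded_sum f t)
    then have "coef_bounded \<delta> (W M K R 0 (J + ?\<kappa>)) (\<lambda>x. 1 / ?m * (fps_nth (inhom P x) J +
             (\<Sum>p\<in>T. fps_nth (fps_X ^ t_exp P (snd p) * nonlinear_term P (snd p) u x) J)))"
    proof (rule coef_bounded_mono)
      fix \<alpha> :: "'n multi_index"
      have \<rho>: "?\<rho> > 0" by simp
      have mpos: "aa ^ ?\<kappa> * ?\<rho> \<le> cmod ?m" by (rule moment_ratio_lower[OF aa])
      have am: "0 < aa ^ ?\<kappa> * ?\<rho>" using aa by simp
      have "?\<rho> * (Mf * real (0 + ?\<kappa> + 1) ^ 2 / K * ?w \<alpha>) +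
             (\<Sum>p\<in>T. ?\<rho> * (C p * real (t_exp P (snd p) + ?\<kappa> + 1) ^ 2 / K * ?w \<alpha>)) = ?\<rho> * (Q / K * ?w \<alpha>)"
        unfolding Q_def sum_distrib_left[symmetric] sum_distrib_right[symmetric] sum_divide_distrib[symmetric]
        by (simp only: distrib_left distrib_right add_divide_distrib)
      moreover have "cmod (1 / ?m) * (?\<rho> * (Q / K * ?w \<alpha>)) \<le> 1 / (aa ^ ?\<kappa> * ?\<rho>) * (?\<rho> * (Q / K * ?w \<alpha>))"
      proof (intro mult_right_mono)
        show "cmod (1 / ?m) \<le> 1 / (aa ^ ?\<kappa> * ?\<rho>)"
          unfolding norm_divide[of 1] norm_one
          by (rule divide_left_mono[OF mpos zero_le_one mult_pos_pos[OF less_le_trans[OF am mpos] am]])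
      qed (use Q0 K w0[of \<alpha>] in auto)
      moreover have "1 / (aa ^ ?\<kappa> * ?\<rho>) * (?\<rho> * (Q / K * ?w \<alpha>)) = (Q / aa ^ ?\<kappa>) / K * ?w \<alpha>"
        using \<rho> by simp
      moreover have "(Q / aa ^ ?\<kappa>) / K * ?w \<alpha> \<le> M * ?w \<alpha>"
      proof (intro mult_right_mono w0)
        have "(Q / aa ^ ?\<kappa>) / K \<le> 1" using K by (subst pos_divide_le_eq) auto
        then show "(Q / aa ^ ?\<kappa>) / K \<le> M" using M1 by linarith
      qed
      ultimately show "cmod (1 / ?m) * (?\<rho> * (Mf * real (0 + ?\<kappa> + 1) ^ 2 / K * ?w \<alpha>) +
             (\<Sum>p\<in>T. ?\<rho> * (C p * real (t_exp P (snd p) + ?\<kappa> + 1) ^ 2 / K * ?w \<alpha>))) \<le> W M K R 0 (J + ?\<kappa>) \<alpha>"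
        using W_scale[of M 1 K R 0 "J + ?\<kappa>" \<alpha>] by simp
    qed
    then show ?thesis
    proof (rule coef_bounded_cong)
      fix x :: "'n cvec" assume "x \<in> cube \<delta>"
      then have x: "x \<in> polydisc (rad_x P)" using sub by blast
      have "?m * fps_nth (u x) (J + ?\<kappa>) = fps_nth ((moment_deriv (mom_t P) ^^ ?\<kappa>) (u x)) J"
        by (rule moment_deriv_power_nth[where m = "mom_t P", OF aa(2), symmetric])
      also have "\<dots> = fps_nth (inhom P x) J +
          (\<Sum>p\<in>T. fps_nth (fps_X ^ t_exp P (snd p) * nonlinear_term P (snd p) u x) J)"
      proof -
        have "finite (degrees P)" "\<forall>n\<in>degrees P. finite (Lam P n)" using d(1) by (auto simp: cauchy_data_def)
        then show ?thesis
          by (simp only: formal_solutionD[OF u x] T_def fps_add_nth fps_sum_nth sum.Sigma case_prod_unfold)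
      qed
      finally have "?m * fps_nth (u x) (J + ?\<kappa>) = fps_nth (inhom P x) J +
          (\<Sum>p\<in>T. fps_nth (fps_X ^ t_exp P (snd p) * nonlinear_term P (snd p) u x) J)" .
      moreover have "?m \<noteq> 0" using aa(2)[of "J + ?\<kappa>"] aa(2)[of J] by simp
      ultimately show "1 / ?m * (fps_nth (inhom P x) J +
             (\<Sum>p\<in>T. fps_nth (fps_X ^ t_exp P (snd p) * nonlinear_term P (snd p) u x) J)) = fps_nth (u x) (J + ?\<kappa>)"
        by (metis (no_types, lifting) nonzero_mult_div_cancel_left times_divide_eq_left mult_1)
    qed
  qed
  have all: "majorized \<delta> (J + kappa P - 1) (W M K R 0) u" for J
  proof (induction J)
    case 0
    show ?case unfolding majorized_def using init K \<kappa> by auto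
  next
    case (Suc J)
    show ?case
      unfolding majorized_def
    proof (intro allI impI)
      fix j assume j: "j \<le> Suc J + kappa P - 1"
      show "coef_bounded \<delta> (W M K R 0 j) (\<lambda>x. fps_nth (u x) j)"
      proof (cases "j = J + kappa P")
        case True
        then show ?thesis using step[OF Suc] by simp
      next
        case False
        then have "j \<le> J + kappa P - 1" using j \<kappa> by linarith
        then show ?thesis using Suc by (simp add: majorized_def)
      qed
    qed
  qed
  show ?thesis
  proof (rule factorially_bounded_if_majorized[OF \<delta>(1) _ K(4) R(3)])
    show "majorized \<delta> J (W M K R 0) u" for J
      by (rule majorized_mono[OF all[of J]]) (use \<kappa> in auto)
  qed (use M1 in auto)
qed

end

theorem solution_gevrey_iff:
  fixes P :: "('n::{finite,linorder}) cauchy_problem"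
  assumes d: "cauchy_data P" "order_condition P" and u: "formal_solution P u"
    and crit: "critical_value P \<le> \<sigma>" and \<sigma>: "0 \<le> \<sigma>"
  shows "gevrey (rad_x P) \<sigma> u \<longleftrightarrow> gevrey (rad_x P) \<sigma> (inhom P)"
proof -
  have s0: "ord_t P > 0" and rad: "\<And>d. 0 < rad_x P $ d" and hf: "holomorphic_fps (rad_x P) (inhom P)"
    using d by (auto simp: cauchy_data_def)
  have hu: "holomorphic_fps (rad_x P) u" using u by (auto simp: formal_solution_def)
  obtain \<beta> L where "gevrey_weight (ord_t P) \<sigma> \<beta> L" using gevrey_weight_exists[OF s0 \<sigma>] .
  then interpret gevrey_weight "ord_t P" \<sigma> \<beta> L .
  show ?thesis
    using inhom_bounded_if_solution_bounded[OF d(1) refl u]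
      solution_bounded_if_inhom_bounded[OF d refl u _ crit]
      gevrey_imp_factorially_bounded[OF _ hu \<sigma>] gevrey_imp_factorially_bounded[OF _ hf \<sigma>]
      factorially_bounded_imp_gevrey[OF _ rad \<sigma>] by blast
qed

section \<open>Factorial moments\<close>

text \<open>The pair \<open>t exp (- t)\<close>, \<open>exp t\<close> is the classical kernel pair of order \<open>1\<close>, with moments
  \<open>m(\<lambda>) = Gamma (1 + \<lambda>)\<close>.\<close>

definition factorial_kernel :: "complex \<Rightarrow> complex" where
  "factorial_kernel t = t * exp (- t)"

abbreviation factorial_moment :: "complex \<Rightarrow> complex" where
  "factorial_moment \<equiv> moment_integral factorial_kernel"

lemma factorial_kernel_of_real: "factorial_kernel (of_real t) = of_real (t * exp (- t))"
  by (simp add: factorial_kernel_def flip: exp_of_real)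

lemma factorial_moment_of_nat: "factorial_moment (of_nat j) = fact j"
proof -
  let ?f = "\<lambda>t. indicator {0<..} t * (t ^ j / exp t) :: real"
  have eq: "indicator {0<..} t *\<^sub>R (of_real t powr (of_nat j - 1) * factorial_kernel (of_real t)) = complex_of_real (?f t)" for t :: real
  proof (cases "t > 0")
    case True
    have "complex_of_real t powr (of_nat j - 1) = of_real (t powr (real j - 1))"
      using powr_of_real[of t "real j - 1"] True by simp
    moreover have "t powr (real j - 1) * t = t ^ j"
      using True by (simp add: powr_diff powr_realpow)
    then have "complex_of_real (t powr (real j - 1)) * of_real t = of_real t ^ j"
      by (metis of_real_mult of_real_power)
    ultimately show ?thesis
      using True by (simp add: factorial_kernel_of_real exp_minus divide_inverse flip: mult.assoc)
  qed simp
  have nn: "(\<integral>\<^sup>+t. ennreal (?f t) \<partial>lborel) = ennreal (fact j)"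
  proof -
    have "(\<integral>\<^sup>+t. ennreal (?f t) \<partial>lborel) = (\<integral>\<^sup>+t. ennreal (indicator {0..} t * t powr (real j + 1 - 1) / exp t) \<partial>lborel)"
    proof (rule nn_integral_cong_AE)
      have "AE t in lborel. t \<noteq> (0::real)" by (rule AE_lborel_singleton)
      then show "AE t in lborel. ennreal (?f t) = ennreal (indicator {0..} t * t powr (real j + 1 - 1) / exp t)"
        by eventually_elim (auto simp: indicator_def powr_realpow)
    qed
    also have "\<dots> = ennreal (Gamma (real j + 1))"
      by (rule Gamma_conv_nn_integral_real[symmetric]) simp
    also have "Gamma (real j + 1) = fact j" using Gamma_fact[of j, where 'a = real] by (simp add: add.commute)
    finally show ?thesis .
  qed
  have "factorial_moment (of_nat j) = (LINT t|lborel. complex_of_real (?f t))"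
    unfolding moment_integral_def set_lebesgue_integral_def eq ..
  also have "\<dots> = of_real (LINT t|lborel. ?f t)" by (rule integral_complex_of_real)
  also have "(LINT t|lborel. ?f t) = enn2real (\<integral>\<^sup>+t. ennreal (?f t) \<partial>lborel)"
    by (rule integral_eq_nn_integral) (auto simp: indicator_def)
  also have "\<dots> = fact j" by (subst nn) simp
  finally show ?thesis by simp
qed

lemma set_integrable_bounded_continuous:
  fixes g :: "real \<Rightarrow> complex"
  assumes "continuous_on {0<..<\<delta>} g" "\<And>r. r \<in> {0<..<\<delta>} \<Longrightarrow> cmod (g r) \<le> B"
  shows "set_integrable lborel {0<..<\<delta>} g"
  unfolding set_integrable_def
proof (rule integrableI_bounded_set[where A = "{0<..<\<delta>}" and B = B])
  show "(\<lambda>x. indicator {0<..<\<delta>} x *\<^sub>R g x) \<in> borel_measurable lborel"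
    using borel_measurable_continuous_on_indicator[OF _ assms(1)] by simp
  show "emeasure lborel {0<..<\<delta>} < \<infinity>" by (cases "0 \<le> \<delta>") auto
qed (use assms(2) in auto)

text \<open>In the sector of opening \<open>\<pi> - \<epsilon>\<close> the real part of \<open>x\<close> is at least \<open>c |x|\<close> with
  \<open>c = cos ((\<pi> - \<epsilon>) / 2) > 0\<close>; half of the decay \<open>exp (- c |x|)\<close> absorbs the factor \<open>x\<close>. On the
  rays in the left half plane the same device makes \<open>exp (1 / t) / t\<close> bounded near \<open>0\<close>.\<close>

lemma factorial_kernel_pair: "kernel_pair 1 factorial_kernel exp"
  unfolding kernel_pair_def
proof (intro conjI allI impI)
  show "factorial_kernel holomorphic_on sector 0 (pi * 1)"
    unfolding factorial_kernel_def by (intro holomorphic_intros)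
  fix t :: real assume t: "t > 0"
  show "factorial_kernel (of_real t) \<in> \<real>" "0 < Re (factorial_kernel (of_real t))"
    unfolding factorial_kernel_of_real using t by auto
next
  show "integrable_at_zero_along 0 (\<lambda>t. factorial_kernel t / t)"
    unfolding integrable_at_zero_along_def
  proof (intro exI[of _ 1] conjI set_integrable_bounded_continuous)
    show "continuous_on {0<..<1} (\<lambda>r. factorial_kernel (complex_of_real r * cis 0) / (complex_of_real r * cis 0))"
      unfolding factorial_kernel_def by (intro continuous_intros) auto
    fix r :: real assume "r \<in> {0<..<1}"
    then show "cmod (factorial_kernel (complex_of_real r * cis 0) / (complex_of_real r * cis 0)) \<le> 1"
      by (simp add: factorial_kernel_def)
  qed simp
next
  fix \<epsilon> :: real assume \<epsilon>: "\<epsilon> > 0"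
  show "\<exists>A>0. \<exists>B>0. \<forall>x\<in>sector 0 (pi * 1 - \<epsilon>). cmod (factorial_kernel x) \<le> A * exp (- ((cmod x / B) powr (1 / 1)))"
  proof (cases "\<epsilon> < pi")
    case False
    then have "sector 0 (pi * 1 - \<epsilon>) = {}" by (auto simp: sector_def)
    then show ?thesis by (intro exI[of _ 1] conjI) auto
  next
    case True
    define c where "c = cos ((pi - \<epsilon>) / 2)"
    have c: "c > 0" unfolding c_def using True \<epsilon> by (intro cos_gt_zero) auto
    show ?thesis
    proof (intro exI[of _ "2 / c"] conjI ballI)
      fix x assume "x \<in> sector 0 (pi * 1 - \<epsilon>)"
      then obtain \<theta> where x: "x \<noteq> 0" "x = of_real (cmod x) * cis \<theta>" "\<bar>\<theta>\<bar> < (pi - \<epsilon>) / 2"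
        by (auto simp: sector_def)
      have "c \<le> cos \<bar>\<theta>\<bar>" unfolding c_def using x True \<epsilon> by (intro cos_monotone_0_pi_le) auto
      then have "cmod x * c \<le> cmod x * cos \<theta>" by (intro mult_left_mono) auto
      also have "cmod x * cos \<theta> = Re x" by (subst (2) x(2)) simp
      finally have re: "c * cmod x \<le> Re x" by (simp add: mult.commute)
      have "cmod x * c / 2 \<le> exp (cmod x * c / 2)" using exp_ge_add_one_self[of "cmod x * c / 2"] by linarith
      then have "cmod x \<le> 2 / c * exp (cmod x * c / 2)" using c by (simp add: field_simps)
      then have "cmod x * exp (- Re x) \<le> (2 / c * exp (cmod x * c / 2)) * exp (- (c * cmod x))"
        using re c by (intro mult_mono) auto
      also have "\<dots> = 2 / c * exp (- (cmod x / (2 / c)))" by (simp add: mult_exp_exp field_simps)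
      finally show "cmod (factorial_kernel x) \<le> 2 / c * exp (- ((cmod x / (2 / c)) powr (1 / 1)))"
        using c by (simp add: factorial_kernel_def norm_mult)
    qed (use c in auto)
  qed
next
  show "(exp :: complex \<Rightarrow> complex) holomorphic_on UNIV" by (intro holomorphic_intros)
  show "\<exists>A>0. \<exists>B>0. \<forall>x. cmod (exp x) \<le> A * exp ((cmod x / B) powr (1 / 1))"
    by (intro exI[of _ 1] conjI) (auto simp: complex_Re_le_cmod)
next
  fix \<theta> :: real assume "\<bar>\<theta> - pi\<bar> < pi * (2 - 1) / 2"
  then have "- (pi / 2) < \<theta> - pi" "\<theta> - pi < pi / 2" by (simp_all add: abs_if split: if_splits)
  then have "cos (\<theta> - pi) > 0" by (rule cos_gt_zero_pi)
  then have k: "- cos \<theta> > 0" by (simp add: cos_diff)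
  show "integrable_at_zero_along \<theta> (\<lambda>t. exp (1 / t) / t)"
    unfolding integrable_at_zero_along_def
  proof (intro exI[of _ 1] conjI set_integrable_bounded_continuous)
    show "continuous_on {0<..<1} (\<lambda>r. exp (1 / (complex_of_real r * cis \<theta>)) / (complex_of_real r * cis \<theta>))"
      by (intro continuous_intros) auto
    fix r :: real assume r: "r \<in> {0<..<1}"
    have "1 / (complex_of_real r * cis \<theta>) = of_real (1 / r) * cis (- \<theta>)"
      by (simp add: divide_inverse)
    then have re: "Re (1 / (complex_of_real r * cis \<theta>)) = - (- cos \<theta> / r)" by simp
    have "- cos \<theta> / r \<le> exp (- cos \<theta> / r)" using exp_ge_add_one_self[of "- cos \<theta> / r"] by linarith
    then have "exp (- (- cos \<theta> / r)) / r \<le> 1 / - cos \<theta>"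
      using k r by (simp only: exp_minus) (simp add: field_simps)
    then show "cmod (exp (1 / (complex_of_real r * cis \<theta>)) / (complex_of_real r * cis \<theta>)) \<le> 1 / - cos \<theta>"
      unfolding norm_divide norm_exp_eq_Re re using r by (simp add: norm_mult)
  qed simp
next
  fix t :: complex
  show "(\<lambda>j. t ^ j / factorial_moment (of_nat j)) sums exp t"
    using exp_converges[of t] by (simp add: factorial_moment_of_nat scaleR_conv_of_real divide_inverse mult.commute)
qed auto

lemma factorial_moment_regular: "regular_moment_function 1 factorial_moment"
proof -
  have "factorial_moment 0 = 1" using factorial_moment_of_nat[of 0] by simp
  moreover have "(\<lambda>t. factorial_kernel (t powr (1 / of_nat 1)) / of_nat 1) = factorial_kernel"
    by (rule ext) (simp add: factorial_kernel_def powr_def)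
  ultimately have "moment_function 1 factorial_moment"
    unfolding moment_function_def using factorial_kernel_pair
    by (intro conjI exI[of _ 1] exI[of _ factorial_kernel] exI[of _ exp]) auto
  moreover have "factorial_moment (of_nat (j + 1)) / factorial_moment (of_nat j) = of_real (real (j + 1))" for j
    unfolding factorial_moment_of_nat by simp
  ultimately show ?thesis
    unfolding regular_moment_function_def
    by (intro conjI exI[of _ 1]) (simp_all del: of_nat_add of_nat_Suc)
qed

lemma moment_deriv_factorial:
  "fps_nth (moment_deriv factorial_moment h) j = of_nat (j + 1) * fps_nth h (j + 1)"
  by (simp add: moment_deriv_def factorial_moment_of_nat del: of_nat_add of_nat_Suc)

text \<open>Consecutive factorial moments have quotient \<open>j + 1\<close>, the factor of termwise differentiation.\<close>

lemma moment_deriv_var_factorial: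
  fixes f :: "'n::finite cvec \<Rightarrow> complex"
  assumes g: "g holomorphic_on ball 0 1" and f: "\<And>x. x \<in> cube 1 \<Longrightarrow> f x = g (x $ d)" and x: "x \<in> cube 1"
  shows "moment_deriv_var factorial_moment d f x = deriv g (x $ d)"
proof -
  have xd: "x $ d \<in> ball 0 1" using x by (simp add: mem_cube)
  have "fps_expansion (\<lambda>z. f (upd x d z)) 0 = fps_expansion g 0"
  proof (rule fps_expansion_cong)
    have "eventually (\<lambda>z::complex. z \<in> ball 0 1) (nhds 0)" by (intro eventually_nhds_in_open) auto
    then show "eventually (\<lambda>z. f (upd x d z) = g z) (nhds 0)"
    proof eventually_elim
      case (elim z)
      then have "upd x d z \<in> cube 1" by (intro upd_in_cube x) auto
      from f[OF this] show ?case by simp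
    qed
  qed
  then have "moment_deriv_var factorial_moment d f x = eval_fps (moment_deriv factorial_moment (fps_expansion g 0)) (x $ d)"
    by (simp add: moment_deriv_var_def)
  also have "\<dots> = (\<Sum>n. (deriv ^^ n) (deriv g) 0 / fact n * (x $ d) ^ n)"
    unfolding eval_fps_def
  proof (intro suminf_cong arg_cong2[where f = "(*)"] refl)
    fix n
    have "(deriv ^^ Suc n) g 0 = (deriv ^^ n) (deriv g) 0"
      by (simp add: funpow_Suc_right del: funpow.simps)
    then show "fps_nth (moment_deriv factorial_moment (fps_expansion g 0)) n = (deriv ^^ n) (deriv g) 0 / fact n"
      unfolding moment_deriv_factorial fps_expansion_def fps_nth_Abs_fps Suc_eq_plus1[symmetric]
      by (simp del: funpow.simps of_nat_Suc)
  qed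
  also have "\<dots> = deriv g (x $ d)"
    by (rule sums_unique[symmetric], rule taylor_series[OF _ xd]) (intro holomorphic_intros g, simp)
  finally show ?thesis .
qed

lemma moment_deriv_var_factorial_power:
  fixes f :: "'n::finite cvec \<Rightarrow> complex"
  assumes g: "g holomorphic_on ball 0 1" and f: "\<And>x. x \<in> cube 1 \<Longrightarrow> f x = g (x $ d)" and x: "x \<in> cube 1"
  shows "(moment_deriv_var factorial_moment d ^^ k) f x = (deriv ^^ k) g (x $ d)"
  using x
proof (induction k arbitrary: x)
  case (Suc k)
  have "(deriv ^^ k) g holomorphic_on ball 0 1" by (intro holomorphic_intros g) simp
  from moment_deriv_var_factorial[OF this Suc.IH Suc.prems] show ?case by simp
qed (simp add: f)

lemma foldr_axis:
  fixes G :: "'n::finite \<Rightarrow> 'b \<Rightarrow> 'b"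
  assumes "distinct ds"
  shows "foldr (\<lambda>d. G d ^^ (axis e q $ d)) ds f = (if e \<in> set ds then (G e ^^ q) f else f)"
  using assms by (induction ds) (auto simp: axis_def)

lemma moment_deriv_vec_axis:
  fixes e :: "'n::{finite,linorder}"
  shows "moment_deriv_vec m (axis e q) f = (moment_deriv_var (m e) e ^^ q) f"
  unfolding moment_deriv_vec_def using foldr_axis[where ds = "sorted_list_of_set UNIV" and G = "\<lambda>d. moment_deriv_var (m d) d"] by simp

lemma holomorphic_vec_component:
  fixes d :: "'n::finite"
  assumes g: "g holomorphic_on ball 0 1"
  shows "holomorphic_vec (\<lambda>x. g (x $ d)) (cube 1)"
  unfolding holomorphic_vec_def
proof
  fix x :: "'n cvec" assume "x \<in> cube 1"
  then have "x $ d \<in> ball 0 1" by (simp add: mem_cube)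
  then have "(g has_field_derivative deriv g (x $ d)) (at (x $ d))"
    using g by (intro holomorphic_derivI) auto
  then have "(g has_derivative (*) (deriv g (x $ d))) (at (x $ d))" by (simp add: has_field_derivative_def)
  moreover have "((\<lambda>x :: 'n cvec. x $ d) has_derivative (\<lambda>h. h $ d)) (at x)"
    by (intro bounded_linear_imp_has_derivative bounded_linear_vec_nth)
  ultimately
  have "((\<lambda>x. g (x $ d)) has_derivative (\<lambda>h. deriv g (x $ d) * h $ d)) (at x)"
    using diff_chain_at[of "\<lambda>x. x $ d" "\<lambda>h. h $ d" x g] by (simp add: o_def)
  also have "(\<lambda>h. deriv g (x $ d) * h $ d) = (\<lambda>h. \<Sum>e\<in>UNIV. axis d (deriv g (x $ d)) $ e * h $ e)"
    by (auto simp: axis_def if_distrib[of "\<lambda>a. a * _"] cong: if_cong)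
  finally show "\<exists>c. ((\<lambda>x. g (x $ d)) has_derivative (\<lambda>h. \<Sum>d\<in>UNIV. c $ d * h $ d)) (at x)" by blast
qed

section \<open>A heat-type equation\<close>

definition geometric :: "complex \<Rightarrow> complex" where "geometric z = inverse (1 - z)"

lemma geometric_holomorphic: "geometric holomorphic_on ball 0 1"
  unfolding geometric_def by (intro holomorphic_intros) auto

lemma higher_deriv_geometric: "(deriv ^^ n) geometric 0 = fact n"
proof -
  have "geometric has_fps_expansion Abs_fps (\<lambda>n. 1)"
  proof (rule has_fps_expansionI)
    have "eventually (\<lambda>z::complex. z \<in> ball 0 1) (nhds 0)" by (intro eventually_nhds_in_open) auto
    then show "eventually (\<lambda>z. (\<lambda>n. fps_nth (Abs_fps (\<lambda>n. 1)) n * z ^ n) sums geometric z) (nhds 0)"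
      by eventually_elim (use geometric_sums in \<open>auto simp: geometric_def divide_inverse\<close>)
  qed
  from fps_nth_fps_expansion[OF this, of n] show ?thesis by simp
qed

text \<open>The equation \<open>\<partial>\<^sub>t u = \<partial>\<^sub>x\<^sup>q u\<close> in the variable \<open>x\<^sub>e\<close>, with \<open>u = 1 / (1 - x\<^sub>e)\<close> at \<open>t = 0\<close>.\<close>

definition heat_problem :: "nat \<Rightarrow> 'n \<Rightarrow> ('n::{finite,linorder}) cauchy_problem" where
  "heat_problem q e = \<lparr>ord_t = 1, ord_x = (\<chi> d. 1), mom_t = factorial_moment, mom_x = (\<lambda>_. factorial_moment),
     kappa = 1, degrees = {1}, Lam = (\<lambda>_. {[(0, axis e q, 1)]}), t_exp = (\<lambda>_. 0), coef = (\<lambda>_ _ _. 1),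
     rad_t = 1, rad_x = (\<chi> d. 1), inhom = (\<lambda>_. 0), init_data = (\<lambda>_ x. geometric (x $ e))\<rparr>"

definition heat_solution :: "nat \<Rightarrow> 'n \<Rightarrow> ('n::{finite,linorder}) cvec \<Rightarrow> complex fps" where
  "heat_solution q e x = Abs_fps (\<lambda>j. (deriv ^^ (q * j)) geometric (x $ e) / fact j)"

lemma heat_cauchy_data: "cauchy_data (heat_problem q e)"
proof -
  have "((\<lambda>(t :: complex, x :: 'a cvec). 1 :: complex) has_derivative (\<lambda>(\<tau>, h). 0 * \<tau> + (\<Sum>d\<in>UNIV. (0 :: 'a cvec) $ d * h $ d))) (at z)" for z
    by (simp add: case_prod_unfold)
  then have "holomorphic_time_vec (\<lambda>t x. 1) U" for U :: "(complex \<times> 'a cvec) set"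
    unfolding holomorphic_time_vec_def by blast
  moreover have "holomorphic_fps \<rho> (\<lambda>x. 0)" for \<rho> :: "'a rvec"
    unfolding holomorphic_fps_def holomorphic_vec_def
    by (intro allI ballI exI[of _ 0]) auto
  moreover have "\<exists>x :: 'a cvec. x \<in> cube 1" by (rule exI[of _ 0]) (simp add: mem_cube)
  ultimately show ?thesis
    unfolding cauchy_data_def heat_problem_def
    using factorial_moment_regular holomorphic_vec_component[OF geometric_holomorphic, of e] by auto
qed

lemma heat_order_condition: "order_condition (heat_problem q e)"
  by (simp add: order_condition_def heat_problem_def)

lemma heat_critical_value:
  assumes "q > 1"
  shows "critical_value (heat_problem q e) = real q - 1"
proof -
  let ?P = "heat_problem q e"
  have "lambda_sq ?P (axis e q) = (\<Sum>d\<in>UNIV. if d = e then real q else 0)"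
    unfolding lambda_sq_def by (rule sum.cong) (auto simp: heat_problem_def axis_def)
  then have l: "lambda_sq ?P (axis e q) = real q" by simp
  then have t: "total_order ?P [(0, axis e q, 1)] = real q" by (simp add: total_order_def)
  have "crit_tuples ?P = {[(0, axis e q, 1)]}"
    using t assms by (auto simp: crit_tuples_def heat_problem_def)
  then show ?thesis using t assms by (simp add: critical_value_def) (simp add: heat_problem_def)
qed

lemma heat_formal_solution: "formal_solution (heat_problem q e) (heat_solution q e)"
proof -
  let ?h = "\<lambda>k. (deriv ^^ k) geometric"
  have hol: "?h k holomorphic_on ball 0 1" for k by (intro holomorphic_intros geometric_holomorphic) simp
  have hol': "(\<lambda>z. ?h k z / fact j) holomorphic_on ball 0 1" for k j by (intro holomorphic_intros hol) auto
  have one: "fps_expansion (\<lambda>t. 1) 0 = 1"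
    using fps_nth_fps_expansion[OF has_fps_expansion_1] by (simp add: fps_expansion_def fps_eq_iff)
  have dx: "moment_deriv_coeffs (\<lambda>_. factorial_moment) (axis e q) (heat_solution q e) x =
      Abs_fps (\<lambda>j. ?h (q * j + q) (x $ e) / fact j)" if x: "x \<in> cube 1" for x
  proof (rule fps_ext)
    fix j
    have "fps_nth (moment_deriv_coeffs (\<lambda>_. factorial_moment) (axis e q) (heat_solution q e) x) j =
        (moment_deriv_var factorial_moment e ^^ q) (\<lambda>y. ?h (q * j) (y $ e) / fact j) x"
      by (simp add: moment_deriv_coeffs_def moment_deriv_vec_axis heat_solution_def)
    also have "\<dots> = (deriv ^^ q) (\<lambda>z. ?h (q * j) z / fact j) (x $ e)"
      by (rule moment_deriv_var_factorial_power[OF hol' _ x]) simp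
    also have "\<dots> = (deriv ^^ q) (\<lambda>z. (1 / fact j) * ?h (q * j) z) (x $ e)" by simp
    also have "\<dots> = (1 / fact j) * (deriv ^^ q) (?h (q * j)) (x $ e)"
      by (rule higher_deriv_cmult[OF hol]) (use x in \<open>auto simp: mem_cube\<close>)
    also have "(deriv ^^ q) (?h (q * j)) = ?h (q * j + q)" by (simp add: funpow_add add.commute)
    finally show "fps_nth (moment_deriv_coeffs (\<lambda>_. factorial_moment) (axis e q) (heat_solution q e) x) j =
        fps_nth (Abs_fps (\<lambda>j. ?h (q * j + q) (x $ e) / fact j)) j" by simp
  qed
  have dt: "moment_deriv factorial_moment (heat_solution q e x) = Abs_fps (\<lambda>j. ?h (q * j + q) (x $ e) / fact j)" for x
    by (rule fps_ext) (simp add: moment_deriv_factorial heat_solution_def add.commute del: of_nat_Suc)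
  show ?thesis
    unfolding formal_solution_def
  proof (intro conjI ballI allI impI)
    show "holomorphic_fps (rad_x (heat_problem q e)) (heat_solution q e)"
      unfolding holomorphic_fps_def
    proof
      fix j
      show "holomorphic_vec (\<lambda>x. fps_nth (heat_solution q e x) j) (polydisc (rad_x (heat_problem q e)))"
        using holomorphic_vec_component[OF hol'[of "q * j" j], of e] by (simp add: heat_problem_def heat_solution_def)
    qed
  next
    fix x assume "x \<in> polydisc (rad_x (heat_problem q e))"
    then have x: "x \<in> cube 1" by (simp add: heat_problem_def)
    show "(moment_deriv (mom_t (heat_problem q e)) ^^ kappa (heat_problem q e)) (heat_solution q e x) -
       (\<Sum>n\<in>degrees (heat_problem q e). \<Sum>w\<in>Lam (heat_problem q e) n.
          fps_X ^ t_exp (heat_problem q e) w * fps_expansion (\<lambda>t. coef (heat_problem q e) w t x) 0 *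
          (\<Prod>(i, qa, r)\<leftarrow>w. (moment_deriv (mom_t (heat_problem q e)) ^^ i)
             (moment_deriv_coeffs (mom_x (heat_problem q e)) qa (heat_solution q e) x) ^ r)) =
       inhom (heat_problem q e) x"
      by (simp add: heat_problem_def one dx[OF x] dt)
  next
    fix j x assume "j < kappa (heat_problem q e)"
    then show "fps_nth ((moment_deriv (mom_t (heat_problem q e)) ^^ j) (heat_solution q e x)) 0 =
        init_data (heat_problem q e) j x"
      by (simp add: heat_problem_def heat_solution_def)
  qed
qed

text \<open>For every \<open>x > 0\<close> the factorial \<open>j!\<close> is at least \<open>x\<^sup>j exp (- x)\<close>; take \<open>x\<close> with
  \<open>x\<^sup>\<epsilon> = 2 K\<close>.\<close>

lemma factorial_beats_geometric:
  fixes \<epsilon> C K :: real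
  assumes \<epsilon>: "\<epsilon> > 0" and K: "K > 0" and b: "\<And>j. fact j powr \<epsilon> \<le> C * K ^ j"
  shows False
proof -
  define x where "x = (2 * K) powr (1 / \<epsilon>)"
  have x: "x > 0" "x powr \<epsilon> = 2 * K" using K \<epsilon> by (simp_all add: x_def powr_powr)
  have "2 ^ j \<le> C * exp x powr \<epsilon>" for j
  proof -
    have "x ^ j / exp x \<le> fact j"
      using power_div_fact_le_exp[of x j] x by (simp add: field_simps)
    then have "(x ^ j / exp x) powr \<epsilon> \<le> fact j powr \<epsilon>" using \<epsilon> x by (intro powr_mono2) auto
    also have "(x ^ j / exp x) powr \<epsilon> = (2 * K) ^ j / exp x powr \<epsilon>"
    proof -
      have "(x ^ j) powr \<epsilon> = (x powr \<epsilon>) ^ j" using x(1) by (simp add: powr_powr powr_realpow[symmetric] mult.commute)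
      then show ?thesis using x by (simp add: powr_divide)
    qed
    finally have "(2 * K) ^ j / exp x powr \<epsilon> \<le> C * K ^ j" using b[of j] by linarith
    then have "2 ^ j * K ^ j \<le> (C * exp x powr \<epsilon>) * K ^ j"
      by (simp add: power_mult_distrib pos_divide_le_eq mult_ac)
    then show ?thesis using K by simp
  qed
  moreover obtain j where "C * exp x powr \<epsilon> < 2 ^ j" using real_arch_pow[of 2] by auto
  ultimately show False using not_le by blast
qed

text \<open>At \<open>x = 0\<close> the coefficients are \<open>(q j)! / j!\<close>, at least \<open>j!\<close> to the power \<open>q - 1\<close>.\<close>

lemma heat_not_gevrey:
  assumes \<sigma>: "0 \<le> \<sigma>" "\<sigma> < real q - 1"
  shows "\<not> gevrey \<rho> \<sigma> (heat_solution q e)"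
proof
  assume "gevrey \<rho> \<sigma> (heat_solution q e)"
  then obtain r C K where r: "r > 0" and C: "C > 0" and K: "K > 0"
    and b: "\<And>x j. x \<in> cube r \<Longrightarrow> cmod (fps_nth (heat_solution q e x) j) \<le> C * K ^ j * Gamma (1 + \<sigma> * real j)"
    unfolding gevrey_def by blast
  obtain G where G: "G \<ge> 1" "\<And>j. Gamma (1 + \<sigma> * real j) \<le> G ^ j * fact j powr \<sigma>"
    using Gamma_fact_powr[OF \<sigma>(1)] by metis
  have "fact j powr (real q - 1 - \<sigma>) \<le> C * (K * G) ^ j" for j
  proof -
    have "0 \<in> cube r" using r by (simp add: mem_cube)
    from b[OF this, of j] have 1: "fact (q * j) / fact j \<le> C * K ^ j * Gamma (1 + \<sigma> * real j)"
      by (simp add: heat_solution_def higher_deriv_geometric norm_divide)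
    have "fact j powr (real q - 1 - \<sigma>) * fact j powr \<sigma> * fact j = (fact j powr real q :: real)"
      by (simp add: powr_diff)
    also have "\<dots> = fact j ^ q" by (simp add: powr_realpow)
    also have "\<dots> \<le> fact (q * j)" by (rule fact_power_le)
    finally have "fact j powr (real q - 1 - \<sigma>) * fact j powr \<sigma> \<le> fact (q * j) / (fact j :: real)"
      by (simp add: pos_le_divide_eq)
    also have "\<dots> \<le> C * K ^ j * (G ^ j * fact j powr \<sigma>)"
      using 1 G(2)[of j] C K by (meson mult_left_mono order_trans mult_nonneg_nonneg less_imp_le zero_le_power)
    also have "\<dots> = C * (K * G) ^ j * fact j powr \<sigma>" by (simp add: power_mult_distrib)
    finally show ?thesis by simp
  qed
  then show False using factorial_beats_geometric[of "real q - 1 - \<sigma>" "K * G" C] \<sigma> K G by simp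
qed

lemma gevrey_zero:
  assumes "\<And>d. 0 < \<rho> $ d" "0 \<le> \<sigma>"
  shows "gevrey \<rho> \<sigma> (\<lambda>x. 0)"
  by (rule factorially_bounded_imp_gevrey[OF factorially_bounded_0]) (use assms in auto)

theorem theorem5p7:
  shows
    "(\<forall>(P :: ('n::{finite,linorder}) cauchy_problem) u.
        cauchy_data P \<longrightarrow> order_condition P \<longrightarrow> formal_solution P u \<longrightarrow>
          (\<forall>\<sigma>\<ge>critical_value P. gevrey (rad_x P) \<sigma> u \<longleftrightarrow> gevrey (rad_x P) \<sigma> (inhom P)) \<and>
          (\<forall>\<sigma>. 0 \<le> \<sigma> \<longrightarrow> \<sigma> < critical_value P \<longrightarrow> gevrey (rad_x P) \<sigma> (inhom P) \<longrightarrow>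
             gevrey (rad_x P) (critical_value P) u)) \<and>
     (\<forall>\<sigma>\<ge>0. \<exists>(Q :: 'n cauchy_problem) u.
        cauchy_data Q \<and> order_condition Q \<and> formal_solution Q u \<and>
        \<sigma> < critical_value Q \<and> gevrey (rad_x Q) \<sigma> (inhom Q) \<and>
        (\<forall>\<sigma>'. 0 \<le> \<sigma>' \<longrightarrow> \<sigma>' < critical_value Q \<longrightarrow> \<not> gevrey (rad_x Q) \<sigma>' u))"
proof (intro conjI allI impI)
  fix P :: "'n cauchy_problem" and u and \<sigma> :: real
  assume d: "cauchy_data P" "order_condition P" and u: "formal_solution P u"
  have c0: "0 \<le> critical_value P" by (rule critical_value_bounds(1)[OF d])
  show "gevrey (rad_x P) \<sigma> u \<longleftrightarrow> gevrey (rad_x P) \<sigma> (inhom P)" if "critical_value P \<le> \<sigma>"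
    using solution_gevrey_iff[OF d u that] that c0 by linarith
  assume \<sigma>: "0 \<le> \<sigma>" "\<sigma> < critical_value P" and f: "gevrey (rad_x P) \<sigma> (inhom P)"
  have hf: "holomorphic_fps (rad_x P) (inhom P)" and rad: "\<And>d. 0 < rad_x P $ d"
    using d(1) by (auto simp: cauchy_data_def)
  have "factorially_bounded (critical_value P) (inhom P)"
    by (rule factorially_bounded_mono[OF gevrey_imp_factorially_bounded[OF f hf \<sigma>(1)]]) (use \<sigma> in simp)
  then have "gevrey (rad_x P) (critical_value P) (inhom P)"
    by (rule factorially_bounded_imp_gevrey) (use rad c0 in auto)
  then show "gevrey (rad_x P) (critical_value P) u"
    using solution_gevrey_iff[OF d u order_refl c0] by blast
next
  fix \<sigma> :: real assume \<sigma>: "0 \<le> \<sigma>"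
  obtain q :: nat where "\<sigma> + 1 < real q" using reals_Archimedean2 by blast
  then have q: "q > 1" "\<sigma> < real q - 1" using \<sigma> by linarith+
  fix e :: 'n
  let ?Q = "heat_problem q e"
  have "gevrey (rad_x ?Q) \<sigma> (inhom ?Q)"
    using gevrey_zero[of "\<chi> d. 1" \<sigma>] \<sigma> by (simp add: heat_problem_def)
  then show "\<exists>(Q :: 'n cauchy_problem) u.
        cauchy_data Q \<and> order_condition Q \<and> formal_solution Q u \<and>
        \<sigma> < critical_value Q \<and> gevrey (rad_x Q) \<sigma> (inhom Q) \<and>
        (\<forall>\<sigma>'. 0 \<le> \<sigma>' \<longrightarrow> \<sigma>' < critical_value Q \<longrightarrow> \<not> gevrey (rad_x Q) \<sigma>' u)"
    using heat_cauchy_data[of q e] heat_order_condition[of q e] heat_formal_solution[of q e]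
      heat_critical_value[OF q(1), of e] q(2) heat_not_gevrey
    by (intro exI[of _ ?Q] exI[of _ "heat_solution q e"]) auto
qed

end
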